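(* Consider the state-space model $$X_{k+1}=\Phi(X_k;\theta)+W_k,\quad W_k\overset{\mathrm{i.i.d.}}{\sim}\mathcal N(0,\Sigma(\theta)),\qquad Y_k=h(X_k;\theta)+V_k,\quad V_k\overset{\mathrm{i.i.d.}}{\sim}\mathcal N(0,\Gamma(\theta)),$$ with $X_k\in\mathbb R^n$, $Y_k\in\mathbb R^r$, random unknown parameter vector $\theta$, and prior density $p_0(X_0,\theta)$. Let $y_1,y_2,\dots$ be the observed data and $\mathcal Y_k=(y_1,\dots,y_k)$. Let $q_k(X_k,\theta)=\rho_k(X_k\mid\theta)\,\nu_k(\theta)$, $k\ge 1$, be a sequence of approximating densities, where each $\nu_k$ is a probability density in $\theta$ and each $\rho_k(\cdot\mid\theta)$ is a conditional probability density on $\mathbb R^n$, initialized by $\rho_0(X_0\mid\theta)\nu_0(\theta)=p_0(X_0,\theta)$. Let $\rho_k^*=\mathcal F_k^X\rho_{k-1}$ and $\nu_k^*=\mathcal F_k(\rho_{k-1},\nu_{k-1})$ be the online conditional filtering distribution and the online parameter posterior (defined in the context). Assume $\inf_\theta|\Gamma(\theta)|=\tilde C>0$, where $|\cdot|$ denotes the determinant. Then for every $k\ge 1$, both for $d$ the total variation distance and for $d$ the Hellinger distance, $$d\big(p(X_k,\theta\mid\mathcal Y_k),q_k(X_k,\theta)\big)\le \sum_{j=1}^{k-1}C(\mathcal Y_k,\tilde C,j,k)\sqrt{\mathbb E_{\theta\sim\nu_j}\big[\mathrm{KL}(\rho_j(\cdot\mid\theta)\,\|\,\rho_j^*(\cdot\mid\theta))\big]+\mathrm{KL}(\nu_j\,\|\,\nu_j^*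 )}$$ $$\qquad+\frac1{\sqrt2}\sqrt{\mathbb E_{\theta\sim\nu_k}\big[\mathrm{KL}(\rho_k(\cdot\mid\theta)\,\|\,\rho_k^*(\cdot\mid\theta))\big]+\mathrm{KL}(\nu_k\,\|\,\nu_k^* )},$$ where $$C(\mathcal Y_k,\tilde C,j,k)=\frac{(2\pi)^{-\frac{r(k-j)}2}\,\tilde C^{-\frac{k-j}2}}{\sqrt2\;p(\mathcal Y_{j+1:k}\mid\mathcal Y_j)}$$ when $d$ is the total variation distance, and $$C(\mathcal Y_k,\tilde C,j,k)=\frac{2^{(k-j)}(2\pi)^{-\frac{r(k-j)}4}\,\tilde C^{-\frac{k-j}4}}{\sqrt{2\,p(\mathcal Y_{j+1:k}\mid\mathcal Y_j)}}$$ when $d$ is the Hellinger distance. Here $\mathcal Y_{j+1:k}=(y_{j+1},\dots,y_k)$.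
   Context: Notation. $p$ denotes the probability density of the indicated random variables under the model; for instance $p(X_k,\theta\mid\mathcal Y_k)$ is the joint posterior density of $(X_k,\theta)$ given $Y_1=y_1,\dots,Y_k=y_k$, and $p(\mathcal Y_{j+1:k}\mid\mathcal Y_j)$ is the conditional density of $(Y_{j+1},\dots,Y_k)$ given $(Y_1,\dots,Y_j)$, evaluated at the data. $p_{\mathcal N}(x;\mu,R)$ is the density at $x$ of the Gaussian distribution with mean $\mu$ and covariance $R$. The covariances $\Sigma(\theta)\in\mathbb R^{n\times n}$, $\Gamma(\theta)\in\mathbb R^{r\times r}$ are positive definite. Conditionally on $\theta$, the noises $(W_k)$ and $(V_k)$ are mutually independent and independent of $X_0$. Data are received from time $1$ on. Operators. Given a family of conditional densities $\rho(\cdot\mid\theta)$ on $\mathbb R^n$ for $X_{k-1}$ and a density $\nu$ for $\theta$, let $$(\mathcal T\rho)(X_k\mid\theta)=\int p_{\mathcal N}(X_k;\Phi(X_{k-1};\theta),\Sigma(\theta))\,\rho(X_{k-1}\mid\theta)\,dX_{k-1},$$ $$(\mathcal F_k^X\rho)(X_k\mid\theta)=\frac{p_{\mathcal N}(y_k;h(X_k;\theta),\Gamma(\theta))\,(\mathcal T\rho)(X_k\mid\theta)}{\int p_{\mathcal N}(y_k;h(X;\theta),\Gamma(\theta))\,(\mathcal T\rho)(X\mid\theta)\,dX},$$ $$\mathcal F_k(\rho,\nu)(\theta)=\frac{\nu(\theta)\int p_{\mathcal N}(y_k;h(X;\theta),\Gamma(\theta))\,(\mathcal T\rho)(X\mid\theta)\,dX}{\int\nu(\theta')\int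 p_{\mathcal N}(y_k;h(X;\theta'),\Gamma(\theta'))\,(\mathcal T\rho)(X\mid\theta')\,dX\,d\theta'}.$$ Thus $\mathcal F_k^X$ maps $p(X_{k-1}\mid\theta,\mathcal Y_{k-1})$ to $p(X_k\mid\theta,\mathcal Y_k)$, and $\mathcal F_k$ maps the pair $(p(X_{k-1}\mid\theta,\mathcal Y_{k-1}),p(\theta\mid\mathcal Y_{k-1}))$ to $p(\theta\mid\mathcal Y_k)$. Divergences, for probability measures $\mu_1,\mu_2$ with densities $f_1,f_2$: $\mathrm{KL}(\mu_1\|\mu_2)=\int f_1\log\frac{f_1}{f_2}\,dx$; total variation distance $d_{TV}(\mu_1,\mu_2)=\frac12\int|f_1-f_2|\,dx$; Hellinger distance $d_H(\mu_1,\mu_2)=\sqrt{\frac12\int(\sqrt{f_1}-\sqrt{f_2})^2\,dx}$. *)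

theory Defs
  imports "HOL-Probability.Probability"
begin

section \<open>Densities\<close>

definition prob_density :: "'a measure \<Rightarrow> ('a \<Rightarrow> real) \<Rightarrow> bool" where
  "prob_density N f \<longleftrightarrow>
     f \<in> borel_measurable N \<and> (\<forall>x\<in>space N. 0 \<le> f x) \<and> (\<integral>\<^sup>+x. ennreal (f x) \<partial>N) = 1"

definition pos_def_matrix :: "real^'n^'n \<Rightarrow> bool" where
  "pos_def_matrix A \<longleftrightarrow> transpose A = A \<and> (\<forall>x. x \<noteq> 0 \<longrightarrow> 0 < x \<bullet> (A *v x))"

definition mvn_density :: "real^'n \<Rightarrow> real^'n \<Rightarrow> real^'n^'n \<Rightarrow> real" where
  "mvn_density x \<mu> R =
     exp (- ((x - \<mu>) \<bullet> (matrix_inv R *v (x - \<mu>))) / 2) / sqrt ((2 * pi) ^ CARD('n) * det R)"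

text \<open>Lebesgue measure on the parameter domain \<open>\<Theta>\<close>, a Borel subset of a Euclidean space.\<close>

abbreviation lebesgue_param :: "(real^'d) set \<Rightarrow> (real^'d) measure" where
  "lebesgue_param \<Theta> \<equiv> restrict_space lborel \<Theta>"

text \<open>A conditional density \<open>\<rho>(x | \<theta>)\<close> is written \<open>\<rho> x \<theta>\<close>.\<close>

definition cond_density :: "(real^'d) set \<Rightarrow> (real^'n \<Rightarrow> real^'d \<Rightarrow> real) \<Rightarrow> bool" where
  "cond_density \<Theta> \<rho> \<longleftrightarrow>
     (\<lambda>(x, \<theta>). \<rho> x \<theta>) \<in> borel_measurable (lborel \<Otimes>\<^sub>M lebesgue_param \<Theta>) \<and>
     (\<forall>\<theta>\<in>\<Theta>. prob_density lborel (\<lambda>x. \<rho> x \<theta>))"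


section \<open>Divergences between densities with respect to a measure \<open>N\<close>\<close>

text \<open>
  The integral of \<open>f log (f / g)\<close> as an extended number: the integral of the positive part minus
  that of the negative part, with \<open>0 log (0 / g) = 0\<close> and \<open>f log (f / 0) = \<infinity>\<close> for \<open>f > 0\<close>
  (as \<open>ln (f / 0) = 0\<close> in HOL, that point needs the case distinction).
  For probability densities the negative part has integral at most 1 and the difference is
  nonnegative, so the truncated subtraction on \<open>ennreal\<close> is the true one.
  The library's \<open>KL_divergence\<close> is real-valued and 0 in the non-integrable case.
\<close>

definition KL :: "'a measure \<Rightarrow> ('a \<Rightarrow> real) \<Rightarrow> ('a \<Rightarrow> real) \<Rightarrow> ennreal" where
  "KL N f g =
     (\<integral>\<^sup>+x. (if f x \<noteq> 0 \<and> g x = 0 then \<infinity> else ennreal (f x * ln (f x / g x))) \<partial>N)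
     - (\<integral>\<^sup>+x. ennreal (- (f x * ln (f x / g x))) \<partial>N)"

definition tv_dist :: "'a measure \<Rightarrow> ('a \<Rightarrow> real) \<Rightarrow> ('a \<Rightarrow> real) \<Rightarrow> real" where
  "tv_dist N f g = 1/2 * (LINT x|N. \<bar>f x - g x\<bar>)"

definition hellinger_dist :: "'a measure \<Rightarrow> ('a \<Rightarrow> real) \<Rightarrow> ('a \<Rightarrow> real) \<Rightarrow> real" where
  "hellinger_dist N f g = sqrt (1/2 * (LINT x|N. (sqrt (f x) - sqrt (g x))\<^sup>2))"

definition ennsqrt :: "ennreal \<Rightarrow> ennreal" where
  "ennsqrt a = (if a = \<infinity> then \<infinity> else ennreal (sqrt (enn2real a)))"


section \<open>Filtering operators\<close>

definition predict ::
  "(real^'n \<Rightarrow> real^'d \<Rightarrow> real^'n) \<Rightarrow> (real^'d \<Rightarrow> real^'n^'n) \<Rightarrow>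
   (real^'n \<Rightarrow> real^'d \<Rightarrow> real) \<Rightarrow> real^'n \<Rightarrow> real^'d \<Rightarrow> real" where
  "predict \<Phi> \<Sigma> \<rho> x \<theta> = (LINT x'|lborel. mvn_density x (\<Phi> x' \<theta>) (\<Sigma> \<theta>) * \<rho> x' \<theta>)"

definition predict_lik ::
  "(real^'n \<Rightarrow> real^'d \<Rightarrow> real^'n) \<Rightarrow> (real^'n \<Rightarrow> real^'d \<Rightarrow> real^'r) \<Rightarrow>
   (real^'d \<Rightarrow> real^'n^'n) \<Rightarrow> (real^'d \<Rightarrow> real^'r^'r) \<Rightarrow> real^'r \<Rightarrow>
   (real^'n \<Rightarrow> real^'d \<Rightarrow> real) \<Rightarrow> real^'d \<Rightarrow> real" where
  "predict_lik \<Phi> h \<Sigma> \<Gamma> yk \<rho> \<theta> =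
     (LINT x|lborel. mvn_density yk (h x \<theta>) (\<Gamma> \<theta>) * predict \<Phi> \<Sigma> \<rho> x \<theta>)"

definition filter_state ::
  "(real^'n \<Rightarrow> real^'d \<Rightarrow> real^'n) \<Rightarrow> (real^'n \<Rightarrow> real^'d \<Rightarrow> real^'r) \<Rightarrow>
   (real^'d \<Rightarrow> real^'n^'n) \<Rightarrow> (real^'d \<Rightarrow> real^'r^'r) \<Rightarrow> real^'r \<Rightarrow>
   (real^'n \<Rightarrow> real^'d \<Rightarrow> real) \<Rightarrow> real^'n \<Rightarrow> real^'d \<Rightarrow> real" where
  "filter_state \<Phi> h \<Sigma> \<Gamma> yk \<rho> x \<theta> =
     mvn_density yk (h x \<theta>) (\<Gamma> \<theta>) * predict \<Phi> \<Sigma> \<rho> x \<theta> / predict_lik \<Phi> h \<Sigma> \<Gamma> yk \<rho> \<theta>"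

definition filter_param ::
  "(real^'d) set \<Rightarrow>
   (real^'n \<Rightarrow> real^'d \<Rightarrow> real^'n) \<Rightarrow> (real^'n \<Rightarrow> real^'d \<Rightarrow> real^'r) \<Rightarrow>
   (real^'d \<Rightarrow> real^'n^'n) \<Rightarrow> (real^'d \<Rightarrow> real^'r^'r) \<Rightarrow> real^'r \<Rightarrow>
   (real^'n \<Rightarrow> real^'d \<Rightarrow> real) \<Rightarrow> (real^'d \<Rightarrow> real) \<Rightarrow> real^'d \<Rightarrow> real" where
  "filter_param \<Theta> \<Phi> h \<Sigma> \<Gamma> yk \<rho> \<nu> \<theta> =
     \<nu> \<theta> * predict_lik \<Phi> h \<Sigma> \<Gamma> yk \<rho> \<theta> /
     (LINT \<theta>'|lebesgue_param \<Theta>. \<nu> \<theta>' * predict_lik \<Phi> h \<Sigma> \<Gamma> yk \<rho> \<theta>')"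


section \<open>Densities of the state-space model\<close>

text \<open>
  Conditional densities at a data point depend on the choice of versions. Those used are the
  standard ones, which come from the product form of the joint density of
  \<open>(X 0, \<dots>, X k)\<close>, \<open>\<theta>\<close> and \<open>(Y 1, \<dots>, Y k)\<close>. Lemmas \<open>distributed_path\<close>, \<open>distributed_joint\<close> and
  \<open>distributed_evidence\<close> below show that these functions are the densities of the random variables
  of the model.
\<close>

definition path_density ::
  "(real^'n \<Rightarrow> real^'d \<Rightarrow> real^'n) \<Rightarrow> (real^'n \<Rightarrow> real^'d \<Rightarrow> real^'r) \<Rightarrow>
   (real^'d \<Rightarrow> real^'n^'n) \<Rightarrow> (real^'d \<Rightarrow> real^'r^'r) \<Rightarrow> (real^'n \<Rightarrow> real^'d \<Rightarrow> real) \<Rightarrow>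
   nat \<Rightarrow> (nat \<Rightarrow> real^'n) \<Rightarrow> real^'d \<Rightarrow> (nat \<Rightarrow> real^'r) \<Rightarrow> real" where
  "path_density \<Phi> h \<Sigma> \<Gamma> p0 k x \<theta> y =
     p0 (x 0) \<theta>
     * (\<Prod>i<k. mvn_density (x (Suc i)) (\<Phi> (x i) \<theta>) (\<Sigma> \<theta>))
     * (\<Prod>i=1..k. mvn_density (y i) (h (x i) \<theta>) (\<Gamma> \<theta>))"

text \<open>The joint density of \<open>X k\<close>, \<open>\<theta>\<close> and \<open>(Y 1, \<dots>, Y k)\<close>.\<close>

definition joint_density ::
  "(real^'n \<Rightarrow> real^'d \<Rightarrow> real^'n) \<Rightarrow> (real^'n \<Rightarrow> real^'d \<Rightarrow> real^'r) \<Rightarrow>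
   (real^'d \<Rightarrow> real^'n^'n) \<Rightarrow> (real^'d \<Rightarrow> real^'r^'r) \<Rightarrow> (real^'n \<Rightarrow> real^'d \<Rightarrow> real) \<Rightarrow>
   nat \<Rightarrow> real^'n \<Rightarrow> real^'d \<Rightarrow> (nat \<Rightarrow> real^'r) \<Rightarrow> real" where
  "joint_density \<Phi> h \<Sigma> \<Gamma> p0 k x \<theta> y =
     (LINT x'|(\<Pi>\<^sub>M i\<in>{..<k}. lborel). path_density \<Phi> h \<Sigma> \<Gamma> p0 k (x'(k := x)) \<theta> y)"

text \<open>The density of \<open>(Y 1, \<dots>, Y k)\<close>.\<close>

definition evidence ::
  "(real^'d) set \<Rightarrow>
   (real^'n \<Rightarrow> real^'d \<Rightarrow> real^'n) \<Rightarrow> (real^'n \<Rightarrow> real^'d \<Rightarrow> real^'r) \<Rightarrow>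
   (real^'d \<Rightarrow> real^'n^'n) \<Rightarrow> (real^'d \<Rightarrow> real^'r^'r) \<Rightarrow> (real^'n \<Rightarrow> real^'d \<Rightarrow> real) \<Rightarrow>
   nat \<Rightarrow> (nat \<Rightarrow> real^'r) \<Rightarrow> real" where
  "evidence \<Theta> \<Phi> h \<Sigma> \<Gamma> p0 k y =
     (LINT (x, \<theta>)|(lborel \<Otimes>\<^sub>M lebesgue_param \<Theta>). joint_density \<Phi> h \<Sigma> \<Gamma> p0 k x \<theta> y)"

text \<open>The density of \<open>(X k, \<theta>)\<close> given \<open>Y 1 = y 1, \<dots>, Y k = y k\<close>.\<close>

definition posterior ::
  "(real^'d) set \<Rightarrow>
   (real^'n \<Rightarrow> real^'d \<Rightarrow> real^'n) \<Rightarrow> (real^'n \<Rightarrow> real^'d \<Rightarrow> real^'r) \<Rightarrow>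
   (real^'d \<Rightarrow> real^'n^'n) \<Rightarrow> (real^'d \<Rightarrow> real^'r^'r) \<Rightarrow> (real^'n \<Rightarrow> real^'d \<Rightarrow> real) \<Rightarrow>
   nat \<Rightarrow> (nat \<Rightarrow> real^'r) \<Rightarrow> real^'n \<Rightarrow> real^'d \<Rightarrow> real" where
  "posterior \<Theta> \<Phi> h \<Sigma> \<Gamma> p0 k y x \<theta> =
     joint_density \<Phi> h \<Sigma> \<Gamma> p0 k x \<theta> y / evidence \<Theta> \<Phi> h \<Sigma> \<Gamma> p0 k y"

text \<open>The density of \<open>(Y (j + 1), \<dots>, Y k)\<close> given \<open>Y 1 = y 1, \<dots>, Y j = y j\<close>.\<close>

definition cond_evidence ::
  "(real^'d) set \<Rightarrow>
   (real^'n \<Rightarrow> real^'d \<Rightarrow> real^'n) \<Rightarrow> (real^'n \<Rightarrow> real^'d \<Rightarrow> real^'r) \<Rightarrow>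
   (real^'d \<Rightarrow> real^'n^'n) \<Rightarrow> (real^'d \<Rightarrow> real^'r^'r) \<Rightarrow> (real^'n \<Rightarrow> real^'d \<Rightarrow> real) \<Rightarrow>
   nat \<Rightarrow> nat \<Rightarrow> (nat \<Rightarrow> real^'r) \<Rightarrow> real" where
  "cond_evidence \<Theta> \<Phi> h \<Sigma> \<Gamma> p0 j k y =
     evidence \<Theta> \<Phi> h \<Sigma> \<Gamma> p0 k y / evidence \<Theta> \<Phi> h \<Sigma> \<Gamma> p0 j y"


section \<open>The state-space model\<close>

locale state_space_model = prob_space M
  for M :: "'a measure" +
  fixes \<Theta> :: "(real^'d) set"
    and \<Phi> :: "real^'n \<Rightarrow> real^'d \<Rightarrow> real^'n"
    and h :: "real^'n \<Rightarrow> real^'d \<Rightarrow> real^'r"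
    and \<Sigma> :: "real^'d \<Rightarrow> real^'n^'n"
    and \<Gamma> :: "real^'d \<Rightarrow> real^'r^'r"
    and p0 :: "real^'n \<Rightarrow> real^'d \<Rightarrow> real"
    and X :: "nat \<Rightarrow> 'a \<Rightarrow> real^'n"
    and \<theta> :: "'a \<Rightarrow> real^'d"
    and W :: "nat \<Rightarrow> 'a \<Rightarrow> real^'n"
    and V :: "nat \<Rightarrow> 'a \<Rightarrow> real^'r"
    and Y :: "nat \<Rightarrow> 'a \<Rightarrow> real^'r"
  assumes Theta_borel: "\<Theta> \<in> sets borel"
    and Phi_measurable: "(\<lambda>(x, t). \<Phi> x t) \<in> borel_measurable (lborel \<Otimes>\<^sub>M lebesgue_param \<Theta>)"
    and h_measurable: "(\<lambda>(x, t). h x t) \<in> borel_measurable (lborel \<Otimes>\<^sub>M lebesgue_param \<Theta>)"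
    and Sigma_measurable: "\<Sigma> \<in> borel_measurable (lebesgue_param \<Theta>)"
    and Gamma_measurable: "\<Gamma> \<in> borel_measurable (lebesgue_param \<Theta>)"
    and Sigma_pos_def: "\<And>t. t \<in> \<Theta> \<Longrightarrow> pos_def_matrix (\<Sigma> t)"
    and Gamma_pos_def: "\<And>t. t \<in> \<Theta> \<Longrightarrow> pos_def_matrix (\<Gamma> t)"
    and prior_density: "prob_density (lborel \<Otimes>\<^sub>M lebesgue_param \<Theta>) (\<lambda>(x, t). p0 x t)"
    and dynamics: "\<And>k \<omega>. \<omega> \<in> space M \<Longrightarrow> X (Suc k) \<omega> = \<Phi> (X k \<omega>) (\<theta> \<omega>) + W k \<omega>"
    and observation: "\<And>k \<omega>. \<omega> \<in> space M \<Longrightarrow> 1 \<le> k \<Longrightarrow> Y k \<omega> = h (X k \<omega>) (\<theta> \<omega>) + V k \<omega>"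
    \<comment> \<open>\<open>(X 0, \<theta>)\<close> has density \<open>p0\<close>; given \<open>\<theta>\<close>, the noises are independent of each other and of
        \<open>X 0\<close>, and Gaussian with covariances \<open>\<Sigma> \<theta>\<close> and \<open>\<Gamma> \<theta>\<close>.\<close>
    and joint_law: "\<And>K. distributed M
          (lborel \<Otimes>\<^sub>M (lebesgue_param \<Theta> \<Otimes>\<^sub>M
             ((\<Pi>\<^sub>M i\<in>{..<K}. lborel) \<Otimes>\<^sub>M (\<Pi>\<^sub>M i\<in>{1..K}. lborel))))
          (\<lambda>\<omega>. (X 0 \<omega>, \<theta> \<omega>, (\<lambda>i\<in>{..<K}. W i \<omega>), (\<lambda>i\<in>{1..K}. V i \<omega>)))
          (\<lambda>(x, t, w, v). ennreal
             (p0 x t * (\<Prod>i<K. mvn_density (w i) 0 (\<Sigma> t)) * (\<Prod>i=1..K. mvn_density (v i) 0 (\<Gamma> t))))"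


section \<open>The densities of the model are those of its random variables\<close>

text \<open>\<open>traj f x w\<close> is the state trajectory started at \<open>x\<close> with transition map \<open>f\<close> and noise \<open>w\<close>.\<close>

primrec traj :: "('x::plus \<Rightarrow> 'x) \<Rightarrow> 'x \<Rightarrow> (nat \<Rightarrow> 'x) \<Rightarrow> nat \<Rightarrow> 'x" where
  "traj f x w 0 = x"
| "traj f x w (Suc i) = f (traj f x w i) + w i"

lemma traj_cong: "(\<And>j. j < i \<Longrightarrow> w j = w' j) \<Longrightarrow> traj f x w i = traj f x w' i"
  by (induction i) auto

lemma traj_upd: "i \<le> k \<Longrightarrow> traj f x (w(k := a)) i = traj f x w i"
  by (rule traj_cong) auto

lemma borel_measurable_traj:
  fixes f :: "'z \<Rightarrow> 'x::euclidean_space \<Rightarrow> 'x"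
  assumes f: "(\<lambda>(z, x). f z x) \<in> borel_measurable (N \<Otimes>\<^sub>M borel)"
    and x: "x \<in> borel_measurable N"
    and w: "\<And>j. j < i \<Longrightarrow> (\<lambda>z. w z j) \<in> borel_measurable N"
  shows "(\<lambda>z. traj (f z) (x z) (w z) i) \<in> borel_measurable N"
  using w
proof (induction i)
  case 0
  then show ?case using x by simp
next
  case (Suc i)
  have "(\<lambda>z. traj (f z) (x z) (w z) i) \<in> borel_measurable N" using Suc by simp
  then have "(\<lambda>z. (z, traj (f z) (x z) (w z) i)) \<in> N \<rightarrow>\<^sub>M N \<Otimes>\<^sub>M borel" by measurable
  from measurable_compose[OF this f]
  have "(\<lambda>z. f z (traj (f z) (x z) (w z) i)) \<in> borel_measurable N" by simp
  moreover have "(\<lambda>z. w z i) \<in> borel_measurable N" using Suc by simp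
  ultimately show ?case by simp
qed

lemma nn_integral_lborel_translate:
  fixes F :: "'a::euclidean_space \<Rightarrow> ennreal"
  assumes [measurable]: "F \<in> borel_measurable borel"
  shows "(\<integral>\<^sup>+x. F (c + x) \<partial>lborel) = (\<integral>\<^sup>+x. F x \<partial>lborel)"
proof -
  have "(\<integral>\<^sup>+x. F x \<partial>lborel) = (\<integral>\<^sup>+x. F x \<partial>distr lborel borel ((+) c))"
    by (simp add: lborel_distr_plus)
  also have "\<dots> = (\<integral>\<^sup>+x. F (c + x) \<partial>lborel)"
    by (subst nn_integral_distr) auto
  finally show ?thesis ..
qed

lemma nn_integral_path:
  fixes f :: "real^'n \<Rightarrow> real^'n" and g :: "real^'n \<Rightarrow> real^'r"
    and a p :: "real^'n \<Rightarrow> ennreal" and b :: "real^'r \<Rightarrow> ennreal"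
  assumes [measurable]: "f \<in> borel_measurable borel" "g \<in> borel_measurable borel"
    "a \<in> borel_measurable borel" "b \<in> borel_measurable borel" "p \<in> borel_measurable borel"
    and "F \<in> borel_measurable ((\<Pi>\<^sub>M i\<in>{..k}. lborel) \<Otimes>\<^sub>M (\<Pi>\<^sub>M i\<in>{1..k}. lborel))"
  shows "(\<integral>\<^sup>+x. \<integral>\<^sup>+w. \<integral>\<^sup>+v. p x * (\<Prod>i<k. a (w i)) * (\<Prod>i=1..k. b (v i))
             * F (\<lambda>i\<in>{..k}. traj f x w i, \<lambda>i\<in>{1..k}. g (traj f x w i) + v i)
             \<partial>(\<Pi>\<^sub>M i\<in>{1..k}. lborel) \<partial>(\<Pi>\<^sub>M i\<in>{..<k}. lborel) \<partial>lborel)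
       = (\<integral>\<^sup>+xs. \<integral>\<^sup>+ys. p (xs 0) * (\<Prod>i<k. a (xs (Suc i) - f (xs i))) * (\<Prod>i=1..k. b (ys i - g (xs i)))
             * F (xs, ys) \<partial>(\<Pi>\<^sub>M i\<in>{1..k}. lborel) \<partial>(\<Pi>\<^sub>M i\<in>{..k}. lborel))"
  using assms(6)
proof (induction k arbitrary: F)
  case 0
  note 0[measurable]
  interpret n: product_sigma_finite "\<lambda>_::nat. lborel :: (real^'n) measure" ..
  have *: "(\<lambda>i\<in>{0}. traj f x w i) = (\<lambda>i\<in>{0}. x)" for x w by (auto simp: restrict_def)
  have [measurable]: "F \<in> borel_measurable ((\<Pi>\<^sub>M i\<in>{0}. lborel) \<Otimes>\<^sub>M (\<Pi>\<^sub>M i\<in>{}. lborel))"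
    using 0 by simp
  have E: "(\<lambda>_::nat. undefined) \<in> space (\<Pi>\<^sub>M i\<in>{}. lborel :: (real^'r) measure)"
    by (simp add: space_PiM)
  have [measurable]: "(\<lambda>xs. F (xs, \<lambda>_. undefined)) \<in> borel_measurable (\<Pi>\<^sub>M i\<in>{0}. lborel)"
    using E by measurable
  have "(\<integral>\<^sup>+xs. p (xs 0) * F (xs, \<lambda>_. undefined) \<partial>(\<Pi>\<^sub>M i\<in>{0}. lborel))
     = (\<integral>\<^sup>+x. \<integral>\<^sup>+xs. p ((\<lambda>i\<in>{0::nat}. x) 0) * F (\<lambda>i\<in>{0}. x, \<lambda>_. undefined) \<partial>(\<Pi>\<^sub>M i\<in>({}::nat set). lborel :: (real^'n) measure) \<partial>lborel)"
  proof -
    have "(\<integral>\<^sup>+xs. p (xs 0) * F (xs, \<lambda>_. undefined) \<partial>(\<Pi>\<^sub>M i\<in>{0}. lborel))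
     = (\<integral>\<^sup>+xs. p (xs 0) * F (xs, \<lambda>_. undefined) \<partial>distr lborel (\<Pi>\<^sub>M i\<in>{0}. lborel) (\<lambda>x. \<lambda>i\<in>{0}. x))"
      using n.distr_component[of 0] by simp
    also have "\<dots> = (\<integral>\<^sup>+x. p x * F (\<lambda>i\<in>{0}. x, \<lambda>_. undefined) \<partial>lborel)"
      by (subst nn_integral_distr) auto
    finally show ?thesis by (simp add: nn_integral_empty PiM_empty)
  qed
  then show ?case
    by (simp add: * PiM_empty nn_integral_count_space_finite restrict_def cong: if_cong)
next
  case (Suc k)
  note Suc.prems[measurable]
  interpret n: product_sigma_finite "\<lambda>_::nat. lborel :: (real^'n) measure" ..
  interpret r: product_sigma_finite "\<lambda>_::nat. lborel :: (real^'r) measure" ..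
  have sn: "sigma_finite_measure (\<Pi>\<^sub>M i\<in>I. lborel :: (real^'n) measure)" if "finite I" for I :: "nat set"
    by (rule n.sigma_finite[OF that])
  have sr: "sigma_finite_measure (\<Pi>\<^sub>M i\<in>I. lborel :: (real^'r) measure)" if "finite I" for I :: "nat set"
    by (rule r.sigma_finite[OF that])
  note [measurable (raw)] = sigma_finite_measure.borel_measurable_nn_integral[OF sn]
     sigma_finite_measure.borel_measurable_nn_integral[OF sr]
  let ?Pn = "\<lambda>I. \<Pi>\<^sub>M i\<in>I. lborel :: (real^'n) measure"
  let ?Pr = "\<lambda>I. \<Pi>\<^sub>M i\<in>I. lborel :: (real^'r) measure"
  have in1: "{..<Suc k} = insert k {..<k}" "{..Suc k} = insert (Suc k) {..k}" by auto
  have ir1: "{1..Suc k} = insert (Suc k) {1..k}" by auto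
  have comp: "(\<lambda>z. x z i) \<in> borel_measurable N" if "x \<in> N \<rightarrow>\<^sub>M ?Pn I" "i \<in> I" for N :: "'z measure" and x i I
    using measurable_compose[OF that(1) measurable_component_singleton[OF that(2)]] by simp
  have compr: "(\<lambda>z. x z i) \<in> borel_measurable N" if "x \<in> N \<rightarrow>\<^sub>M ?Pr I" "i \<in> I" for N :: "'z measure" and x i I
    using measurable_compose[OF that(1) measurable_component_singleton[OF that(2)]] by simp
  have trajm [measurable (raw)]: "(\<lambda>z. traj f (x z) (w z) i) \<in> borel_measurable N"
    if [measurable]: "x \<in> borel_measurable N" "w \<in> N \<rightarrow>\<^sub>M ?Pn I" and "{..<i} \<subseteq> I" for N :: "'z measure" and x w i I
    using that by (intro borel_measurable_traj) (auto intro!: comp[OF that(2)])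
  let ?A = "\<lambda>w. \<Prod>i<k. a (w i)" and ?B = "\<lambda>v. \<Prod>i=1..k. b (v i)"
  let ?xs = "\<lambda>x w. \<lambda>i\<in>{..k}. traj f x w i" and ?ys = "\<lambda>x w v. \<lambda>i\<in>{1..k}. g (traj f x w i) + v i"
  define G where "G = (\<lambda>(xs, ys). \<integral>\<^sup>+\<alpha>. \<integral>\<^sup>+\<beta>. a \<alpha> * b \<beta> *
      F (xs(Suc k := f (xs k) + \<alpha>), ys(Suc k := g (f (xs k) + \<alpha>) + \<beta>)) \<partial>lborel \<partial>lborel)"
  have updn: "(\<lambda>z. (x z)(Suc k := c z)) \<in> N \<rightarrow>\<^sub>M ?Pn {..Suc k}"
    if "x \<in> N \<rightarrow>\<^sub>M ?Pn {..k}" "c \<in> borel_measurable N" for N :: "'z measure" and x c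
    using that by (intro measurable_fun_upd[where J="{..k}"]) auto
  have updr: "(\<lambda>z. (x z)(Suc k := c z)) \<in> N \<rightarrow>\<^sub>M ?Pr {1..Suc k}"
    if "x \<in> N \<rightarrow>\<^sub>M ?Pr {1..k}" "c \<in> borel_measurable N" for N :: "'z measure" and x c
    using that by (intro measurable_fun_upd[where J="{1..k}"]) auto
  have Fm: "(\<lambda>z. F ((x z)(Suc k := c z), (y z)(Suc k := d z))) \<in> borel_measurable N"
    if "x \<in> N \<rightarrow>\<^sub>M ?Pn {..k}" "c \<in> borel_measurable N"
       "y \<in> N \<rightarrow>\<^sub>M ?Pr {1..k}" "d \<in> borel_measurable N" for N :: "'z measure" and x c y d
    using measurable_compose[OF measurable_Pair[OF updn[OF that(1,2)] updr[OF that(3,4)]] Suc.prems] by simp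
  have [measurable]: "G \<in> borel_measurable (?Pn {..k} \<Otimes>\<^sub>M ?Pr {1..k})"
    unfolding G_def split_beta'
    supply Fm[measurable (raw)] comp[measurable (raw)] by measurable
  note Fm[measurable (raw)] comp[measurable (raw)] compr[measurable (raw)]
  have xsS: "(\<lambda>i\<in>{..Suc k}. traj f x (w(k := \<alpha>)) i) = (?xs x w)(Suc k := f (?xs x w k) + \<alpha>)" for x w \<alpha>
    by (auto simp: fun_eq_iff restrict_def traj_upd)
  have ysS: "(\<lambda>i\<in>{1..Suc k}. g (traj f x (w(k := \<alpha>)) i) + (v(Suc k := \<beta>)) i)
      = (?ys x w v)(Suc k := g (f (?xs x w k) + \<alpha>) + \<beta>)" for x w v \<alpha> \<beta>
    by (auto simp: fun_eq_iff restrict_def traj_upd)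
  have AS: "(\<Prod>i<Suc k. a ((w(k := \<alpha>)) i)) = ?A w * a \<alpha>" for w \<alpha> by simp
  have BS: "(\<Prod>i=1..Suc k. b ((v(Suc k := \<beta>)) i)) = ?B v * b \<beta>" for v \<beta> by simp
  have fswap: "(\<integral>\<^sup>+\<alpha>. \<integral>\<^sup>+v. H \<alpha> v \<partial>?Pr {1..k} \<partial>lborel) = (\<integral>\<^sup>+v. \<integral>\<^sup>+\<alpha>. H \<alpha> v \<partial>lborel \<partial>?Pr {1..k})"
    if "(\<lambda>(\<alpha>, v). H \<alpha> v) \<in> borel_measurable (lborel \<Otimes>\<^sub>M ?Pr {1..k})" for H :: "real^'n \<Rightarrow> (nat \<Rightarrow> real^'r) \<Rightarrow> ennreal"
  proof -
    interpret pair_sigma_finite "lborel :: (real^'n) measure" "?Pr {1..k}"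
      by (intro pair_sigma_finite.intro sr sigma_finite_lborel) simp
    show ?thesis using Fubini'[OF that] by simp
  qed
  have xsm: "(\<lambda>z. \<lambda>i\<in>{..m}. traj f (x z) (w z) i) \<in> N \<rightarrow>\<^sub>M ?Pn {..m}"
    if "x \<in> borel_measurable N" "w \<in> N \<rightarrow>\<^sub>M ?Pn {..<m}" for N :: "'z measure" and x w m
    by (intro measurable_restrict) (use trajm[OF that] in auto)
  have ysm: "(\<lambda>z. \<lambda>i\<in>{1..m}. g (traj f (x z) (w z) i) + v z i) \<in> N \<rightarrow>\<^sub>M ?Pr {1..m}"
    if [measurable]: "x \<in> borel_measurable N" "w \<in> N \<rightarrow>\<^sub>M ?Pn {..<m}" "v \<in> N \<rightarrow>\<^sub>M ?Pr {1..m}"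
    for N :: "'z measure" and x w v m
  proof (intro measurable_restrict)
    fix i assume i: "i \<in> {1..m}"
    then have [measurable]: "(\<lambda>z. traj f (x z) (w z) i) \<in> borel_measurable N"
      by (intro trajm[OF that(1,2)]) auto
    show "(\<lambda>z. g (traj f (x z) (w z) i) + v z i) \<in> N \<rightarrow>\<^sub>M lborel"
      using compr[OF that(3) i] by simp
  qed
  have pull: "(\<integral>\<^sup>+\<alpha>. \<integral>\<^sup>+\<beta>. c * H \<alpha> \<beta> \<partial>lborel \<partial>lborel) = c * (\<integral>\<^sup>+\<alpha>. \<integral>\<^sup>+\<beta>. H \<alpha> \<beta> \<partial>lborel \<partial>lborel)"
    if [measurable]: "(\<lambda>(\<alpha>, \<beta>). H \<alpha> \<beta>) \<in> borel_measurable (lborel \<Otimes>\<^sub>M lborel)"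
    for c and H :: "real^'n \<Rightarrow> real^'r \<Rightarrow> ennreal"
    by (simp add: nn_integral_cmult)
  note [measurable (raw)] = xsm ysm
  have L: "(\<integral>\<^sup>+w. \<integral>\<^sup>+v. p x * (\<Prod>i<Suc k. a (w i)) * (\<Prod>i=1..Suc k. b (v i))
             * F (\<lambda>i\<in>{..Suc k}. traj f x w i, \<lambda>i\<in>{1..Suc k}. g (traj f x w i) + v i)
             \<partial>?Pr {1..Suc k} \<partial>?Pn {..<Suc k})
       = (\<integral>\<^sup>+w. \<integral>\<^sup>+v. p x * ?A w * ?B v * G (?xs x w, ?ys x w v) \<partial>?Pr {1..k} \<partial>?Pn {..<k})" for x
  proof -
    have "(\<integral>\<^sup>+w. \<integral>\<^sup>+v. p x * (\<Prod>i<Suc k. a (w i)) * (\<Prod>i=1..Suc k. b (v i))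
             * F (\<lambda>i\<in>{..Suc k}. traj f x w i, \<lambda>i\<in>{1..Suc k}. g (traj f x w i) + v i)
             \<partial>?Pr {1..Suc k} \<partial>?Pn {..<Suc k})
      = (\<integral>\<^sup>+w. \<integral>\<^sup>+\<alpha>. \<integral>\<^sup>+v. p x * (\<Prod>i<Suc k. a ((w(k := \<alpha>)) i)) * (\<Prod>i=1..Suc k. b (v i))
             * F (\<lambda>i\<in>{..Suc k}. traj f x (w(k := \<alpha>)) i, \<lambda>i\<in>{1..Suc k}. g (traj f x (w(k := \<alpha>)) i) + v i)
             \<partial>?Pr {1..Suc k} \<partial>lborel \<partial>?Pn {..<k})"
      by (rule n.product_nn_integral_insert[of "{..<k}" k, folded in1]) (simp, simp, measurable)
    also have "\<dots> = (\<integral>\<^sup>+w. \<integral>\<^sup>+\<alpha>. \<integral>\<^sup>+v. \<integral>\<^sup>+\<beta>. p x * (?A w * a \<alpha>) * (?B v * b \<beta>)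
             * F ((?xs x w)(Suc k := f (?xs x w k) + \<alpha>), (?ys x w v)(Suc k := g (f (?xs x w k) + \<alpha>) + \<beta>))
             \<partial>lborel \<partial>?Pr {1..k} \<partial>lborel \<partial>?Pn {..<k})"
      unfolding xsS[symmetric] ysS[symmetric] AS[symmetric] BS[symmetric]
    proof (intro nn_integral_cong r.product_nn_integral_insert[of "{1..k}" "Suc k", folded ir1])
      fix w \<alpha> assume w: "w \<in> space (?Pn {..<k})"
      have [measurable]: "w(k := \<alpha>) \<in> space (?Pn {..<Suc k})"
        using w by (auto simp: space_PiM PiE_iff extensional_def)
      show "(\<lambda>v. p x * (\<Prod>i<Suc k. a ((w(k := \<alpha>)) i)) * (\<Prod>i=1..Suc k. b (v i))
             * F (\<lambda>i\<in>{..Suc k}. traj f x (w(k := \<alpha>)) i, \<lambda>i\<in>{1..Suc k}. g (traj f x (w(k := \<alpha>)) i) + v i))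
           \<in> borel_measurable (?Pr {1..Suc k})"
        by measurable
    qed simp_all
    also have "\<dots> = (\<integral>\<^sup>+w. \<integral>\<^sup>+v. \<integral>\<^sup>+\<alpha>. \<integral>\<^sup>+\<beta>. p x * (?A w * a \<alpha>) * (?B v * b \<beta>)
             * F ((?xs x w)(Suc k := f (?xs x w k) + \<alpha>), (?ys x w v)(Suc k := g (f (?xs x w k) + \<alpha>) + \<beta>))
             \<partial>lborel \<partial>lborel \<partial>?Pr {1..k} \<partial>?Pn {..<k})"
    proof (intro nn_integral_cong fswap)
      fix w assume [measurable]: "w \<in> space (?Pn {..<k})"
      show "(\<lambda>(\<alpha>, v). \<integral>\<^sup>+\<beta>. p x * (?A w * a \<alpha>) * (?B v * b \<beta>)
             * F ((?xs x w)(Suc k := f (?xs x w k) + \<alpha>), (?ys x w v)(Suc k := g (f (?xs x w k) + \<alpha>) + \<beta>))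
             \<partial>lborel) \<in> borel_measurable (lborel \<Otimes>\<^sub>M ?Pr {1..k})"
        by measurable
    qed
    also have "\<dots> = (\<integral>\<^sup>+w. \<integral>\<^sup>+v. p x * ?A w * ?B v * G (?xs x w, ?ys x w v) \<partial>?Pr {1..k} \<partial>?Pn {..<k})"
    proof (intro nn_integral_cong)
      fix w v assume [measurable]: "w \<in> space (?Pn {..<k})" "v \<in> space (?Pr {1..k})"
      let ?F = "\<lambda>\<alpha> \<beta>. F ((?xs x w)(Suc k := f (?xs x w k) + \<alpha>), (?ys x w v)(Suc k := g (f (?xs x w k) + \<alpha>) + \<beta>))"
      have [measurable]: "(\<lambda>(\<alpha>, \<beta>). ?F \<alpha> \<beta>) \<in> borel_measurable (lborel \<Otimes>\<^sub>M lborel)" by measurable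
      have "(\<integral>\<^sup>+\<alpha>. \<integral>\<^sup>+\<beta>. p x * (?A w * a \<alpha>) * (?B v * b \<beta>) * ?F \<alpha> \<beta> \<partial>lborel \<partial>lborel)
         = (\<integral>\<^sup>+\<alpha>. \<integral>\<^sup>+\<beta>. (p x * ?A w * ?B v) * (a \<alpha> * b \<beta> * ?F \<alpha> \<beta>) \<partial>lborel \<partial>lborel)"
        by (simp only: ac_simps)
      also have "\<dots> = (p x * ?A w * ?B v) * (\<integral>\<^sup>+\<alpha>. \<integral>\<^sup>+\<beta>. a \<alpha> * b \<beta> * ?F \<alpha> \<beta> \<partial>lborel \<partial>lborel)"
        by (rule pull) measurable
      finally show "(\<integral>\<^sup>+\<alpha>. \<integral>\<^sup>+\<beta>. p x * (?A w * a \<alpha>) * (?B v * b \<beta>) * ?F \<alpha> \<beta> \<partial>lborel \<partial>lborel)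
         = p x * ?A w * ?B v * G (?xs x w, ?ys x w v)"
        by (simp add: G_def)
    qed
    finally show ?thesis .
  qed
  have G: "G (xs, ys) = (\<integral>\<^sup>+x. \<integral>\<^sup>+y. a (x - f (xs k)) * b (y - g x) * F (xs(Suc k := x), ys(Suc k := y)) \<partial>lborel \<partial>lborel)"
    if [measurable]: "xs \<in> space (?Pn {..k})" "ys \<in> space (?Pr {1..k})" for xs ys
  proof -
    have "(\<integral>\<^sup>+x. \<integral>\<^sup>+y. a (x - f (xs k)) * b (y - g x) * F (xs(Suc k := x), ys(Suc k := y)) \<partial>lborel \<partial>lborel)
       = (\<integral>\<^sup>+\<alpha>. \<integral>\<^sup>+y. a \<alpha> * b (y - g (f (xs k) + \<alpha>)) * F (xs(Suc k := f (xs k) + \<alpha>), ys(Suc k := y)) \<partial>lborel \<partial>lborel)"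
      by (subst nn_integral_lborel_translate[symmetric, where c="f (xs k)"]) simp_all
    also have "\<dots> = G (xs, ys)"
      unfolding G_def split_conv
    proof (rule nn_integral_cong)
      fix \<alpha>
      show "(\<integral>\<^sup>+y. a \<alpha> * b (y - g (f (xs k) + \<alpha>)) * F (xs(Suc k := f (xs k) + \<alpha>), ys(Suc k := y)) \<partial>lborel)
        = (\<integral>\<^sup>+\<beta>. a \<alpha> * b \<beta> * F (xs(Suc k := f (xs k) + \<alpha>), ys(Suc k := g (f (xs k) + \<alpha>) + \<beta>)) \<partial>lborel)"
        by (subst nn_integral_lborel_translate[symmetric, where c="g (f (xs k) + \<alpha>)"]) simp_all
    qed
    finally show ?thesis ..
  qed
  have R: "(\<integral>\<^sup>+xs. \<integral>\<^sup>+ys. p (xs 0) * (\<Prod>i<Suc k. a (xs (Suc i) - f (xs i))) * (\<Prod>i=1..Suc k. b (ys i - g (xs i)))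
             * F (xs, ys) \<partial>?Pr {1..Suc k} \<partial>?Pn {..Suc k})
     = (\<integral>\<^sup>+xs. \<integral>\<^sup>+ys. p (xs 0) * (\<Prod>i<k. a (xs (Suc i) - f (xs i))) * (\<Prod>i=1..k. b (ys i - g (xs i)))
             * G (xs, ys) \<partial>?Pr {1..k} \<partial>?Pn {..k})"
  proof -
    let ?C = "\<lambda>xs. \<Prod>i<k. a (xs (Suc i) - f (xs i))" and ?D = "\<lambda>xs ys. \<Prod>i=1..k. b (ys i - g (xs i))"
    let ?H = "\<lambda>xs ys. p (xs 0) * (\<Prod>i<Suc k. a (xs (Suc i) - f (xs i))) * (\<Prod>i=1..Suc k. b (ys i - g (xs i)))
             * F (xs, ys)"
    have Hm: "(\<lambda>(xs, ys). ?H xs ys) \<in> borel_measurable (?Pn {..Suc k} \<Otimes>\<^sub>M ?Pr {1..Suc k})"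
      by measurable
    have H: "?H (xs(Suc k := x)) (ys(Suc k := y))
       = p (xs 0) * ?C xs * ?D xs ys * (a (x - f (xs k)) * b (y - g x) * F (xs(Suc k := x), ys(Suc k := y)))"
      for xs ys x y
    proof -
      have "?C (xs(Suc k := x)) = ?C xs" "?D (xs(Suc k := x)) (ys(Suc k := y)) = ?D xs ys"
        by (auto intro!: prod.cong)
      then show ?thesis by (simp add: ac_simps)
    qed
    have "(\<integral>\<^sup>+xs. \<integral>\<^sup>+ys. ?H xs ys \<partial>?Pr {1..Suc k} \<partial>?Pn {..Suc k})
       = (\<integral>\<^sup>+xs. \<integral>\<^sup>+x. \<integral>\<^sup>+ys. ?H (xs(Suc k := x)) ys \<partial>?Pr {1..Suc k} \<partial>lborel \<partial>?Pn {..k})"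
    proof (rule n.product_nn_integral_insert[of "{..k}" "Suc k", folded in1])
      show "(\<lambda>xs. \<integral>\<^sup>+ys. ?H xs ys \<partial>?Pr {1..Suc k}) \<in> borel_measurable (?Pn {..Suc k})"
        by (rule sigma_finite_measure.borel_measurable_nn_integral[OF sr Hm]) simp
    qed simp_all
    also have "\<dots> = (\<integral>\<^sup>+xs. \<integral>\<^sup>+x. \<integral>\<^sup>+ys. \<integral>\<^sup>+y. ?H (xs(Suc k := x)) (ys(Suc k := y)) \<partial>lborel \<partial>?Pr {1..k} \<partial>lborel \<partial>?Pn {..k})"
    proof (intro nn_integral_cong r.product_nn_integral_insert[of "{1..k}" "Suc k", folded ir1])
      fix xs x assume xs: "xs \<in> space (?Pn {..k})"
      have [measurable]: "xs(Suc k := x) \<in> space (?Pn {..Suc k})"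
        using xs by (auto simp: space_PiM PiE_iff extensional_def)
      show "(\<lambda>ys. ?H (xs(Suc k := x)) ys) \<in> borel_measurable (?Pr {1..Suc k})"
        by measurable
    qed simp_all
    also have "\<dots> = (\<integral>\<^sup>+xs. \<integral>\<^sup>+ys. \<integral>\<^sup>+x. \<integral>\<^sup>+y. ?H (xs(Suc k := x)) (ys(Suc k := y)) \<partial>lborel \<partial>lborel \<partial>?Pr {1..k} \<partial>?Pn {..k})"
      unfolding H
    proof (intro nn_integral_cong fswap)
      fix xs assume [measurable]: "xs \<in> space (?Pn {..k})"
      show "(\<lambda>(x, ys). \<integral>\<^sup>+y. p (xs 0) * ?C xs * ?D xs ys * (a (x - f (xs k)) * b (y - g x) * F (xs(Suc k := x), ys(Suc k := y))) \<partial>lborel)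
          \<in> borel_measurable (lborel \<Otimes>\<^sub>M ?Pr {1..k})"
        by measurable
    qed
    also have "\<dots> = (\<integral>\<^sup>+xs. \<integral>\<^sup>+ys. p (xs 0) * ?C xs * ?D xs ys * G (xs, ys) \<partial>?Pr {1..k} \<partial>?Pn {..k})"
      unfolding H
    proof (intro nn_integral_cong)
      fix xs ys assume sp [measurable]: "xs \<in> space (?Pn {..k})" "ys \<in> space (?Pr {1..k})"
      have "(\<integral>\<^sup>+x. \<integral>\<^sup>+y. p (xs 0) * ?C xs * ?D xs ys * (a (x - f (xs k)) * b (y - g x) * F (xs(Suc k := x), ys(Suc k := y))) \<partial>lborel \<partial>lborel)
         = p (xs 0) * ?C xs * ?D xs ys * (\<integral>\<^sup>+x. \<integral>\<^sup>+y. a (x - f (xs k)) * b (y - g x) * F (xs(Suc k := x), ys(Suc k := y)) \<partial>lborel \<partial>lborel)"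
        by (rule pull) measurable
      then show "(\<integral>\<^sup>+x. \<integral>\<^sup>+y. p (xs 0) * ?C xs * ?D xs ys * (a (x - f (xs k)) * b (y - g x) * F (xs(Suc k := x), ys(Suc k := y))) \<partial>lborel \<partial>lborel)
         = p (xs 0) * ?C xs * ?D xs ys * G (xs, ys)"
        by (simp only: G[OF sp])
    qed
    finally show ?thesis .
  qed
  show ?case
    unfolding L R
    by (rule Suc.IH) measurable
qed

lemma pos_def_det_pos:
  fixes A :: "real^'n^'n"
  assumes "pos_def_matrix A"
  shows "0 < det A"
proof (rule ccontr)
  assume neg: "\<not> 0 < det A"
  let ?B = "\<lambda>s::real. (1 - s) *\<^sub>R mat 1 + s *\<^sub>R A"
  have B: "?B s *v x = (1 - s) *\<^sub>R x + s *\<^sub>R (A *v x)" for s x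
    by (simp add: matrix_vector_mult_add_rdistrib scaleR_matrix_vector_assoc[symmetric])
  have "continuous_on {0..1} (\<lambda>s. det (?B s))"
    unfolding det_def by (intro continuous_intros)
  moreover have "det (?B 0) = 1"
    by simp
  moreover have "det (?B 1) \<le> 0"
    using neg by simp
  ultimately obtain s where s: "0 \<le> s" "s \<le> 1" "det (?B s) = 0"
    using IVT2'[of "\<lambda>s. det (?B s)" 1 0 0] by auto
  then obtain x where x: "x \<noteq> 0" "?B s *v x = 0"
    using invertible_det_nz[of "?B s"] matrix_left_invertible_ker[of "?B s"] invertible_left_inverse[of "?B s"] by metis
  from x(2) have "(1 - s) * (x \<bullet> x) + s * (x \<bullet> (A *v x)) = 0"
    unfolding B using inner_add_right[of x "(1 - s) *\<^sub>R x" "s *\<^sub>R (A *v x)"] by simp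
  moreover have "0 < x \<bullet> x" "0 < x \<bullet> (A *v x)"
    using x assms by (auto simp: pos_def_matrix_def)
  ultimately show False
    using s by (metis add.commute add_nonneg_eq_0_iff diff_ge_0_iff_ge diff_zero less_eq_real_def
        mult_eq_0_iff mult_nonneg_nonneg order_less_irrefl zero_neq_one)
qed

lemma borel_measurable_det:
  assumes [measurable]: "\<And>i j. (\<lambda>z. A z $ i $ j) \<in> borel_measurable N"
  shows "(\<lambda>z. det (A z :: real^'n^'n)) \<in> borel_measurable N"
  unfolding det_def by measurable

lemma borel_measurable_vec_iff:
  "(f :: 'z \<Rightarrow> real^'n) \<in> borel_measurable N \<longleftrightarrow> (\<forall>i. (\<lambda>z. f z $ i) \<in> borel_measurable N)"
proof -
  have "f \<in> borel_measurable N \<longleftrightarrow> (\<forall>i\<in>Basis. (\<lambda>z. f z \<bullet> i) \<in> borel_measurable N)"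
    by (rule borel_measurable_euclidean_space)
  then show ?thesis
    by (auto simp: Basis_vec_def inner_axis)
qed

lemma borel_measurable_mat_entry:
  fixes A :: "'z \<Rightarrow> real^'n^'m"
  assumes "A \<in> borel_measurable N"
  shows "(\<lambda>z. A z $ i $ j) \<in> borel_measurable N"
proof -
  have "(\<lambda>M :: real^'n^'m. M $ i $ j) \<in> borel_measurable borel"
    by (intro borel_measurable_continuous_onI continuous_intros)
  from measurable_compose[OF assms this] show ?thesis .
qed

lemma borel_measurable_mvn_density:
  fixes R :: "'z \<Rightarrow> real^'n^'n"
  assumes x: "x \<in> borel_measurable N" and m: "\<mu> \<in> borel_measurable N" and R: "R \<in> borel_measurable N"
    and nz: "\<And>z. z \<in> space N \<Longrightarrow> det (R z) \<noteq> 0"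
  shows "(\<lambda>z. mvn_density (x z) (\<mu> z) (R z)) \<in> borel_measurable N"
proof -
  note [measurable] = borel_measurable_mat_entry[OF R] x m
  define d where "d z = x z - \<mu> z" for z
  have d [measurable]: "d \<in> borel_measurable N" unfolding d_def by measurable
  then have [measurable]: "(\<lambda>z. d z $ i) \<in> borel_measurable N" for i
    by (simp add: borel_measurable_vec_iff)
  define u where "u z = (\<chi> k. det (\<chi> i j. if j = k then d z $ i else R z $ i $ j) / det (R z))" for z
  have u: "matrix_inv (R z) *v d z = u z" if "z \<in> space N" for z
  proof -
    have "invertible (R z)" using nz[OF that] by (simp add: invertible_det_nz)
    then have "R z ** matrix_inv (R z) = mat 1"
      unfolding invertible_def matrix_inv_def by (rule someI2_ex) simp
    then have "R z *v (matrix_inv (R z) *v d z) = d z"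
      by (simp add: matrix_vector_mul_assoc)
    then show ?thesis
      using cramer[OF nz[OF that], of "matrix_inv (R z) *v d z" "d z"] by (simp add: u_def)
  qed
  have D [measurable]: "(\<lambda>z. det (R z)) \<in> borel_measurable N"
    by (rule borel_measurable_det) measurable
  have [measurable]: "(\<lambda>z. det (\<chi> i j. if j = k then d z $ i else R z $ i $ j)) \<in> borel_measurable N" for k
    by (rule borel_measurable_det) simp
  have [measurable]: "u \<in> borel_measurable N"
    unfolding borel_measurable_vec_iff u_def by simp
  have "(\<lambda>z. exp (- (d z \<bullet> u z) / 2) / sqrt ((2 * pi) ^ CARD('n) * det (R z))) \<in> borel_measurable N"
    by measurable
  then show ?thesis
    by (rule measurable_cong[THEN iffD1, rotated]) (simp add: mvn_density_def u flip: d_def)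
qed

lemma mvn_density_pos: "pos_def_matrix R \<Longrightarrow> 0 < mvn_density x \<mu> R"
  by (simp add: mvn_density_def pos_def_det_pos)

lemma mvn_density_translate: "mvn_density (x - \<mu>) 0 R = mvn_density x \<mu> R"
  by (simp add: mvn_density_def)

lemma distributed_change_of_coordinates:
  assumes Z: "distributed M P Z f"
    and phi: "\<phi> \<in> Q \<rightarrow>\<^sub>M P" and psi: "\<psi> \<in> P \<rightarrow>\<^sub>M Q"
    and inv: "\<And>q. q \<in> space Q \<Longrightarrow> \<psi> (\<phi> q) = q"
    and int: "\<And>K :: _ \<Rightarrow> ennreal. K \<in> borel_measurable P \<Longrightarrow> (\<integral>\<^sup>+z. K z \<partial>P) = (\<integral>\<^sup>+q. K (\<phi> q) \<partial>Q)"
  shows "distributed M Q (\<lambda>\<omega>. \<psi> (Z \<omega>)) (\<lambda>q. f (\<phi> q))"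
proof -
  have f: "f \<in> borel_measurable P" and Zm: "Z \<in> M \<rightarrow>\<^sub>M P" and ZD: "distr M P Z = density P f"
    using Z by (auto simp: distributed_def)
  have fq: "(\<lambda>q. f (\<phi> q)) \<in> borel_measurable Q"
    by (rule measurable_compose[OF phi f])
  have "distr M Q (\<lambda>\<omega>. \<psi> (Z \<omega>)) = distr (density P f) Q \<psi>"
    using distr_distr[OF psi Zm] by (simp add: comp_def ZD)
  also have "\<dots> = density Q (\<lambda>q. f (\<phi> q))"
  proof (rule measure_eqI)
    fix A assume "A \<in> sets (distr (density P f) Q \<psi>)"
    then have A: "A \<in> sets Q" by simp
    have i: "(\<lambda>z. indicator A (\<psi> z) :: ennreal) \<in> borel_measurable P"
      by (rule measurable_compose[OF psi]) (use A in simp)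
    have "emeasure (distr (density P f) Q \<psi>) A = (\<integral>\<^sup>+q. indicator A q \<partial>distr (density P f) Q \<psi>)"
      using A by simp
    also have "\<dots> = (\<integral>\<^sup>+z. f z * indicator A (\<psi> z) \<partial>P)"
      by (subst nn_integral_distr) (use A psi f i in \<open>simp_all add: nn_integral_density\<close>)
    also have "\<dots> = (\<integral>\<^sup>+q. f (\<phi> q) * indicator A (\<psi> (\<phi> q)) \<partial>Q)"
      by (rule int) (intro borel_measurable_times_ennreal f i)
    also have "\<dots> = (\<integral>\<^sup>+q. f (\<phi> q) * indicator A q \<partial>Q)"
      by (rule nn_integral_cong) (simp add: inv)
    also have "\<dots> = emeasure (density Q (\<lambda>q. f (\<phi> q))) A"
      using A fq by (simp add: emeasure_density)
    finally show "emeasure (distr (density P f) Q \<psi>) A = emeasure (density Q (\<lambda>q. f (\<phi> q))) A" .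
  qed simp
  finally show ?thesis
    using measurable_compose[OF Zm psi] fq by (simp add: distributed_def)
qed

lemma (in prob_space) distributed_real_marginal:
  fixes g :: "'b \<times> 'c \<Rightarrow> real"
  assumes A: "sigma_finite_measure A" and B: "sigma_finite_measure B"
    and D: "distributed M (A \<Otimes>\<^sub>M B) (\<lambda>\<omega>. (U \<omega>, V \<omega>)) (\<lambda>z. ennreal (g z))"
    and nonneg: "\<And>z. z \<in> space (A \<Otimes>\<^sub>M B) \<Longrightarrow> 0 \<le> g z"
  shows "distributed M B V (\<lambda>b. ennreal (LINT a|A. g (a, b)))"
proof -
  interpret A: sigma_finite_measure A by fact
  interpret B: sigma_finite_measure B by fact
  interpret AB: pair_sigma_finite A B ..
  let ?J = "\<lambda>b. \<integral>\<^sup>+a. ennreal (g (a, b)) \<partial>A"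
  have g: "g \<in> borel_measurable (A \<Otimes>\<^sub>M B)"
    using distributed_real_measurable[OF nonneg D] .
  have g': "(\<lambda>(b, a). g (a, b)) \<in> borel_measurable (B \<Otimes>\<^sub>M A)"
    using measurable_compose[OF measurable_pair_swap' g] by (simp add: split_beta')
  have J: "distributed M B V ?J"
    using distr_marginal2[OF A B D] by simp
  have Jm: "?J \<in> borel_measurable B"
    using J by (simp add: distributed_def)
  have "prob_space (distr M B V)"
    using J by (intro prob_space_distr) (simp add: distributed_def)
  then have "emeasure (density B ?J) (space B) = 1"
    using J prob_space.emeasure_space_1 by (fastforce simp: distributed_def)
  then have "(\<integral>\<^sup>+b. ?J b \<partial>B) = 1"
    using Jm by (simp add: emeasure_density cong: nn_integral_cong)
  then have "AE b in B. ?J b \<noteq> \<infinity>"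
    using Jm by (intro nn_integral_PInf_AE) auto
  then have AE: "AE b in B. ?J b = ennreal (LINT a|A. g (a, b))"
  proof (rule AE_mp, intro AE_I2 impI)
    fix b assume b: "b \<in> space B" and fin: "?J b \<noteq> \<infinity>"
    have m: "(\<lambda>a. g (a, b)) \<in> borel_measurable A"
      by (rule measurable_compose[OF measurable_Pair2' g]) fact
    have n: "AE a in A. 0 \<le> g (a, b)"
      using b by (intro AE_I2 nonneg) (simp add: space_pair_measure)
    have "integrable A (\<lambda>a. g (a, b))"
      using m n fin by (intro integrableI_nonneg) (simp_all add: top.not_eq_extremum)
    then show "?J b = ennreal (LINT a|A. g (a, b))"
      using n by (rule nn_integral_eq_integral)
  qed
  have m: "(\<lambda>b. ennreal (LINT a|A. g (a, b))) \<in> borel_measurable B"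
    using A.borel_measurable_lebesgue_integral[OF g'] by simp
  have "density B ?J = density B (\<lambda>b. ennreal (LINT a|A. g (a, b)))"
    by (rule density_cong[OF Jm m AE])
  then show ?thesis
    using J m by (simp add: distributed_def)
qed

context state_space_model
begin

lemma space_param [simp]: "space (lebesgue_param \<Theta>) = \<Theta>"
  by (simp add: space_restrict_space)

lemma sigma_finite_param: "sigma_finite_measure (lebesgue_param \<Theta>)"
  using Theta_borel by (intro sigma_finite_measure_restrict_space sigma_finite_lborel) simp

lemma Phi_comp:
  assumes "x \<in> borel_measurable N" "t \<in> N \<rightarrow>\<^sub>M lebesgue_param \<Theta>"
  shows "(\<lambda>z. \<Phi> (x z) (t z)) \<in> borel_measurable N"
proof -
  have "(\<lambda>z. (x z, t z)) \<in> N \<rightarrow>\<^sub>M lborel \<Otimes>\<^sub>M lebesgue_param \<Theta>"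
    using assms by (intro measurable_Pair) simp_all
  from measurable_compose[OF this Phi_measurable] show ?thesis by simp
qed

lemma h_comp:
  assumes "x \<in> borel_measurable N" "t \<in> N \<rightarrow>\<^sub>M lebesgue_param \<Theta>"
  shows "(\<lambda>z. h (x z) (t z)) \<in> borel_measurable N"
proof -
  have "(\<lambda>z. (x z, t z)) \<in> N \<rightarrow>\<^sub>M lborel \<Otimes>\<^sub>M lebesgue_param \<Theta>"
    using assms by (intro measurable_Pair) simp_all
  from measurable_compose[OF this h_measurable] show ?thesis by simp
qed

lemma p0_comp:
  assumes "x \<in> borel_measurable N" "t \<in> N \<rightarrow>\<^sub>M lebesgue_param \<Theta>"
  shows "(\<lambda>z. p0 (x z) (t z)) \<in> borel_measurable N"
proof -
  have "(\<lambda>z. (x z, t z)) \<in> N \<rightarrow>\<^sub>M lborel \<Otimes>\<^sub>M lebesgue_param \<Theta>"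
    using assms by (intro measurable_Pair) simp_all
  moreover have "(\<lambda>(x, t). p0 x t) \<in> borel_measurable (lborel \<Otimes>\<^sub>M lebesgue_param \<Theta>)"
    using prior_density by (simp add: prob_density_def)
  ultimately have "(\<lambda>z. (\<lambda>(x, t). p0 x t) (x z, t z)) \<in> borel_measurable N"
    by (rule measurable_compose)
  then show ?thesis by simp
qed

lemma mvn_Sigma_comp:
  assumes "x \<in> borel_measurable N" "m \<in> borel_measurable N" "t \<in> N \<rightarrow>\<^sub>M lebesgue_param \<Theta>"
  shows "(\<lambda>z. mvn_density (x z) (m z) (\<Sigma> (t z))) \<in> borel_measurable N"
  using assms measurable_space[OF assms(3)] pos_def_det_pos[OF Sigma_pos_def]
  by (intro borel_measurable_mvn_density measurable_compose[OF assms(3) Sigma_measurable]) (force simp: less_le)+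

lemma mvn_Gamma_comp:
  assumes "x \<in> borel_measurable N" "m \<in> borel_measurable N" "t \<in> N \<rightarrow>\<^sub>M lebesgue_param \<Theta>"
  shows "(\<lambda>z. mvn_density (x z) (m z) (\<Gamma> (t z))) \<in> borel_measurable N"
  using assms measurable_space[OF assms(3)] pos_def_det_pos[OF Gamma_pos_def]
  by (intro borel_measurable_mvn_density measurable_compose[OF assms(3) Gamma_measurable]) (force simp: less_le)+

lemma path_density_comp:
  assumes "\<And>i. i \<le> k \<Longrightarrow> (\<lambda>z. x z i) \<in> borel_measurable N" "t \<in> N \<rightarrow>\<^sub>M lebesgue_param \<Theta>"
    "\<And>i. 1 \<le> i \<Longrightarrow> i \<le> k \<Longrightarrow> (\<lambda>z. y z i) \<in> borel_measurable N"
  shows "(\<lambda>z. path_density \<Phi> h \<Sigma> \<Gamma> p0 k (x z) (t z) (y z)) \<in> borel_measurable N"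
  unfolding path_density_def
  by (intro borel_measurable_times borel_measurable_prod p0_comp mvn_Sigma_comp mvn_Gamma_comp Phi_comp h_comp
      assms) auto

lemma p0_nonneg: "t \<in> \<Theta> \<Longrightarrow> 0 \<le> p0 x t"
  using prior_density by (simp add: prob_density_def space_pair_measure)

lemma path_density_nonneg: "t \<in> \<Theta> \<Longrightarrow> 0 \<le> path_density \<Phi> h \<Sigma> \<Gamma> p0 k x t y"
  unfolding path_density_def
  by (intro mult_nonneg_nonneg prod_nonneg p0_nonneg)
     (auto intro!: less_imp_le mvn_density_pos Sigma_pos_def Gamma_pos_def)

lemma X_eq_traj: "\<omega> \<in> space M \<Longrightarrow> i \<le> k \<Longrightarrow> X i \<omega> = traj (\<lambda>x. \<Phi> x (\<theta> \<omega>)) (X 0 \<omega>) (\<lambda>i\<in>{..<k}. W i \<omega>) i"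
  by (induction i) (auto simp: dynamics)

lemma distributed_path:
  "distributed M
     ((\<Pi>\<^sub>M i\<in>{..k}. lborel) \<Otimes>\<^sub>M (lebesgue_param \<Theta> \<Otimes>\<^sub>M (\<Pi>\<^sub>M i\<in>{1..k}. lborel)))
     (\<lambda>\<omega>. (\<lambda>i\<in>{..k}. X i \<omega>, \<theta> \<omega>, \<lambda>i\<in>{1..k}. Y i \<omega>))
     (\<lambda>(x, t, y). ennreal (path_density \<Phi> h \<Sigma> \<Gamma> p0 k x t y))"
proof -
  let ?T = "lebesgue_param \<Theta>"
  let ?Pn = "\<lambda>I. \<Pi>\<^sub>M i\<in>I. lborel :: (real^'n) measure"
  let ?Pr = "\<lambda>I. \<Pi>\<^sub>M i\<in>I. lborel :: (real^'r) measure"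
  let ?N = "(lborel :: (real^'n) measure) \<Otimes>\<^sub>M (?T \<Otimes>\<^sub>M (?Pn {..<k} \<Otimes>\<^sub>M ?Pr {1..k}))"
  let ?P = "?Pn {..k} \<Otimes>\<^sub>M (?T \<Otimes>\<^sub>M ?Pr {1..k})"
  interpret n: product_sigma_finite "\<lambda>_::nat. lborel :: (real^'n) measure" ..
  interpret r: product_sigma_finite "\<lambda>_::nat. lborel :: (real^'r) measure" ..
  interpret T: sigma_finite_measure ?T by (rule sigma_finite_param)
  interpret Pn: sigma_finite_measure "?Pn {..<k}" by (rule n.sigma_finite) simp
  interpret Pn': sigma_finite_measure "?Pn {..k}" by (rule n.sigma_finite) simp
  interpret Pr: sigma_finite_measure "?Pr {1..k}" by (rule r.sigma_finite) simp
  interpret TR: pair_sigma_finite ?T "?Pr {1..k}" ..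
  interpret NR: pair_sigma_finite "?Pn {..<k}" "?Pr {1..k}" ..
  interpret TNR: pair_sigma_finite ?T "?Pn {..<k} \<Otimes>\<^sub>M ?Pr {1..k}" ..
  interpret LT: pair_sigma_finite "lborel :: (real^'n) measure" ?T ..
  interpret PT: pair_sigma_finite "?Pn {..k}" ?T ..
  define U where "U = (\<lambda>\<omega>. (X 0 \<omega>, \<theta> \<omega>, (\<lambda>i\<in>{..<k}. W i \<omega>), (\<lambda>i\<in>{1..k}. V i \<omega>)))"
  define D where "D = (\<lambda>(x, t, w, v). ennreal
     (p0 x t * (\<Prod>i<k. mvn_density (w i) 0 (\<Sigma> t)) * (\<Prod>i=1..k. mvn_density (v i) 0 (\<Gamma> t))))"
  define S where "S = (\<lambda>(x, t, w, v). (\<lambda>i\<in>{..k}. traj (\<lambda>x. \<Phi> x t) x w i, t,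
     \<lambda>i\<in>{1..k}. h (traj (\<lambda>x. \<Phi> x t) x w i) t + v i))"
  define Z where "Z = (\<lambda>\<omega>. (\<lambda>i\<in>{..k}. X i \<omega>, \<theta> \<omega>, \<lambda>i\<in>{1..k}. Y i \<omega>))"
  define f where "f = (\<lambda>(x, t, y). ennreal (path_density \<Phi> h \<Sigma> \<Gamma> p0 k x t y))"
  have UD: "distributed M ?N U D"
    unfolding U_def D_def by (rule joint_law)
  then have U: "U \<in> M \<rightarrow>\<^sub>M ?N" and D: "D \<in> borel_measurable ?N"
    by (auto simp: distributed_def)
  have compn: "(\<lambda>z. x z i) \<in> borel_measurable L" if "x \<in> L \<rightarrow>\<^sub>M ?Pn I" "i \<in> I" for L :: "'z measure" and x i I
    using measurable_compose[OF that(1) measurable_component_singleton[OF that(2)]] by simp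
  have compr: "(\<lambda>z. x z i) \<in> borel_measurable L" if "x \<in> L \<rightarrow>\<^sub>M ?Pr I" "i \<in> I" for L :: "'z measure" and x i I
    using measurable_compose[OF that(1) measurable_component_singleton[OF that(2)]] by simp
  note m3 = measurable_compose[OF measurable_snd measurable_compose[OF measurable_snd measurable_fst]]
    and m4 = measurable_compose[OF measurable_snd measurable_compose[OF measurable_snd measurable_snd]]
    and m2 = measurable_compose[OF measurable_snd measurable_fst]
    and m2' = measurable_compose[OF measurable_snd measurable_snd]
  have m1: "fst \<in> borel_measurable (lborel \<Otimes>\<^sub>M L)" for L :: "'z measure"
    using measurable_fst[of lborel L] by simp
  have trj: "(\<lambda>z. traj (\<lambda>x. \<Phi> x (fst (snd z))) (fst z) (fst (snd (snd z))) i) \<in> borel_measurable ?N"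
    if "i \<le> k" for i
  proof (rule borel_measurable_traj)
    show "(\<lambda>(z, x). \<Phi> x (fst (snd z))) \<in> borel_measurable (?N \<Otimes>\<^sub>M borel)"
      unfolding split_beta'
      by (rule Phi_comp) (use measurable_compose[OF measurable_fst m2] in simp_all)
    show "fst \<in> borel_measurable ?N"
      by (rule m1)
    show "(\<lambda>z. fst (snd (snd z)) j) \<in> borel_measurable ?N" if "j < i" for j
      using that \<open>i \<le> k\<close> by (intro compn[of _ _ "{..<k}"] m3) auto
  qed
  have S: "S \<in> ?N \<rightarrow>\<^sub>M ?P"
    unfolding S_def split_beta'
  proof (intro measurable_Pair measurable_restrict)
    fix i assume i: "i \<in> {1..k}"
    show "(\<lambda>z. h (traj (\<lambda>x. \<Phi> x (fst (snd z))) (fst z) (fst (snd (snd z))) i) (fst (snd z)) + snd (snd (snd z)) i)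
       \<in> ?N \<rightarrow>\<^sub>M lborel"
      unfolding measurable_lborel1 using i
      by (intro borel_measurable_add h_comp trj compr[of _ _ "{1..k}"] m2 m4) auto
  qed (use trj m2 in auto)
  have f: "f \<in> borel_measurable ?P"
    unfolding f_def split_beta'
    by (intro measurable_compose[OF _ measurable_ennreal] path_density_comp compn[of _ _ "{..k}"]
       compr[of _ _ "{1..k}"] m2 m2' measurable_fst) auto
  have Z: "Z \<omega> = S (U \<omega>)" if "\<omega> \<in> space M" for \<omega>
  proof -
    have "traj (\<lambda>x. \<Phi> x (\<theta> \<omega>)) (X 0 \<omega>) (\<lambda>i\<in>{..<k}. W i \<omega>) i = X i \<omega>" if "i \<le> k" for i
      using X_eq_traj[OF \<open>\<omega> \<in> space M\<close> that] by simp
    moreover have "Y i \<omega> = h (X i \<omega>) (\<theta> \<omega>) + V i \<omega>" if "i \<in> {1..k}" for i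
      using that \<open>\<omega> \<in> space M\<close> by (simp add: observation)
    ultimately show ?thesis
      by (simp add: Z_def S_def U_def cong: restrict_cong)
  qed
  have SU: "(\<lambda>\<omega>. S (U \<omega>)) \<in> M \<rightarrow>\<^sub>M ?P"
    by (rule measurable_compose[OF U S])
  have Zm: "Z \<in> M \<rightarrow>\<^sub>M ?P"
    using SU by (rule measurable_cong[THEN iffD2, rotated]) (rule Z)
  have key: "(\<integral>\<^sup>+x. \<integral>\<^sup>+w. \<integral>\<^sup>+v. D (x, t, w, v) * G (S (x, t, w, v)) \<partial>?Pr {1..k} \<partial>?Pn {..<k} \<partial>lborel)
     = (\<integral>\<^sup>+xs. \<integral>\<^sup>+ys. f (xs, t, ys) * G (xs, t, ys) \<partial>?Pr {1..k} \<partial>?Pn {..k})"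
    if t: "t \<in> \<Theta>" and G: "G \<in> borel_measurable ?P" for t G
  proof -
    have ct: "(\<lambda>_. t) \<in> L \<rightarrow>\<^sub>M ?T" for L :: "'z measure"
      using t by (intro measurable_const) simp
    have Dt: "D (x, t, w, v) = ennreal (p0 x t) * (\<Prod>i<k. ennreal (mvn_density (w i) 0 (\<Sigma> t)))
        * (\<Prod>i=1..k. ennreal (mvn_density (v i) 0 (\<Gamma> t)))" for x w v
      using t unfolding D_def
      by (simp add: ennreal_mult prod_nonneg p0_nonneg less_imp_le mvn_density_pos Sigma_pos_def Gamma_pos_def
          prod_ennreal)
    have ft: "f (xs, t, ys) = ennreal (p0 (xs 0) t)
        * (\<Prod>i<k. ennreal (mvn_density (xs (Suc i) - \<Phi> (xs i) t) 0 (\<Sigma> t)))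
        * (\<Prod>i=1..k. ennreal (mvn_density (ys i - h (xs i) t) 0 (\<Gamma> t)))" for xs ys
      using t unfolding f_def path_density_def
      by (simp add: ennreal_mult prod_nonneg p0_nonneg less_imp_le mvn_density_pos Sigma_pos_def Gamma_pos_def
          prod_ennreal mvn_density_translate)
    have Gt: "(\<lambda>(xs, ys). G (xs, t, ys)) \<in> borel_measurable (?Pn {..k} \<Otimes>\<^sub>M ?Pr {1..k})"
      unfolding split_beta'
      by (rule measurable_compose[OF _ G]) (intro measurable_Pair ct measurable_fst measurable_snd)
    have "(\<integral>\<^sup>+x. \<integral>\<^sup>+w. \<integral>\<^sup>+v. ennreal (p0 x t) * (\<Prod>i<k. ennreal (mvn_density (w i) 0 (\<Sigma> t)))
        * (\<Prod>i=1..k. ennreal (mvn_density (v i) 0 (\<Gamma> t)))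
        * (\<lambda>(xs, ys). G (xs, t, ys)) (\<lambda>i\<in>{..k}. traj (\<lambda>x. \<Phi> x t) x w i, \<lambda>i\<in>{1..k}. h (traj (\<lambda>x. \<Phi> x t) x w i) t + v i)
        \<partial>?Pr {1..k} \<partial>?Pn {..<k} \<partial>lborel)
      = (\<integral>\<^sup>+xs. \<integral>\<^sup>+ys. ennreal (p0 (xs 0) t)
        * (\<Prod>i<k. ennreal (mvn_density (xs (Suc i) - \<Phi> (xs i) t) 0 (\<Sigma> t)))
        * (\<Prod>i=1..k. ennreal (mvn_density (ys i - h (xs i) t) 0 (\<Gamma> t))) * (\<lambda>(xs, ys). G (xs, t, ys)) (xs, ys)
        \<partial>?Pr {1..k} \<partial>?Pn {..k})"
      by (rule nn_integral_path)
         (intro measurable_compose[OF _ measurable_ennreal] Phi_comp h_comp p0_comp mvn_Sigma_comp mvn_Gamma_comp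
           ct Gt measurable_ident_sets borel_measurable_const sets_lborel refl measurable_ident)+
    then show ?thesis
      by (simp add: Dt ft S_def)
  qed
  have PP: "(\<integral>\<^sup>+z. K z \<partial>?P) = (\<integral>\<^sup>+t. \<integral>\<^sup>+xs. \<integral>\<^sup>+ys. K (xs, t, ys) \<partial>?Pr {1..k} \<partial>?Pn {..k} \<partial>?T)"
    if K: "K \<in> borel_measurable ?P" for K :: "_ \<Rightarrow> ennreal"
  proof -
    have "(\<integral>\<^sup>+z. K z \<partial>?P) = (\<integral>\<^sup>+xs. \<integral>\<^sup>+q. K (xs, q) \<partial>(?T \<Otimes>\<^sub>M ?Pr {1..k}) \<partial>?Pn {..k})"
      by (rule TR.nn_integral_fst[symmetric, OF K])
    also have "\<dots> = (\<integral>\<^sup>+xs. \<integral>\<^sup>+t. \<integral>\<^sup>+ys. K (xs, t, ys) \<partial>?Pr {1..k} \<partial>?T \<partial>?Pn {..k})"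
    proof (rule nn_integral_cong)
      fix xs assume "xs \<in> space (?Pn {..k})"
      then have "(\<lambda>q. K (xs, q)) \<in> borel_measurable (?T \<Otimes>\<^sub>M ?Pr {1..k})"
        by (intro measurable_compose[OF measurable_Pair1' K])
      from Pr.nn_integral_fst[OF this]
      show "(\<integral>\<^sup>+q. K (xs, q) \<partial>(?T \<Otimes>\<^sub>M ?Pr {1..k})) = (\<integral>\<^sup>+t. \<integral>\<^sup>+ys. K (xs, t, ys) \<partial>?Pr {1..k} \<partial>?T)"
        by simp
    qed
    also have "\<dots> = (\<integral>\<^sup>+t. \<integral>\<^sup>+xs. \<integral>\<^sup>+ys. K (xs, t, ys) \<partial>?Pr {1..k} \<partial>?Pn {..k} \<partial>?T)"
    proof (rule PT.Fubini'[symmetric])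
      have "(\<lambda>(q, ys). K (fst q, snd q, ys)) \<in> borel_measurable ((?Pn {..k} \<Otimes>\<^sub>M ?T) \<Otimes>\<^sub>M ?Pr {1..k})"
        unfolding split_beta' by (rule measurable_compose[OF _ K]) (intro measurable_Pair measurable_compose[OF measurable_fst] measurable_fst measurable_snd)
      from Pr.borel_measurable_nn_integral[OF this]
      show "(\<lambda>(xs, t). \<integral>\<^sup>+ys. K (xs, t, ys) \<partial>?Pr {1..k}) \<in> borel_measurable (?Pn {..k} \<Otimes>\<^sub>M ?T)"
        by (simp add: split_beta')
    qed
    finally show ?thesis .
  qed
  have NN: "(\<integral>\<^sup>+z. K z \<partial>?N) = (\<integral>\<^sup>+t. \<integral>\<^sup>+x. \<integral>\<^sup>+w. \<integral>\<^sup>+v. K (x, t, w, v) \<partial>?Pr {1..k} \<partial>?Pn {..<k} \<partial>lborel \<partial>?T)"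
    if K: "K \<in> borel_measurable ?N" for K :: "_ \<Rightarrow> ennreal"
  proof -
    have "(\<integral>\<^sup>+z. K z \<partial>?N) = (\<integral>\<^sup>+x. \<integral>\<^sup>+q. K (x, q) \<partial>(?T \<Otimes>\<^sub>M (?Pn {..<k} \<Otimes>\<^sub>M ?Pr {1..k})) \<partial>lborel)"
      by (rule TNR.nn_integral_fst[symmetric, OF K])
    also have "\<dots> = (\<integral>\<^sup>+x. \<integral>\<^sup>+t. \<integral>\<^sup>+w. \<integral>\<^sup>+v. K (x, t, w, v) \<partial>?Pr {1..k} \<partial>?Pn {..<k} \<partial>?T \<partial>lborel)"
    proof (rule nn_integral_cong)
      fix x :: "real^'n"
      have Kx: "(\<lambda>q. K (x, q)) \<in> borel_measurable (?T \<Otimes>\<^sub>M (?Pn {..<k} \<Otimes>\<^sub>M ?Pr {1..k}))"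
        by (intro measurable_compose[OF measurable_Pair1' K]) simp
      have "(\<integral>\<^sup>+q. K (x, q) \<partial>(?T \<Otimes>\<^sub>M (?Pn {..<k} \<Otimes>\<^sub>M ?Pr {1..k})))
         = (\<integral>\<^sup>+t. \<integral>\<^sup>+q. K (x, t, q) \<partial>(?Pn {..<k} \<Otimes>\<^sub>M ?Pr {1..k}) \<partial>?T)"
        using NR.nn_integral_fst[OF Kx] by simp
      also have "\<dots> = (\<integral>\<^sup>+t. \<integral>\<^sup>+w. \<integral>\<^sup>+v. K (x, t, w, v) \<partial>?Pr {1..k} \<partial>?Pn {..<k} \<partial>?T)"
      proof (rule nn_integral_cong)
        fix t assume "t \<in> space ?T"
        then have "(\<lambda>q. K (x, t, q)) \<in> borel_measurable (?Pn {..<k} \<Otimes>\<^sub>M ?Pr {1..k})"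
          by (intro measurable_compose[OF measurable_Pair1' Kx])
        from Pr.nn_integral_fst[OF this]
        show "(\<integral>\<^sup>+q. K (x, t, q) \<partial>(?Pn {..<k} \<Otimes>\<^sub>M ?Pr {1..k})) = (\<integral>\<^sup>+w. \<integral>\<^sup>+v. K (x, t, w, v) \<partial>?Pr {1..k} \<partial>?Pn {..<k})"
          by simp
      qed
      finally show "(\<integral>\<^sup>+q. K (x, q) \<partial>(?T \<Otimes>\<^sub>M (?Pn {..<k} \<Otimes>\<^sub>M ?Pr {1..k})))
         = (\<integral>\<^sup>+t. \<integral>\<^sup>+w. \<integral>\<^sup>+v. K (x, t, w, v) \<partial>?Pr {1..k} \<partial>?Pn {..<k} \<partial>?T)" .
    qed
    also have "\<dots> = (\<integral>\<^sup>+t. \<integral>\<^sup>+x. \<integral>\<^sup>+w. \<integral>\<^sup>+v. K (x, t, w, v) \<partial>?Pr {1..k} \<partial>?Pn {..<k} \<partial>lborel \<partial>?T)"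
    proof (rule LT.Fubini'[symmetric])
      have "(\<lambda>(q, v). K (fst (fst q), snd (fst q), snd q, v)) \<in> borel_measurable (((lborel \<Otimes>\<^sub>M ?T) \<Otimes>\<^sub>M ?Pn {..<k}) \<Otimes>\<^sub>M ?Pr {1..k})"
        unfolding split_beta' by (rule measurable_compose[OF _ K]) (intro measurable_Pair measurable_compose[OF measurable_fst] measurable_fst measurable_snd)
      from Pr.borel_measurable_nn_integral[OF this]
      have "(\<lambda>(q, w). \<integral>\<^sup>+v. K (fst q, snd q, w, v) \<partial>?Pr {1..k}) \<in> borel_measurable ((lborel \<Otimes>\<^sub>M ?T) \<Otimes>\<^sub>M ?Pn {..<k})"
        by (simp add: split_beta')
      from Pn.borel_measurable_nn_integral[OF this]
      show "(\<lambda>(x, t). \<integral>\<^sup>+w. \<integral>\<^sup>+v. K (x, t, w, v) \<partial>?Pr {1..k} \<partial>?Pn {..<k}) \<in> borel_measurable (lborel \<Otimes>\<^sub>M ?T)"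
        by (simp add: split_beta')
    qed
    finally show ?thesis .
  qed
  have "distr M ?P Z = distr M ?P (\<lambda>\<omega>. S (U \<omega>))"
    by (rule distr_cong) (auto simp: Z)
  also have "\<dots> = distr (distr M ?N U) ?P S"
    using distr_distr[OF S U] by (simp add: comp_def)
  also have "distr M ?N U = density ?N D"
    using UD by (rule distributed_distr_eq_density)
  also have "distr (density ?N D) ?P S = density ?P f"
  proof (rule measure_eqI)
    fix A assume "A \<in> sets (distr (density ?N D) ?P S)"
    then have A: "A \<in> sets ?P" by simp
    define G where "G = (indicator A :: _ \<Rightarrow> ennreal)"
    have G: "G \<in> borel_measurable ?P" unfolding G_def using A by simp
    have H: "(\<lambda>z. D z * G (S z)) \<in> borel_measurable ?N"
      by (intro borel_measurable_times_ennreal D measurable_compose[OF S G])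
    have K: "(\<lambda>z. f z * G z) \<in> borel_measurable ?P"
      by (intro borel_measurable_times_ennreal f G)
    have "emeasure (distr (density ?N D) ?P S) A = (\<integral>\<^sup>+z. G z \<partial>distr (density ?N D) ?P S)"
      using A by (simp add: G_def)
    also have "\<dots> = (\<integral>\<^sup>+z. D z * G (S z) \<partial>?N)"
      using S D G measurable_compose[OF S G] by (simp add: nn_integral_distr nn_integral_density)
    also have "\<dots> = (\<integral>\<^sup>+t. \<integral>\<^sup>+x. \<integral>\<^sup>+w. \<integral>\<^sup>+v. D (x, t, w, v) * G (S (x, t, w, v)) \<partial>?Pr {1..k} \<partial>?Pn {..<k} \<partial>lborel \<partial>?T)"
      by (rule NN[OF H])
    also have "\<dots> = (\<integral>\<^sup>+t. \<integral>\<^sup>+xs. \<integral>\<^sup>+ys. f (xs, t, ys) * G (xs, t, ys) \<partial>?Pr {1..k} \<partial>?Pn {..k} \<partial>?T)"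
      using G by (intro nn_integral_cong key) simp_all
    also have "\<dots> = (\<integral>\<^sup>+z. f z * G z \<partial>?P)"
      by (rule PP[OF K, symmetric])
    also have "\<dots> = emeasure (density ?P f) A"
      using A f by (simp add: G_def emeasure_density)
    finally show "emeasure (distr (density ?N D) ?P S) A = emeasure (density ?P f) A" .
  qed simp
  finally show ?thesis
    using f Zm by (simp add: distributed_def Z_def f_def)
qed

lemma joint_density_nonneg: "t \<in> \<Theta> \<Longrightarrow> 0 \<le> joint_density \<Phi> h \<Sigma> \<Gamma> p0 k x t y"
  unfolding joint_density_def by (intro Bochner_Integration.integral_nonneg path_density_nonneg)

lemma distributed_joint:
  "distributed M (lborel \<Otimes>\<^sub>M (lebesgue_param \<Theta> \<Otimes>\<^sub>M (\<Pi>\<^sub>M i\<in>{1..k}. lborel)))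
     (\<lambda>\<omega>. (X k \<omega>, \<theta> \<omega>, \<lambda>i\<in>{1..k}. Y i \<omega>))
     (\<lambda>(x, t, y). ennreal (joint_density \<Phi> h \<Sigma> \<Gamma> p0 k x t y))"
proof -
  let ?T = "lebesgue_param \<Theta>"
  let ?Pn = "\<lambda>I. \<Pi>\<^sub>M i\<in>I. lborel :: (real^'n) measure"
  let ?Pr = "\<lambda>I. \<Pi>\<^sub>M i\<in>I. lborel :: (real^'r) measure"
  let ?L = "(lborel :: (real^'n) measure) \<Otimes>\<^sub>M (?T \<Otimes>\<^sub>M ?Pr {1..k})"
  let ?P = "?Pn {..k} \<Otimes>\<^sub>M (?T \<Otimes>\<^sub>M ?Pr {1..k})"
  let ?Q = "?Pn {..<k} \<Otimes>\<^sub>M ?L"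
  interpret n: product_sigma_finite "\<lambda>_::nat. lborel :: (real^'n) measure" ..
  interpret r: product_sigma_finite "\<lambda>_::nat. lborel :: (real^'r) measure" ..
  interpret T: sigma_finite_measure ?T by (rule sigma_finite_param)
  interpret Pn: sigma_finite_measure "?Pn {..<k}" by (rule n.sigma_finite) simp
  interpret Pr: sigma_finite_measure "?Pr {1..k}" by (rule r.sigma_finite) simp
  interpret TR: pair_sigma_finite ?T "?Pr {1..k}" ..
  interpret L: pair_sigma_finite "lborel :: (real^'n) measure" "?T \<Otimes>\<^sub>M ?Pr {1..k}" ..
  interpret Q: pair_sigma_finite "?Pn {..<k}" ?L ..
  define \<phi> :: "(nat \<Rightarrow> real^'n) \<times> (real^'n) \<times> (real^'d) \<times> (nat \<Rightarrow> real^'r) \<Rightarrow> _"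
    where "\<phi> = (\<lambda>(x', x, q). (x'(k := x), q))"
  define \<psi> :: "(nat \<Rightarrow> real^'n) \<times> (real^'d) \<times> (nat \<Rightarrow> real^'r) \<Rightarrow> _"
    where "\<psi> = (\<lambda>(xs, q). (restrict xs {..<k}, xs k, q))"
  have cap: "{..k} \<inter> {..<k} = {..<k}" by auto
  have ins: "{..k} = insert k {..<k}" by auto
  have phi: "\<phi> \<in> ?Q \<rightarrow>\<^sub>M ?P"
    unfolding \<phi>_def split_beta'
    by (intro measurable_Pair measurable_fun_upd[where J="{..<k}"] measurable_fst
         measurable_compose[OF measurable_snd measurable_fst] measurable_compose[OF measurable_snd measurable_snd]) auto
  have psi: "\<psi> \<in> ?P \<rightarrow>\<^sub>M ?Q"
    unfolding \<psi>_def split_beta'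
    by (intro measurable_Pair measurable_compose[OF measurable_fst measurable_restrict_subset]
         measurable_compose[OF measurable_fst measurable_component_singleton] measurable_snd) auto
  have inv: "\<psi> (\<phi> q) = q" if "q \<in> space ?Q" for q
    using that by (auto simp: \<phi>_def \<psi>_def space_pair_measure space_PiM PiE_iff extensional_def fun_eq_iff restrict_def)
  have int: "(\<integral>\<^sup>+z. K z \<partial>?P) = (\<integral>\<^sup>+q. K (\<phi> q) \<partial>?Q)" if K: "K \<in> borel_measurable ?P" for K :: "_ \<Rightarrow> ennreal"
  proof -
    have Kq: "(\<lambda>q. K (\<phi> q)) \<in> borel_measurable ?Q"
      by (rule measurable_compose[OF phi K])
    have "(\<integral>\<^sup>+z. K z \<partial>?P) = (\<integral>\<^sup>+xs. \<integral>\<^sup>+q. K (xs, q) \<partial>(?T \<Otimes>\<^sub>M ?Pr {1..k}) \<partial>?Pn {..k})"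
      by (rule TR.nn_integral_fst[symmetric, OF K])
    also have "\<dots> = (\<integral>\<^sup>+x'. \<integral>\<^sup>+x. \<integral>\<^sup>+q. K (x'(k := x), q) \<partial>(?T \<Otimes>\<^sub>M ?Pr {1..k}) \<partial>lborel \<partial>?Pn {..<k})"
    proof (rule n.product_nn_integral_insert[of "{..<k}" k, folded ins])
      show "(\<lambda>xs. \<integral>\<^sup>+q. K (xs, q) \<partial>(?T \<Otimes>\<^sub>M ?Pr {1..k})) \<in> borel_measurable (?Pn {..k})"
        using TR.borel_measurable_nn_integral_fst[OF K] .
    qed simp_all
    also have "\<dots> = (\<integral>\<^sup>+x'. \<integral>\<^sup>+p. K (\<phi> (x', p)) \<partial>?L \<partial>?Pn {..<k})"
    proof (rule nn_integral_cong)
      fix x' assume "x' \<in> space (?Pn {..<k})"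
      then have "(\<lambda>p. K (\<phi> (x', p))) \<in> borel_measurable ?L"
        by (intro measurable_compose[OF measurable_Pair1' Kq])
      from TR.nn_integral_fst[OF this]
      show "(\<integral>\<^sup>+x. \<integral>\<^sup>+q. K (x'(k := x), q) \<partial>(?T \<Otimes>\<^sub>M ?Pr {1..k}) \<partial>lborel) = (\<integral>\<^sup>+p. K (\<phi> (x', p)) \<partial>?L)"
        by (simp add: \<phi>_def)
    qed
    also have "\<dots> = (\<integral>\<^sup>+q. K (\<phi> q) \<partial>?Q)"
      by (rule L.nn_integral_fst[OF Kq])
    finally show ?thesis .
  qed
  define f where "f = (\<lambda>(x, t, y). path_density \<Phi> h \<Sigma> \<Gamma> p0 k x t y)"
  have D: "distributed M ?Q
      (\<lambda>\<omega>. (\<lambda>i\<in>{..<k}. X i \<omega>, X k \<omega>, \<theta> \<omega>, \<lambda>i\<in>{1..k}. Y i \<omega>)) (\<lambda>q. ennreal (f (\<phi> q)))"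
    using distributed_change_of_coordinates[OF distributed_path[of k] phi psi inv int]
    by (simp add: \<psi>_def f_def restrict_restrict split_beta' cap)
  have "distributed M ?L (\<lambda>\<omega>. (X k \<omega>, \<theta> \<omega>, \<lambda>i\<in>{1..k}. Y i \<omega>)) (\<lambda>b. ennreal (LINT a|?Pn {..<k}. f (\<phi> (a, b))))"
    by (rule distributed_real_marginal[OF Pn.sigma_finite_measure_axioms L.sigma_finite_measure_axioms D])
       (auto simp: f_def \<phi>_def space_pair_measure path_density_nonneg)
  then show ?thesis
    by (simp add: f_def \<phi>_def joint_density_def split_beta')
qed

lemma distributed_evidence:
  "distributed M (\<Pi>\<^sub>M i\<in>{1..k}. lborel) (\<lambda>\<omega>. \<lambda>i\<in>{1..k}. Y i \<omega>)
     (\<lambda>y. ennreal (evidence \<Theta> \<Phi> h \<Sigma> \<Gamma> p0 k y))"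
proof -
  let ?T = "lebesgue_param \<Theta>"
  let ?L = "lborel :: (real^'n) measure"
  let ?R = "\<Pi>\<^sub>M i\<in>{1..k}. lborel :: (real^'r) measure"
  interpret r: product_sigma_finite "\<lambda>_::nat. lborel :: (real^'r) measure" ..
  interpret T: sigma_finite_measure ?T by (rule sigma_finite_param)
  interpret R: sigma_finite_measure ?R by (rule r.sigma_finite) simp
  interpret TR: pair_sigma_finite ?T ?R ..
  interpret LT: pair_sigma_finite ?L ?T ..
  define \<phi> :: "((real^'n) \<times> (real^'d)) \<times> (nat \<Rightarrow> real^'r) \<Rightarrow> _" where "\<phi> = (\<lambda>((x, t), y). (x, t, y))"
  define \<psi> :: "(real^'n) \<times> (real^'d) \<times> (nat \<Rightarrow> real^'r) \<Rightarrow> _" where "\<psi> = (\<lambda>(x, t, y). ((x, t), y))"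
  have phi: "\<phi> \<in> (?L \<Otimes>\<^sub>M ?T) \<Otimes>\<^sub>M ?R \<rightarrow>\<^sub>M ?L \<Otimes>\<^sub>M (?T \<Otimes>\<^sub>M ?R)"
    unfolding \<phi>_def split_beta'
    by (intro measurable_Pair measurable_compose[OF measurable_fst] measurable_fst measurable_snd)
  have psi: "\<psi> \<in> ?L \<Otimes>\<^sub>M (?T \<Otimes>\<^sub>M ?R) \<rightarrow>\<^sub>M (?L \<Otimes>\<^sub>M ?T) \<Otimes>\<^sub>M ?R"
    unfolding \<psi>_def split_beta'
    by (intro measurable_Pair measurable_compose[OF measurable_snd] measurable_fst measurable_snd)
  have int: "(\<integral>\<^sup>+z. K z \<partial>(?L \<Otimes>\<^sub>M (?T \<Otimes>\<^sub>M ?R))) = (\<integral>\<^sup>+q. K (\<phi> q) \<partial>((?L \<Otimes>\<^sub>M ?T) \<Otimes>\<^sub>M ?R))"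
    if K: "K \<in> borel_measurable (?L \<Otimes>\<^sub>M (?T \<Otimes>\<^sub>M ?R))" for K :: "_ \<Rightarrow> ennreal"
  proof -
    have Kq: "(\<lambda>q. K (\<phi> q)) \<in> borel_measurable ((?L \<Otimes>\<^sub>M ?T) \<Otimes>\<^sub>M ?R)"
      by (rule measurable_compose[OF phi K])
    have "(\<integral>\<^sup>+z. K z \<partial>(?L \<Otimes>\<^sub>M (?T \<Otimes>\<^sub>M ?R))) = (\<integral>\<^sup>+x. \<integral>\<^sup>+q. K (x, q) \<partial>(?T \<Otimes>\<^sub>M ?R) \<partial>?L)"
      by (rule TR.nn_integral_fst[symmetric, OF K])
    also have "\<dots> = (\<integral>\<^sup>+x. \<integral>\<^sup>+t. \<integral>\<^sup>+y. K (x, t, y) \<partial>?R \<partial>?T \<partial>?L)"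
    proof (rule nn_integral_cong)
      fix x assume "x \<in> space ?L"
      then have "(\<lambda>q. K (x, q)) \<in> borel_measurable (?T \<Otimes>\<^sub>M ?R)"
        by (intro measurable_compose[OF measurable_Pair1' K])
      from R.nn_integral_fst[OF this]
      show "(\<integral>\<^sup>+q. K (x, q) \<partial>(?T \<Otimes>\<^sub>M ?R)) = (\<integral>\<^sup>+t. \<integral>\<^sup>+y. K (x, t, y) \<partial>?R \<partial>?T)" by simp
    qed
    also have "\<dots> = (\<integral>\<^sup>+p. \<integral>\<^sup>+y. K (\<phi> (p, y)) \<partial>?R \<partial>(?L \<Otimes>\<^sub>M ?T))"
      using T.nn_integral_fst[OF R.borel_measurable_nn_integral_fst[OF Kq]] by (simp add: \<phi>_def)
    also have "\<dots> = (\<integral>\<^sup>+q. K (\<phi> q) \<partial>((?L \<Otimes>\<^sub>M ?T) \<Otimes>\<^sub>M ?R))"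
      by (rule R.nn_integral_fst[OF Kq])
    finally show ?thesis .
  qed
  define f where "f = (\<lambda>(x, t, y). joint_density \<Phi> h \<Sigma> \<Gamma> p0 k x t y)"
  have D: "distributed M ((?L \<Otimes>\<^sub>M ?T) \<Otimes>\<^sub>M ?R)
      (\<lambda>\<omega>. ((X k \<omega>, \<theta> \<omega>), \<lambda>i\<in>{1..k}. Y i \<omega>)) (\<lambda>q. ennreal (f (\<phi> q)))"
    using distributed_change_of_coordinates[OF distributed_joint[of k] phi psi _ int]
    by (simp add: \<psi>_def \<phi>_def f_def split_beta')
  have "distributed M ?R (\<lambda>\<omega>. \<lambda>i\<in>{1..k}. Y i \<omega>) (\<lambda>y. ennreal (LINT p|(?L \<Otimes>\<^sub>M ?T). f (\<phi> (p, y))))"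
    by (rule distributed_real_marginal[OF LT.sigma_finite_measure_axioms R.sigma_finite_measure_axioms D])
       (auto simp: f_def \<phi>_def space_pair_measure joint_density_nonneg)
  then show ?thesis
    by (simp add: f_def \<phi>_def evidence_def split_beta')
qed

end

end

(*
  A filtering step sends a density f to A f / Z, where A is a positive kernel operator of mass at
  most G = (2 pi)^(-r/2) Ct^(-1/2), the bound on the observation density, and Z is the integral of
  A f.  Applied to the exact posterior p and an approximation q, with Z = p(y_k | Y_(k-1)) the
  constant of p, such a step multiplies the total variation distance by at most G / Z and the
  Hellinger distance by at most 2 sqrt (G / Z); the factor 2 is the price of the change of the
  normalising constant.  The triangle inequality through the filtered density of q_(k-1) adds the
  error made at step k, which is bounded by the divergence (Pinsker, and 2 H^2 <= KL), and the chain
  rule splits this divergence into its state and parameter parts.  Unrolling gives products of the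
  one-step evidences, which telescope to p(Y_(j+1:k) | Y_j).
*)
theory Submission
  imports Defs
begin

text \<open>Two obstacles shape the proof. The recursion is therefore proved for the extended-valued
  \<open>path_mass\<close>, where Tonelli applies at every point, and carried over to the posterior
  almost everywhere. Moreover the divergences may be infinite; they are treated as integrals of the
  nonnegative \<open>kl_integrand\<close>, and every cancellation in \<open>ennreal\<close> removes
  a finite mass.

  Gaussian densities are strictly positive, hence so is the kernel, and this makes all normalising
  constants positive for every data sequence. The step bounds contain the constant of the exact
  posterior alone, because the two numerators are compared after division by that same constant. The
  separate updates of state and parameter recombine into one step of the joint kernel, since the
  predictive likelihood cancels in their product. The mass bound G needs the Gaussian transition
  density to integrate to 1, which is proved by whitening the covariance.\<close>

section \<open>Square-integrable functions\<close>

text \<open>Cauchy-Schwarz. With a, b, c the integrals of u^2, v^2 and u v, expanding the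
  nonnegative integral of (b u - c v)^2 gives b (a b - c^2) \<ge> 0. The factor b can be removed
  unless b = 0, and then v vanishes almost everywhere, so that c = 0.\<close>

lemma L2_product:
  fixes u v :: "'a \<Rightarrow> real"
  assumes [measurable]: "u \<in> borel_measurable N" "v \<in> borel_measurable N"
    and U: "integrable N (\<lambda>x. (u x)\<^sup>2)" and V: "integrable N (\<lambda>x. (v x)\<^sup>2)"
  shows "integrable N (\<lambda>x. u x * v x)"
    and "(LINT x|N. u x * v x) \<le> sqrt (LINT x|N. (u x)\<^sup>2) * sqrt (LINT x|N. (v x)\<^sup>2)"
proof -
  have bound: "\<bar>a * b\<bar> \<le> a\<^sup>2 + b\<^sup>2" for a b :: real
  proof -
    have "0 \<le> (\<bar>a\<bar> - \<bar>b\<bar>)\<^sup>2" by simp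
    then have "2 * \<bar>a * b\<bar> \<le> a\<^sup>2 + b\<^sup>2" by (simp add: power2_diff abs_mult)
    then show ?thesis using abs_ge_zero[of "a * b"] by linarith
  qed
  show C: "integrable N (\<lambda>x. u x * v x)"
    by (rule Bochner_Integration.integrable_bound[OF Bochner_Integration.integrable_add[OF U V]])
       (use bound in \<open>auto intro!: AE_I2 order_trans[OF _ abs_ge_self]\<close>)
  define a b c where "a = (LINT x|N. (u x)\<^sup>2)" and "b = (LINT x|N. (v x)\<^sup>2)"
    and "c = (LINT x|N. u x * v x)"
  have ab: "0 \<le> a" "0 \<le> b" by (simp_all add: a_def b_def)
  have "c\<^sup>2 \<le> a * b"
  proof (cases "b = 0")
    case True
    then have "AE x in N. (v x)\<^sup>2 = 0"
      using V by (simp add: b_def integral_nonneg_eq_0_iff_AE)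
    then have "AE x in N. u x * v x = 0" by eventually_elim simp
    then have "c = 0" unfolding c_def by (rule integral_eq_zero_AE)
    then show ?thesis using ab by simp
  next
    case False
    have "0 \<le> (LINT x|N. (b * u x - c * v x)\<^sup>2)" by simp
    also have "\<dots> = (LINT x|N. b\<^sup>2 * (u x)\<^sup>2 - 2 * b * c * (u x * v x) + c\<^sup>2 * (v x)\<^sup>2)"
      by (rule Bochner_Integration.integral_cong) (simp_all add: power2_eq_square algebra_simps)
    also have "\<dots> = b\<^sup>2 * a - 2 * b * c * c + c\<^sup>2 * b"
      using U V C by (simp add: a_def b_def c_def)
    also have "\<dots> = b * (a * b - c\<^sup>2)"
      by (simp add: power2_eq_square algebra_simps)
    finally have "0 \<le> a * b - c\<^sup>2"
      using False ab by (simp add: zero_le_mult_iff)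
    then show ?thesis by simp
  qed
  then have "c \<le> sqrt (a * b)" by (rule real_le_rsqrt)
  then show "c \<le> sqrt a * sqrt b" by (simp add: real_sqrt_mult)
qed

text \<open>Reverse triangle inequality of the L2 norm. It serves twice: for the change of the
  normalising constant in \<open>hellinger_dist_normalized_le\<close>, and for the action of the
  kernel on square roots in \<open>push_sqrt_diff_le\<close>.\<close>

lemma L2_diff:
  fixes u v :: "'a \<Rightarrow> real"
  assumes [measurable]: "u \<in> borel_measurable N" "v \<in> borel_measurable N"
    and U: "integrable N (\<lambda>x. (u x)\<^sup>2)" and V: "integrable N (\<lambda>x. (v x)\<^sup>2)"
  shows "integrable N (\<lambda>x. (u x - v x)\<^sup>2)"
    and "(sqrt (LINT x|N. (u x)\<^sup>2) - sqrt (LINT x|N. (v x)\<^sup>2))\<^sup>2 \<le> (LINT x|N. (u x - v x)\<^sup>2)"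
proof -
  note C = L2_product[OF assms]
  have eq: "(u x - v x)\<^sup>2 = (u x)\<^sup>2 + (v x)\<^sup>2 - 2 * (u x * v x)" for x
    by (simp add: power2_diff)
  show "integrable N (\<lambda>x. (u x - v x)\<^sup>2)"
    unfolding eq using U V C(1) by simp
  have "(LINT x|N. (u x - v x)\<^sup>2)
      = (LINT x|N. (u x)\<^sup>2) + (LINT x|N. (v x)\<^sup>2) - 2 * (LINT x|N. u x * v x)"
    unfolding eq using U V C(1) by simp
  then show "(sqrt (LINT x|N. (u x)\<^sup>2) - sqrt (LINT x|N. (v x)\<^sup>2))\<^sup>2 \<le> (LINT x|N. (u x - v x)\<^sup>2)"
    using C(2) by (simp add: power2_diff)
qed

lemma L2_triangle:
  fixes u v :: "'a \<Rightarrow> real"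
  assumes "u \<in> borel_measurable N" "v \<in> borel_measurable N"
    and U: "integrable N (\<lambda>x. (u x)\<^sup>2)" and V: "integrable N (\<lambda>x. (v x)\<^sup>2)"
  shows "sqrt (LINT x|N. (u x + v x)\<^sup>2) \<le> sqrt (LINT x|N. (u x)\<^sup>2) + sqrt (LINT x|N. (v x)\<^sup>2)"
proof (rule real_le_lsqrt)
  note C = L2_product[OF assms]
  have eq: "(u x + v x)\<^sup>2 = (u x)\<^sup>2 + (v x)\<^sup>2 + 2 * (u x * v x)" for x
    by (simp add: power2_sum)
  have "(LINT x|N. (u x + v x)\<^sup>2)
      = (LINT x|N. (u x)\<^sup>2) + (LINT x|N. (v x)\<^sup>2) + 2 * (LINT x|N. u x * v x)"
    unfolding eq using U V C(1) by simp
  then show "(LINT x|N. (u x + v x)\<^sup>2)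
      \<le> (sqrt (LINT x|N. (u x)\<^sup>2) + sqrt (LINT x|N. (v x)\<^sup>2))\<^sup>2"
    using C(2) by (simp add: power2_sum)
qed simp_all


section \<open>Total variation and Hellinger distance\<close>

lemma prob_density_measurable: "prob_density N f \<Longrightarrow> f \<in> borel_measurable N"
  and prob_density_nonneg: "prob_density N f \<Longrightarrow> x \<in> space N \<Longrightarrow> 0 \<le> f x"
  and prob_density_nn_integral: "prob_density N f \<Longrightarrow> (\<integral>\<^sup>+x. ennreal (f x) \<partial>N) = 1"
  by (auto simp: prob_density_def)

lemma prob_density_has_bochner_integral:
  assumes "prob_density N f"
  shows "has_bochner_integral N f 1"
  using assms by (intro has_bochner_integral_nn_integral) (auto simp: prob_density_def)

lemma prob_density_integrable: "prob_density N f \<Longrightarrow> integrable N f"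
  and prob_density_integral: "prob_density N f \<Longrightarrow> integral\<^sup>L N f = 1"
  using prob_density_has_bochner_integral has_bochner_integral_iff by blast+

lemma prob_density_sqrt_L2:
  assumes "prob_density N f"
  shows "(\<lambda>x. sqrt (f x)) \<in> borel_measurable N"
    and "integrable N (\<lambda>x. (sqrt (f x))\<^sup>2)"
proof -
  show "(\<lambda>x. sqrt (f x)) \<in> borel_measurable N"
    using prob_density_measurable[OF assms] by simp
  have "integrable N (\<lambda>x. (sqrt (f x))\<^sup>2) \<longleftrightarrow> integrable N f"
    using prob_density_nonneg[OF assms] by (intro Bochner_Integration.integrable_cong) auto
  then show "integrable N (\<lambda>x. (sqrt (f x))\<^sup>2)"
    using prob_density_integrable[OF assms] by simp
qed

lemma tv_dist_triangle:
  assumes "prob_density N f" "prob_density N g" "prob_density N h"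
  shows "tv_dist N f h \<le> tv_dist N f g + tv_dist N g h"
proof -
  note i = assms[THEN prob_density_integrable]
  have "(LINT x|N. \<bar>f x - h x\<bar>) \<le> (LINT x|N. \<bar>f x - g x\<bar> + \<bar>g x - h x\<bar>)"
    using i by (intro integral_mono) auto
  also have "\<dots> = (LINT x|N. \<bar>f x - g x\<bar>) + (LINT x|N. \<bar>g x - h x\<bar>)"
    using i by simp
  finally show ?thesis by (simp add: tv_dist_def)
qed

lemma tv_dist_nonneg: "0 \<le> tv_dist N f g"
  by (simp add: tv_dist_def)

lemma hellinger_dist_nonneg: "0 \<le> hellinger_dist N f g"
  by (simp add: hellinger_dist_def)

text \<open>Up to the factor sqrt (1/2), the Hellinger distance is the L2 distance of the square
  roots, so that its triangle inequality is Minkowski's.\<close>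

lemma hellinger_dist_alt:
  "hellinger_dist N f g = sqrt (1/2) * sqrt (LINT x|N. (sqrt (f x) - sqrt (g x))\<^sup>2)"
  by (simp add: hellinger_dist_def real_sqrt_mult real_sqrt_divide)

lemma hellinger_dist_triangle:
  assumes "prob_density N f" "prob_density N g" "prob_density N h"
  shows "hellinger_dist N f h \<le> hellinger_dist N f g + hellinger_dist N g h"
proof -
  note L2 = assms[THEN prob_density_sqrt_L2(1)] assms[THEN prob_density_sqrt_L2(2)]
  have "sqrt (LINT x|N. (sqrt (f x) - sqrt (h x))\<^sup>2)
      = sqrt (LINT x|N. ((sqrt (f x) - sqrt (g x)) + (sqrt (g x) - sqrt (h x)))\<^sup>2)" by simp
  also have "\<dots> \<le> sqrt (LINT x|N. (sqrt (f x) - sqrt (g x))\<^sup>2) + sqrt (LINT x|N. (sqrt (g x) - sqrt (h x))\<^sup>2)"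
    using L2 by (intro L2_triangle L2_diff) auto
  finally show ?thesis
    unfolding hellinger_dist_alt by (simp flip: distrib_left)
qed

text \<open>Needed because the recursion for the posterior is an identity outside a null set
  only.\<close>

lemma tv_dist_cong_AE:
  assumes "AE x in N. f x = f' x" "AE x in N. g x = g' x"
    and [measurable]: "f \<in> borel_measurable N" "f' \<in> borel_measurable N" "g \<in> borel_measurable N" "g' \<in> borel_measurable N"
  shows "tv_dist N f g = tv_dist N f' g'"
proof -
  have "AE x in N. \<bar>f x - g x\<bar> = \<bar>f' x - g' x\<bar>"
    using assms(1,2) by eventually_elim simp
  then show ?thesis
    unfolding tv_dist_def by (subst integral_cong_AE[of _ _ "\<lambda>x. \<bar>f' x - g' x\<bar>"]) auto
qed

lemma hellinger_dist_cong_AE: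
  assumes "AE x in N. f x = f' x" "AE x in N. g x = g' x"
    and [measurable]: "f \<in> borel_measurable N" "f' \<in> borel_measurable N" "g \<in> borel_measurable N" "g' \<in> borel_measurable N"
  shows "hellinger_dist N f g = hellinger_dist N f' g'"
proof -
  have "AE x in N. (sqrt (f x) - sqrt (g x))\<^sup>2 = (sqrt (f' x) - sqrt (g' x))\<^sup>2"
    using assms(1,2) by eventually_elim simp
  then show ?thesis
    unfolding hellinger_dist_def by (subst integral_cong_AE[of _ _ "\<lambda>x. (sqrt (f' x) - sqrt (g' x))\<^sup>2"]) auto
qed

text \<open>With P and Q the integrals of the two one-sided differences, the L1 distance is P + Q
  and the change of mass is P - Q. Their combination P + Q + \<bar>P - Q\<bar> is 2 max(P, Q), which
  is how \<open>tv_dist_normalized_le\<close> uses the two identities.\<close>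

lemma integral_abs_eq_pos_parts:
  fixes f g :: "'a \<Rightarrow> real"
  assumes f: "integrable N f" and g: "integrable N g"
  shows "(LINT x|N. \<bar>f x - g x\<bar>) = (LINT x|N. max 0 (f x - g x)) + (LINT x|N. max 0 (g x - f x))"
    and "integral\<^sup>L N f - integral\<^sup>L N g = (LINT x|N. max 0 (f x - g x)) - (LINT x|N. max 0 (g x - f x))"
proof -
  have i: "integrable N (\<lambda>x. max 0 (f x - g x))" "integrable N (\<lambda>x. max 0 (g x - f x))"
    using f g by simp_all
  show "(LINT x|N. \<bar>f x - g x\<bar>) = (LINT x|N. max 0 (f x - g x)) + (LINT x|N. max 0 (g x - f x))"
    by (subst Bochner_Integration.integral_add[OF i, symmetric]) (auto intro!: Bochner_Integration.integral_cong)
  have "integral\<^sup>L N f - integral\<^sup>L N g = (LINT x|N. f x - g x)"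
    using f g by simp
  also have "\<dots> = (LINT x|N. max 0 (f x - g x) - max 0 (g x - f x))"
    by (rule Bochner_Integration.integral_cong) auto
  also have "\<dots> = (LINT x|N. max 0 (f x - g x)) - (LINT x|N. max 0 (g x - f x))"
    by (rule Bochner_Integration.integral_diff[OF i])
  finally show "integral\<^sup>L N f - integral\<^sup>L N g = \<dots>" .
qed

text \<open>Equal masses force the two one-sided parts to agree, so each is half of the L1
  distance.\<close>

lemma tv_dist_eq_pos_part:
  assumes "prob_density N f" "prob_density N g"
  shows "(LINT x|N. max 0 (f x - g x)) = tv_dist N f g"
    and "(LINT x|N. max 0 (g x - f x)) = tv_dist N f g"
  using integral_abs_eq_pos_parts[OF assms[THEN prob_density_integrable]] assms[THEN prob_density_integral]
  by (simp_all add: tv_dist_def)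

text \<open>
  Bounding by the larger of the two one-sided differences, instead of the \<open>L\<^sup>1\<close> norm of
  \<open>F1 - F2\<close> plus the change of the normalising constant, avoids losing a factor 2.
\<close>

lemma tv_dist_normalized_le:
  fixes F1 F2 :: "'a \<Rightarrow> real"
  assumes i: "integrable N F1" "integrable N F2"
    and nonneg: "AE x in N. 0 \<le> F2 x"
    and Z: "integral\<^sup>L N F1 = Z1" "integral\<^sup>L N F2 = Z2" "0 < Z1" "0 < Z2"
    and B: "(LINT x|N. max 0 (F1 x - F2 x)) \<le> B" "(LINT x|N. max 0 (F2 x - F1 x)) \<le> B"
  shows "tv_dist N (\<lambda>x. F1 x / Z1) (\<lambda>x. F2 x / Z2) \<le> B / Z1"
proof -
  let ?c = "\<bar>Z2 - Z1\<bar> / (Z1 * Z2)"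
  note parts = integral_abs_eq_pos_parts[OF i]
  have "(LINT x|N. \<bar>F1 x / Z1 - F2 x / Z2\<bar>) \<le> (LINT x|N. \<bar>F1 x - F2 x\<bar> / Z1 + F2 x * ?c)"
  proof (rule integral_mono_AE)
    show "AE x in N. \<bar>F1 x / Z1 - F2 x / Z2\<bar> \<le> \<bar>F1 x - F2 x\<bar> / Z1 + F2 x * ?c"
      using nonneg
    proof eventually_elim
      case (elim x)
      \<comment> \<open>Both numerators are divided by \<open>Z1\<close>. The correction term
        carries \<open>F2\<close>, of integral \<open>Z2\<close>, so that \<open>Z2\<close> cancels
        after integration and the bound contains \<open>Z1\<close> alone.\<close>
      have "F1 x / Z1 - F2 x / Z2 = (F1 x - F2 x) / Z1 + F2 x * ((Z2 - Z1) / (Z1 * Z2))"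
        using Z by (simp add: field_simps)
      then have "\<bar>F1 x / Z1 - F2 x / Z2\<bar> \<le> \<bar>(F1 x - F2 x) / Z1\<bar> + \<bar>F2 x * ((Z2 - Z1) / (Z1 * Z2))\<bar>"
        using abs_triangle_ineq by metis
      also have "\<dots> = \<bar>F1 x - F2 x\<bar> / Z1 + F2 x * ?c"
        using Z elim by (simp add: abs_mult)
      finally show ?case .
    qed
  qed (use i in auto)
  also have "\<dots> = (LINT x|N. \<bar>F1 x - F2 x\<bar>) / Z1 + Z2 * ?c"
    using i Z by simp
  also have "\<dots> = ((LINT x|N. \<bar>F1 x - F2 x\<bar>) + \<bar>Z1 - Z2\<bar>) / Z1"
    using Z by (simp add: field_simps abs_minus_commute)
  also have "\<dots> \<le> 2 * B / Z1"
    using parts B Z by (intro divide_right_mono) auto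
  finally show ?thesis by (simp add: tv_dist_def mult.commute)
qed

text \<open>Normalisation of vectors in L2: sqrt F1 and sqrt F2 have norms sqrt Z1 and sqrt Z2.
  Dividing both by sqrt Z1 costs d / sqrt Z1, where d is their distance; correcting the second norm
  costs \<bar>sqrt Z1 - sqrt Z2\<bar> / sqrt Z1, again at most d / sqrt Z1 by the reverse triangle
  inequality. On the right, \<open>hellinger_dist\<close> is applied to unnormalised
  functions.\<close>

lemma hellinger_dist_normalized_le:
  fixes F1 F2 :: "'a \<Rightarrow> real"
  assumes i: "integrable N F1" "integrable N F2"
    and nonneg: "\<And>x. x \<in> space N \<Longrightarrow> 0 \<le> F1 x" "\<And>x. x \<in> space N \<Longrightarrow> 0 \<le> F2 x"
    and Z: "integral\<^sup>L N F1 = Z1" "integral\<^sup>L N F2 = Z2" "0 < Z1" "0 < Z2"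
  shows "hellinger_dist N (\<lambda>x. F1 x / Z1) (\<lambda>x. F2 x / Z2) \<le> 2 / sqrt Z1 * hellinger_dist N F1 F2"
proof -
  have m: "F1 \<in> borel_measurable N" "F2 \<in> borel_measurable N"
    using i by auto
  have sq: "integrable N (\<lambda>x. (sqrt (F1 x))\<^sup>2)" "(LINT x|N. (sqrt (F1 x))\<^sup>2) = Z1"
    "integrable N (\<lambda>x. (sqrt (F2 x))\<^sup>2)" "(LINT x|N. (sqrt (F2 x))\<^sup>2) = Z2"
    using i Z nonneg
    by (simp_all cong: Bochner_Integration.integral_cong Bochner_Integration.integrable_cong)
  define d where "d = sqrt (LINT x|N. (sqrt (F1 x) - sqrt (F2 x))\<^sup>2)"
  define c where "c = (sqrt Z2 - sqrt Z1) / (sqrt Z1 * sqrt Z2)"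
  note diff = L2_diff[of "\<lambda>x. sqrt (F1 x)" N "\<lambda>x. sqrt (F2 x)"]
  have d: "\<bar>sqrt Z1 - sqrt Z2\<bar> \<le> d"
    unfolding d_def using diff(2) m sq by (intro real_le_rsqrt) simp
  have split: "sqrt (F1 x / Z1) - sqrt (F2 x / Z2)
      = (sqrt (F1 x) - sqrt (F2 x)) / sqrt Z1 + sqrt (F2 x) * c" for x
    using Z by (simp add: c_def real_sqrt_divide field_simps)
  have "sqrt (LINT x|N. (sqrt (F1 x / Z1) - sqrt (F2 x / Z2))\<^sup>2)
     \<le> sqrt (LINT x|N. ((sqrt (F1 x) - sqrt (F2 x)) / sqrt Z1)\<^sup>2) + sqrt (LINT x|N. (sqrt (F2 x) * c)\<^sup>2)"
    unfolding split using diff(1) m sq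
    by (intro L2_triangle) (simp_all add: power_divide power_mult_distrib)
  also have "\<dots> = d / sqrt Z1 + sqrt Z2 * \<bar>c\<bar>"
    using sq Z by (simp add: power_divide power_mult_distrib d_def real_sqrt_divide real_sqrt_mult)
  also have "\<dots> = (d + \<bar>sqrt Z1 - sqrt Z2\<bar>) / sqrt Z1"
    using Z by (simp add: c_def abs_mult field_simps abs_minus_commute)
  also have "\<dots> \<le> 2 * d / sqrt Z1"
    using d Z by (intro divide_right_mono) auto
  finally have "sqrt (LINT x|N. (sqrt (F1 x / Z1) - sqrt (F2 x / Z2))\<^sup>2) \<le> 2 / sqrt Z1 * d"
    by simp
  then have "sqrt (1/2) * sqrt (LINT x|N. (sqrt (F1 x / Z1) - sqrt (F2 x / Z2))\<^sup>2)
      \<le> sqrt (1/2) * (2 / sqrt Z1 * d)"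
    by (rule mult_left_mono) simp
  then show ?thesis
    by (simp add: hellinger_dist_alt d_def ac_simps)
qed

section \<open>The Kullback-Leibler divergence as the integral of a nonnegative function\<close>

text \<open>The added term b - a integrates to 0 for probability densities and makes the integrand
  nonnegative, so that one \<open>ennreal\<close> integral replaces a difference of two. The case
  distinction is needed because a / 0 = 0 and ln 0 = 0.\<close>

definition kl_integrand :: "real \<Rightarrow> real \<Rightarrow> ennreal" where
  "kl_integrand a b = (if a \<noteq> 0 \<and> b = 0 then \<infinity> else ennreal (a * ln (a / b) - a + b))"

text \<open>This is ln u \<le> u - 1 at u = b / a; it gives the nonnegativity of the finite branch
  of \<open>kl_integrand\<close>.\<close>

lemma mult_ln_divide_ge:
  fixes a b :: real
  assumes "0 \<le> a" "0 < b"
  shows "a - b \<le> a * ln (a / b)"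
proof (cases "a = 0")
  case False
  with assms have a: "0 < a" by simp
  have "ln (b / a) \<le> b / a - 1"
    using a assms by (intro ln_le_minus_one) simp
  then have "a * ln (b / a) \<le> b - a"
    using a by (simp add: field_simps)
  moreover have "ln (a / b) = - ln (b / a)"
    using a assms by (simp add: ln_div)
  ultimately show ?thesis by simp
qed (use assms in simp)

lemma kl_integrand_measurable [measurable]:
  assumes [measurable]: "f \<in> borel_measurable N" "g \<in> borel_measurable N"
  shows "(\<lambda>x. kl_integrand (f x) (g x)) \<in> borel_measurable N"
  unfolding kl_integrand_def by measurable

text \<open>Let p and m be the positive and negative parts in the definition of \<open>KL\<close>.
  The pointwise identity p + g = \<open>kl_integrand\<close> + f + m contains no subtraction and
  holds also where p is infinite. After integration the masses of f and g, both 1, cancel. As m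
  \<le> g, the integral of m is finite and may be subtracted.\<close>

lemma KL_eq_nn_integral:
  assumes f: "prob_density N f" and g: "prob_density N g"
  shows "KL N f g = (\<integral>\<^sup>+x. kl_integrand (f x) (g x) \<partial>N)"
proof -
  note [measurable] = f[unfolded prob_density_def, THEN conjunct1] g[unfolded prob_density_def, THEN conjunct1]
  have fg: "0 \<le> f x" "0 \<le> g x" if "x \<in> space N" for x
    using that f g by (auto simp: prob_density_def)
  have int: "(\<integral>\<^sup>+x. ennreal (f x) \<partial>N) = 1" "(\<integral>\<^sup>+x. ennreal (g x) \<partial>N) = 1"
    using f g by (auto simp: prob_density_def)
  define p where "p x = (if f x \<noteq> 0 \<and> g x = 0 then \<infinity> else ennreal (f x * ln (f x / g x)))" for x
  define m where "m x = ennreal (- (f x * ln (f x / g x)))" for x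
  have [measurable]: "p \<in> borel_measurable N" "m \<in> borel_measurable N"
    unfolding p_def m_def by measurable
  have pw: "p x + ennreal (g x) = kl_integrand (f x) (g x) + ennreal (f x) + m x" if "x \<in> space N" for x
  proof (cases "g x = 0")
    case True
    then show ?thesis by (simp add: p_def m_def kl_integrand_def)
  next
    case False
    then have le: "f x - g x \<le> f x * ln (f x / g x)"
      using fg[OF that] by (intro mult_ln_divide_ge) auto
    show ?thesis
    proof (cases "0 \<le> f x * ln (f x / g x)")
      case True
      then show ?thesis
        using False le fg[OF that]
        by (simp add: p_def m_def kl_integrand_def ennreal_neg flip: ennreal_plus)
    next
      case neg: False
      then show ?thesis
        using False le fg[OF that]
        by (simp add: p_def m_def kl_integrand_def ennreal_neg flip: ennreal_plus)
    qed
  qed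
  have "m x \<le> ennreal (g x)" if "x \<in> space N" for x
  proof (cases "g x = 0")
    case False
    then have "f x - g x \<le> f x * ln (f x / g x)"
      using fg[OF that] by (intro mult_ln_divide_ge) auto
    then show ?thesis
      using fg[OF that] unfolding m_def by (intro ennreal_leI) simp
  qed (simp add: m_def)
  then have "(\<integral>\<^sup>+x. m x \<partial>N) \<le> (\<integral>\<^sup>+x. ennreal (g x) \<partial>N)"
    by (rule nn_integral_mono)
  then have m: "(\<integral>\<^sup>+x. m x \<partial>N) \<noteq> \<infinity>"
    using int by (auto simp: top_unique)
  have "(\<integral>\<^sup>+x. p x \<partial>N) + 1 = (\<integral>\<^sup>+x. p x + ennreal (g x) \<partial>N)"
    by (simp add: nn_integral_add int)
  also have "\<dots> = (\<integral>\<^sup>+x. kl_integrand (f x) (g x) + ennreal (f x) + m x \<partial>N)"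
    by (intro nn_integral_cong pw)
  also have "\<dots> = (\<integral>\<^sup>+x. kl_integrand (f x) (g x) \<partial>N) + 1 + (\<integral>\<^sup>+x. m x \<partial>N)"
    by (simp add: nn_integral_add int)
  finally have "1 + (\<integral>\<^sup>+x. p x \<partial>N) = 1 + ((\<integral>\<^sup>+x. kl_integrand (f x) (g x) \<partial>N) + (\<integral>\<^sup>+x. m x \<partial>N))"
    by (simp add: ac_simps)
  then have "(\<integral>\<^sup>+x. p x \<partial>N) = (\<integral>\<^sup>+x. kl_integrand (f x) (g x) \<partial>N) + (\<integral>\<^sup>+x. m x \<partial>N)"
    by (simp add: ennreal_add_left_cancel)
  then show ?thesis
    using m by (simp add: KL_def p_def m_def)
qed

text \<open>Put a = s^2 and b = t^2. Then a ln (a / b) = - 2 s^2 ln (t / s), and ln (t / s) \<le> t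
  / s - 1 gives at least 2 s^2 - 2 s t; adding b - a completes the square (s - t)^2.\<close>

lemma sqrt_diff_sq_le_kl_integrand:
  assumes "0 \<le> a" "0 \<le> b"
  shows "ennreal ((sqrt a - sqrt b)\<^sup>2) \<le> kl_integrand a b"
proof (cases "b = 0 \<or> a = 0")
  case True
  then show ?thesis using assms by (auto simp: kl_integrand_def)
next
  case False
  define s t where "s = sqrt a" and "t = sqrt b"
  have st: "0 < s" "0 < t" "a = s\<^sup>2" "b = t\<^sup>2"
    using False assms by (auto simp: s_def t_def)
  have "ln (t / s) \<le> t / s - 1"
    using st by (intro ln_le_minus_one) simp
  then have "2 * s\<^sup>2 * ln (t / s) \<le> 2 * s\<^sup>2 * (t / s - 1)"
    by (intro mult_left_mono) auto
  also have "\<dots> = 2 * s * t - 2 * s\<^sup>2"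
    using st by (simp add: power2_eq_square field_simps)
  also have "2 * s\<^sup>2 * ln (t / s) = - (a * ln (a / b))"
    using st by (simp add: ln_div ln_realpow algebra_simps)
  finally have "(s - t)\<^sup>2 \<le> a * ln (a / b) - a + b"
    using st by (simp add: power2_diff)
  then show ?thesis
    using False by (simp add: kl_integrand_def s_def t_def ennreal_leI)
qed

text \<open>The difference \<open>?k\<close> of the two sides vanishes at 1 and has derivative 4
  \<open>?q\<close>. In turn \<open>?q\<close> vanishes at 1 and has the derivative ln v + 1 / v -
  1, which is nonnegative. So \<open>?q\<close> changes sign at 1 from negative to positive, and
  \<open>?k\<close> has its minimum 0 there.\<close>

lemma Pinsker_pointwise:
  fixes u :: real
  assumes u: "0 < u"
  shows "3 * (u - 1)\<^sup>2 \<le> (2 * u + 4) * (u * ln u - u + 1)"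
proof -
  let ?q = "\<lambda>u::real. (u + 1) * ln u - 2 * (u - 1)"
  let ?k = "\<lambda>u::real. (2 * u + 4) * (u * ln u - u + 1) - 3 * (u - 1)\<^sup>2"
  have dq: "(?q has_real_derivative ln v + 1 / v - 1) (at v)" if "0 < v" for v
    using that by (auto intro!: derivative_eq_intros simp: field_simps)
  have dq_nonneg: "0 \<le> ln v + 1 / v - 1" if "0 < v" for v :: real
    using that ln_le_minus_one[of "1 / v"] by (simp add: ln_div)
  have dk: "(?k has_real_derivative 4 * ?q v) (at v)" if "0 < v" for v
    using that by (auto intro!: derivative_eq_intros simp: field_simps)
  have dq': "\<exists>y. (?q has_real_derivative y) (at v) \<and> 0 \<le> y" if "0 < v" for v
    using dq[OF that] dq_nonneg[OF that] by blast
  have q1: "0 \<le> ?q v" if "1 \<le> v" for v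
  proof -
    have "?q 1 \<le> ?q v"
      by (rule DERIV_nonneg_imp_nondecreasing[of 1 v ?q, OF that]) (rule dq', linarith)
    then show ?thesis by simp
  qed
  have q2: "?q v \<le> 0" if "v \<le> 1" "0 < v" for v
  proof -
    have "?q v \<le> ?q 1"
      by (rule DERIV_nonneg_imp_nondecreasing[of v 1 ?q, OF that(1)]) (rule dq', use that in linarith)
    then show ?thesis by simp
  qed
  have "0 \<le> ?k u"
  proof (cases "1 \<le> u")
    case True
    have "?k 1 \<le> ?k u"
    proof (rule DERIV_nonneg_imp_nondecreasing[of 1 u ?k, OF True])
      fix v :: real assume v: "1 \<le> v"
      then show "\<exists>y. (?k has_real_derivative y) (at v) \<and> 0 \<le> y"
        using dk[of v] q1[OF v] by (intro exI[of _ "4 * ?q v"] conjI) auto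
    qed
    then show ?thesis by simp
  next
    case False
    have "?k 1 \<le> ?k u"
    proof (rule DERIV_nonpos_imp_nonincreasing[of u 1 ?k])
      show "u \<le> 1" using False by simp
      fix v :: real assume v: "u \<le> v" "v \<le> 1"
      then show "\<exists>y. (?k has_real_derivative y) (at v) \<and> y \<le> 0"
        using dk[of v] q2[of v] u by (intro exI[of _ "4 * ?q v"] conjI) auto
    qed
    then show ?thesis by simp
  qed
  then show ?thesis by simp
qed

text \<open>Homogeneous form of \<open>Pinsker_pointwise\<close>: take u = a / b and multiply by
  b^2. The boundary cases a = 0 and b = 0 are checked directly.\<close>

lemma abs_diff_sq_le_kl_integrand:
  assumes "0 \<le> a" "0 \<le> b"
  shows "ennreal (3 * (a - b)\<^sup>2) \<le> ennreal (2 * a + 4 * b) * kl_integrand a b"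
proof (cases "b = 0")
  case True
  then show ?thesis using assms by (auto simp: kl_integrand_def ennreal_mult_top)
next
  case b: False
  show ?thesis
  proof (cases "a = 0")
    case True
    then show ?thesis
      using b assms by (simp add: kl_integrand_def power2_eq_square flip: ennreal_mult)
  next
    case False
    then have ab: "0 < a" "0 < b" using b assms by auto
    have "3 * (a - b)\<^sup>2 = b\<^sup>2 * (3 * (a / b - 1)\<^sup>2)"
      using ab by (simp add: power2_eq_square field_simps)
    also have "\<dots> \<le> b\<^sup>2 * ((2 * (a / b) + 4) * (a / b * ln (a / b) - a / b + 1))"
      using ab by (intro mult_left_mono Pinsker_pointwise) auto
    also have "\<dots> = (2 * a + 4 * b) * (a * ln (a / b) - a + b)"
      using ab by (simp add: power2_eq_square field_simps)
    finally have le: "3 * (a - b)\<^sup>2 \<le> (2 * a + 4 * b) * (a * ln (a / b) - a + b)" .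
    have "0 \<le> a * ln (a / b) - a + b"
      using mult_ln_divide_ge[of a b] ab by simp
    then show ?thesis
      using le ab by (simp add: kl_integrand_def ennreal_leI flip: ennreal_mult del: ennreal_plus)
  qed
qed

section \<open>Bounding the distances by the divergence\<close>

text \<open>An infinite divergence makes the bound trivial, provided that c > 0 excludes the product
  0 * \<infinity> = 0. Only the finite case remains, over the reals.\<close>

lemma ennreal_le_ennsqrtI:
  assumes "\<And>k. 0 \<le> k \<Longrightarrow> K = ennreal k \<Longrightarrow> d \<le> c * sqrt k" and "0 < c"
  shows "ennreal d \<le> ennreal c * ennsqrt K"
proof (cases K)
  case (real k)
  then show ?thesis
    using assms by (simp add: ennsqrt_def ennreal_leI flip: ennreal_mult)
next
  case top
  then show ?thesis using assms by (simp add: ennsqrt_def ennreal_mult_top)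
qed

lemma hellinger_dist_le_kl_integrand:
  assumes f: "prob_density N f" and g: "prob_density N g"
  shows "ennreal (hellinger_dist N g f)
    \<le> ennreal (1 / sqrt 2) * ennsqrt (\<integral>\<^sup>+x. kl_integrand (f x) (g x) \<partial>N)"
proof (rule ennreal_le_ennsqrtI)
  fix k assume k: "0 \<le> k" "(\<integral>\<^sup>+x. kl_integrand (f x) (g x) \<partial>N) = ennreal k"
  note [measurable] = prob_density_measurable[OF f] prob_density_measurable[OF g]
  have "(LINT x|N. (sqrt (g x) - sqrt (f x))\<^sup>2) = enn2real (\<integral>\<^sup>+x. ennreal ((sqrt (g x) - sqrt (f x))\<^sup>2) \<partial>N)"
    by (rule integral_eq_nn_integral) auto
  also have "\<dots> \<le> enn2real (\<integral>\<^sup>+x. kl_integrand (f x) (g x) \<partial>N)"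
  proof (intro enn2real_mono nn_integral_mono)
    fix x assume "x \<in> space N"
    then show "ennreal ((sqrt (g x) - sqrt (f x))\<^sup>2) \<le> kl_integrand (f x) (g x)"
      using sqrt_diff_sq_le_kl_integrand[of "f x" "g x"] f g
      by (simp add: prob_density_nonneg power2_commute)
  qed (simp add: k)
  finally have "(LINT x|N. (sqrt (g x) - sqrt (f x))\<^sup>2) \<le> k"
    using k by simp
  then have "sqrt (LINT x|N. (sqrt (g x) - sqrt (f x))\<^sup>2) \<le> sqrt k"
    by (rule real_sqrt_le_mono)
  then show "hellinger_dist N g f \<le> 1 / sqrt 2 * sqrt k"
    by (simp add: hellinger_dist_alt real_sqrt_divide divide_right_mono)
qed simp

text \<open>Pinsker's inequality. Pointwise \<bar>g - f\<bar> \<le> u v with u^2 = 2 f + 4 g, of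
  integral 6, and v^2 one third of the divergence integrand, of integral k / 3. Cauchy-Schwarz
  bounds the L1 distance by sqrt 6 * sqrt (k / 3) = sqrt (2 k), and half of this is sqrt k / sqrt
  2.\<close>

lemma tv_dist_le_kl_integrand:
  assumes f: "prob_density N f" and g: "prob_density N g"
  shows "ennreal (tv_dist N g f)
    \<le> ennreal (1 / sqrt 2) * ennsqrt (\<integral>\<^sup>+x. kl_integrand (f x) (g x) \<partial>N)"
proof (rule ennreal_le_ennsqrtI)
  fix k assume k: "0 \<le> k" "(\<integral>\<^sup>+x. kl_integrand (f x) (g x) \<partial>N) = ennreal k"
  note [measurable] = prob_density_measurable[OF f] prob_density_measurable[OF g]
  note fg = prob_density_nonneg[OF f] prob_density_nonneg[OF g]
  note i = prob_density_integrable[OF f] prob_density_integrable[OF g]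
  define p where "p x = enn2real (kl_integrand (f x) (g x))" for x
  have [measurable]: "p \<in> borel_measurable N" unfolding p_def by measurable
  have "AE x in N. kl_integrand (f x) (g x) \<noteq> \<infinity>"
    using k by (intro nn_integral_PInf_AE) auto
  then have p: "AE x in N. kl_integrand (f x) (g x) = ennreal (p x)"
    by eventually_elim (simp add: p_def top.not_eq_extremum)
  then have "(\<integral>\<^sup>+x. ennreal (p x) \<partial>N) = ennreal k"
    using nn_integral_cong_AE[OF p] k by simp
  then have "has_bochner_integral N p k"
    using k by (intro has_bochner_integral_nn_integral) (auto simp: p_def)
  then have ip: "integrable N p" "integral\<^sup>L N p = k"
    by (auto simp: has_bochner_integral_iff)
  define u where "u x = sqrt (2 * f x + 4 * g x)" for x
  define v where "v x = sqrt (p x / 3)" for x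
  have [measurable]: "u \<in> borel_measurable N" "v \<in> borel_measurable N"
    unfolding u_def v_def by measurable
  have u2: "(u x)\<^sup>2 = 2 * f x + 4 * g x" if "x \<in> space N" for x
    using fg[OF that] by (simp add: u_def)
  have v2: "(v x)\<^sup>2 = p x / 3" for x
    by (simp add: v_def p_def)
  have U: "integrable N (\<lambda>x. (u x)\<^sup>2)" "(LINT x|N. (u x)\<^sup>2) = 6"
    using i prob_density_integral[OF f] prob_density_integral[OF g]
    by (simp_all add: u2 cong: Bochner_Integration.integral_cong Bochner_Integration.integrable_cong)
  have V: "integrable N (\<lambda>x. (v x)\<^sup>2)" "(LINT x|N. (v x)\<^sup>2) = k / 3"
    using ip by (simp_all add: v2)
  have "AE x in N. \<bar>g x - f x\<bar> \<le> u x * v x"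
    using p
  proof (rule AE_mp, intro AE_I2 impI)
    fix x assume x: "x \<in> space N" and eq: "kl_integrand (f x) (g x) = ennreal (p x)"
    have "ennreal (3 * (f x - g x)\<^sup>2) \<le> ennreal (2 * f x + 4 * g x) * ennreal (p x)"
      using abs_diff_sq_le_kl_integrand[of "f x" "g x"] fg[OF x] by (simp only: eq)
    also have "\<dots> = ennreal ((2 * f x + 4 * g x) * p x)"
      using fg[OF x] by (intro ennreal_mult[symmetric]) (auto simp: p_def)
    finally have "3 * (f x - g x)\<^sup>2 \<le> (2 * f x + 4 * g x) * p x"
      using fg[OF x] by (subst (asm) ennreal_le_iff) (auto simp: p_def)
    then have "(g x - f x)\<^sup>2 \<le> (u x * v x)\<^sup>2"
      by (simp add: power_mult_distrib u2[OF x] v2 power2_commute)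
    moreover have "0 \<le> u x * v x"
      using fg[OF x] by (simp add: u_def v_def p_def)
    ultimately show "\<bar>g x - f x\<bar> \<le> u x * v x"
      by (metis abs_le_square_iff abs_of_nonneg)
  qed
  then have "(LINT x|N. \<bar>g x - f x\<bar>) \<le> (LINT x|N. u x * v x)"
    using i L2_product(1)[of u N v] U V by (intro integral_mono_AE) auto
  also have "\<dots> \<le> sqrt 6 * sqrt (k / 3)"
    using L2_product(2)[of u N v] U V by simp
  also have "\<dots> = sqrt 2 * sqrt k"
    by (simp flip: real_sqrt_mult)
  finally have "tv_dist N g f \<le> sqrt 2 / 2 * sqrt k"
    by (simp add: tv_dist_def)
  moreover have "sqrt 2 / 2 = 1 / sqrt 2"
    by (simp add: field_simps)
  ultimately show "tv_dist N g f \<le> 1 / sqrt 2 * sqrt k"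
    by (simp only:)
qed simp

text \<open>
  The four product terms integrate to 1 each; they are distributed over the two sides so that the
  identity involves no subtraction.
\<close>

lemma kl_integrand_mult:
  assumes nn: "0 \<le> a" "0 \<le> a'" "0 \<le> b" "0 \<le> b'"
  shows "kl_integrand (a * b) (a' * b') + (ennreal b * ennreal a' + ennreal a * ennreal b')
    = ennreal b * kl_integrand a a' + ennreal a * kl_integrand b b'
      + (ennreal a * ennreal b + ennreal a' * ennreal b')"
proof -
  consider "b = 0 \<or> a = 0" | "a \<noteq> 0" "b \<noteq> 0" "a' = 0 \<or> b' = 0" | "a \<noteq> 0" "b \<noteq> 0" "a' \<noteq> 0" "b' \<noteq> 0"
    by auto
  then show ?thesis
  proof cases
    case 1
    then show ?thesis using nn
      by (auto simp: kl_integrand_def ennreal_mult[symmetric] ac_simps)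
  next
    case 2
    then show ?thesis using nn
      by (auto simp: kl_integrand_def ennreal_mult_top)
  next
    case 3
    then have pos: "0 < a" "0 < b" "0 < a'" "0 < b'" using nn by auto
    have ge: "0 \<le> a * ln (a / a') - a + a'" "0 \<le> b * ln (b / b') - b + b'"
      "0 \<le> (a * b) * ln ((a * b) / (a' * b')) - a * b + a' * b'"
      using mult_ln_divide_ge[of a a'] mult_ln_divide_ge[of b b'] mult_ln_divide_ge[of "a * b" "a' * b'"] pos
      by simp_all
    have "ln ((a * b) / (a' * b')) = ln (a / a') + ln (b / b')"
      using pos by (simp add: ln_div ln_mult)
    then have "((a * b) * ln ((a * b) / (a' * b')) - a * b + a' * b') + (b * a' + a * b')
      = b * (a * ln (a / a') - a + a') + a * (b * ln (b / b') - b + b') + (a * b + a' * b')"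
      by (simp add: algebra_simps)
    then show ?thesis
      using pos ge by (simp add: kl_integrand_def ennreal_mult[symmetric] ennreal_plus[symmetric] del: ennreal_plus)
  qed
qed

section \<open>Chain rule for the divergence of factorised densities\<close>

context pair_sigma_finite
begin

lemma nn_integral_cond_density:
  assumes m: "(\<lambda>(x, t). r x t) \<in> borel_measurable (M1 \<Otimes>\<^sub>M M2)"
    and r: "\<And>t. t \<in> space M2 \<Longrightarrow> prob_density M1 (\<lambda>x. r x t)"
    and [measurable]: "c \<in> borel_measurable M2"
  shows "(\<integral>\<^sup>+(x, t). ennreal (r x t) * c t \<partial>(M1 \<Otimes>\<^sub>M M2)) = (\<integral>\<^sup>+t. c t \<partial>M2)"
proof -
  have [measurable]: "(\<lambda>z. r (fst z) (snd z)) \<in> borel_measurable (M1 \<Otimes>\<^sub>M M2)"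
    using m by (simp add: split_beta')
  have "(\<integral>\<^sup>+(x, t). ennreal (r x t) * c t \<partial>(M1 \<Otimes>\<^sub>M M2)) = (\<integral>\<^sup>+t. \<integral>\<^sup>+x. ennreal (r x t) * c t \<partial>M1 \<partial>M2)"
    by (subst nn_integral_snd[symmetric]) (auto simp: split_beta')
  also have "\<dots> = (\<integral>\<^sup>+t. c t \<partial>M2)"
  proof (rule nn_integral_cong)
    fix t assume "t \<in> space M2"
    note rt = r[OF this]
    note [measurable] = prob_density_measurable[OF rt]
    show "(\<integral>\<^sup>+x. ennreal (r x t) * c t \<partial>M1) = c t"
      by (simp add: nn_integral_multc prob_density_nn_integral[OF rt])
  qed
  finally show ?thesis .
qed

lemma prob_density_mult:
  assumes m: "(\<lambda>(x, t). r x t) \<in> borel_measurable (M1 \<Otimes>\<^sub>M M2)"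
    and r: "\<And>t. t \<in> space M2 \<Longrightarrow> prob_density M1 (\<lambda>x. r x t)"
    and n: "prob_density M2 n"
  shows "prob_density (M1 \<Otimes>\<^sub>M M2) (\<lambda>(x, t). r x t * n t)"
  unfolding prob_density_def
proof (intro conjI ballI)
  have [measurable]: "(\<lambda>z. r (fst z) (snd z)) \<in> borel_measurable (M1 \<Otimes>\<^sub>M M2)" "n \<in> borel_measurable M2"
    using m n by (simp_all add: split_beta' prob_density_def)
  show "(\<lambda>(x, t). r x t * n t) \<in> borel_measurable (M1 \<Otimes>\<^sub>M M2)"
    unfolding split_beta' by measurable
  have nn: "0 \<le> r (fst z) (snd z)" "0 \<le> n (snd z)" if "z \<in> space (M1 \<Otimes>\<^sub>M M2)" for z
    using that prob_density_nonneg[OF r, of "snd z" "fst z"] prob_density_nonneg[OF n, of "snd z"]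
    by (auto simp: space_pair_measure)
  then show "0 \<le> (case z of (x, t) \<Rightarrow> r x t * n t)" if "z \<in> space (M1 \<Otimes>\<^sub>M M2)" for z
    using that by (simp add: split_beta')
  have "(\<integral>\<^sup>+z. ennreal (case z of (x, t) \<Rightarrow> r x t * n t) \<partial>(M1 \<Otimes>\<^sub>M M2))
      = (\<integral>\<^sup>+(x, t). ennreal (r x t) * ennreal (n t) \<partial>(M1 \<Otimes>\<^sub>M M2))"
    using nn by (intro nn_integral_cong) (simp add: split_beta' ennreal_mult)
  then show "(\<integral>\<^sup>+z. ennreal (case z of (x, t) \<Rightarrow> r x t * n t) \<partial>(M1 \<Otimes>\<^sub>M M2)) = 1"
    using nn_integral_cond_density[OF m r, of "\<lambda>t. ennreal (n t)"] prob_density_nn_integral[OF n] by simp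
qed

text \<open>Integrates \<open>kl_integrand_mult\<close>. The mixed products r n' and r' n have mass
  1 just as r n and r' n' do, because r and r' are densities in the state at every parameter value.
  Hence 1 + 1 cancels from both sides even if the divergence is infinite.\<close>

lemma KL_chain_rule:
  assumes m: "(\<lambda>(x, t). r x t) \<in> borel_measurable (M1 \<Otimes>\<^sub>M M2)"
    "(\<lambda>(x, t). r' x t) \<in> borel_measurable (M1 \<Otimes>\<^sub>M M2)"
    and r: "\<And>t. t \<in> space M2 \<Longrightarrow> prob_density M1 (\<lambda>x. r x t)"
    and r': "\<And>t. t \<in> space M2 \<Longrightarrow> prob_density M1 (\<lambda>x. r' x t)"
    and n: "prob_density M2 n" and n': "prob_density M2 n'"
  shows "KL (M1 \<Otimes>\<^sub>M M2) (\<lambda>(x, t). r x t * n t) (\<lambda>(x, t). r' x t * n' t)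
    = (\<integral>\<^sup>+t. ennreal (n t) * KL M1 (\<lambda>x. r x t) (\<lambda>x. r' x t) \<partial>M2) + KL M2 n n'"
proof -
  let ?N = "M1 \<Otimes>\<^sub>M M2"
  have [measurable]: "(\<lambda>z. r (fst z) (snd z)) \<in> borel_measurable ?N"
    "(\<lambda>z. r' (fst z) (snd z)) \<in> borel_measurable ?N" "n \<in> borel_measurable M2" "n' \<in> borel_measurable M2"
    using m n n' by (simp_all add: split_beta' prob_density_def)
  have nn: "0 \<le> r (fst z) (snd z)" "0 \<le> r' (fst z) (snd z)" "0 \<le> n (snd z)" "0 \<le> n' (snd z)"
    if "z \<in> space ?N" for z
    using that prob_density_nonneg[OF r, of "snd z" "fst z"] prob_density_nonneg[OF r', of "snd z" "fst z"]
      prob_density_nonneg[OF n, of "snd z"] prob_density_nonneg[OF n', of "snd z"]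
    by (auto simp: space_pair_measure)
  let ?R = "\<lambda>z. r (fst z) (snd z)" and ?R' = "\<lambda>z. r' (fst z) (snd z)"
    and ?n = "\<lambda>z. n (snd z)" and ?n' = "\<lambda>z. n' (snd z)"
  note c = nn_integral_cond_density[OF m(1) r, unfolded split_beta'] nn_integral_cond_density[OF m(2) r', unfolded split_beta']
  have one: "(\<integral>\<^sup>+z. ennreal (?R z) * ennreal (?n z) \<partial>?N) = 1" "(\<integral>\<^sup>+z. ennreal (?R z) * ennreal (?n' z) \<partial>?N) = 1"
    "(\<integral>\<^sup>+z. ennreal (?R' z) * ennreal (?n' z) \<partial>?N) = 1" "(\<integral>\<^sup>+z. ennreal (?n z) * ennreal (?R' z) \<partial>?N) = 1"
    using c(1)[of "\<lambda>t. ennreal (n t)"] c(1)[of "\<lambda>t. ennreal (n' t)"] c(2)[of "\<lambda>t. ennreal (n' t)"]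
      c(2)[of "\<lambda>t. ennreal (n t)"] prob_density_nn_integral[OF n] prob_density_nn_integral[OF n']
    by (simp_all add: mult.commute)
  have param: "(\<integral>\<^sup>+z. ennreal (?R z) * kl_integrand (?n z) (?n' z) \<partial>?N) = KL M2 n n'"
    using c(1)[of "\<lambda>t. kl_integrand (n t) (n' t)"] by (simp add: KL_eq_nn_integral[OF n n'])
  have state: "(\<integral>\<^sup>+z. ennreal (?n z) * kl_integrand (?R z) (?R' z) \<partial>?N)
      = (\<integral>\<^sup>+t. ennreal (n t) * KL M1 (\<lambda>x. r x t) (\<lambda>x. r' x t) \<partial>M2)"
  proof -
    have "(\<integral>\<^sup>+z. ennreal (?n z) * kl_integrand (?R z) (?R' z) \<partial>?N)
      = (\<integral>\<^sup>+t. \<integral>\<^sup>+x. ennreal (n t) * kl_integrand (r x t) (r' x t) \<partial>M1 \<partial>M2)"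
      by (subst nn_integral_snd[symmetric]) auto
    also have "\<dots> = (\<integral>\<^sup>+t. ennreal (n t) * KL M1 (\<lambda>x. r x t) (\<lambda>x. r' x t) \<partial>M2)"
    proof (rule nn_integral_cong)
      fix t assume t: "t \<in> space M2"
      note [measurable] = prob_density_measurable[OF r[OF t]] prob_density_measurable[OF r'[OF t]]
      show "(\<integral>\<^sup>+x. ennreal (n t) * kl_integrand (r x t) (r' x t) \<partial>M1)
          = ennreal (n t) * KL M1 (\<lambda>x. r x t) (\<lambda>x. r' x t)"
        by (simp add: nn_integral_cmult KL_eq_nn_integral[OF r[OF t] r'[OF t]])
    qed
    finally show ?thesis .
  qed
  have "(\<integral>\<^sup>+z. kl_integrand (?R z * ?n z) (?R' z * ?n' z) \<partial>?N) + (1 + 1)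
     = (\<integral>\<^sup>+z. kl_integrand (?R z * ?n z) (?R' z * ?n' z)
          + (ennreal (?n z) * ennreal (?R' z) + ennreal (?R z) * ennreal (?n' z)) \<partial>?N)"
    by (simp add: nn_integral_add one)
  also have "\<dots> = (\<integral>\<^sup>+z. ennreal (?n z) * kl_integrand (?R z) (?R' z) + ennreal (?R z) * kl_integrand (?n z) (?n' z)
          + (ennreal (?R z) * ennreal (?n z) + ennreal (?R' z) * ennreal (?n' z)) \<partial>?N)"
    using nn by (intro nn_integral_cong kl_integrand_mult)
  also have "\<dots> = (\<integral>\<^sup>+t. ennreal (n t) * KL M1 (\<lambda>x. r x t) (\<lambda>x. r' x t) \<partial>M2) + KL M2 n n' + (1 + 1)"
    by (simp add: nn_integral_add one state param)
  finally have "(\<integral>\<^sup>+z. kl_integrand (?R z * ?n z) (?R' z * ?n' z) \<partial>?N)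
     = (\<integral>\<^sup>+t. ennreal (n t) * KL M1 (\<lambda>x. r x t) (\<lambda>x. r' x t) \<partial>M2) + KL M2 n n'"
    by simp
  then show ?thesis
    using KL_eq_nn_integral[OF prob_density_mult[OF m(1) r n] prob_density_mult[OF m(2) r' n']]
    by (simp add: split_beta')
qed

end

section \<open>One filtering step as a positive kernel\<close>

lemma ennreal_integral_of_finite:
  fixes f :: "'a \<Rightarrow> real"
  assumes "f \<in> borel_measurable N" "\<And>x. x \<in> space N \<Longrightarrow> 0 \<le> f x" "(\<integral>\<^sup>+x. ennreal (f x) \<partial>N) \<noteq> \<infinity>"
  shows "integrable N f" and "ennreal (integral\<^sup>L N f) = (\<integral>\<^sup>+x. ennreal (f x) \<partial>N)"
proof -
  show i: "integrable N f"
    using assms by (intro integrableI_nonneg) (auto simp: top.not_eq_extremum)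
  show "ennreal (integral\<^sup>L N f) = (\<integral>\<^sup>+x. ennreal (f x) \<partial>N)"
    using nn_integral_eq_integral[OF i] assms(2) by simp
qed

text \<open>
  \<open>K x x' t\<close> is the unnormalised density of moving from state \<open>x'\<close> to \<open>x\<close> with parameter \<open>t\<close> and
  of observing the data point in state \<open>x\<close>; one filtering step is \<open>push\<close> followed by normalisation.
\<close>

locale state_kernel = L: sigma_finite_measure L + T: sigma_finite_measure T
  for L :: "'x measure" and T :: "'t measure" +
  fixes K :: "'x \<Rightarrow> 'x \<Rightarrow> 't \<Rightarrow> real" and G :: real
  assumes K_measurable: "(\<lambda>(x, x', t). K x x' t) \<in> borel_measurable (L \<Otimes>\<^sub>M (L \<Otimes>\<^sub>M T))"
    and K_pos: "\<And>x x' t. x \<in> space L \<Longrightarrow> x' \<in> space L \<Longrightarrow> t \<in> space T \<Longrightarrow> 0 < K x x' t"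
    and K_le: "\<And>x' t. x' \<in> space L \<Longrightarrow> t \<in> space T \<Longrightarrow> (\<integral>\<^sup>+x. ennreal (K x x' t) \<partial>L) \<le> ennreal G"
    and G_pos: "0 < G"
    and L_nonzero: "emeasure L (space L) \<noteq> 0"
begin

sublocale pair_sigma_finite L T ..

abbreviation N where "N \<equiv> L \<Otimes>\<^sub>M T"

text \<open>The parameter is static, so the operator acts on each fibre of constant t. It is a
  Bochner integral, as in \<open>predict\<close>, and thus 0 at the points where the section is not
  integrable; \<open>AE_ennreal_push\<close> shows that it agrees with the extended integral almost
  everywhere.\<close>

definition push :: "('x \<times> 't \<Rightarrow> real) \<Rightarrow> 'x \<times> 't \<Rightarrow> real" where
  "push f = (\<lambda>(x, t). LINT x'|L. K x x' t * f (x', t))"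

lemma K_comp [measurable (raw)]:
  assumes "a \<in> M \<rightarrow>\<^sub>M L" "b \<in> M \<rightarrow>\<^sub>M L" "c \<in> M \<rightarrow>\<^sub>M T"
  shows "(\<lambda>z. K (a z) (b z) (c z)) \<in> borel_measurable M"
  using measurable_compose[OF measurable_Pair[OF assms(1) measurable_Pair[OF assms(2,3)]] K_measurable]
  by simp

section \<open>Mass and positivity of the kernel operator\<close>

lemma nn_integral_fibre:
  assumes t [measurable]: "t \<in> space T" and [measurable]: "\<phi> \<in> borel_measurable L"
  shows "(\<integral>\<^sup>+x. \<integral>\<^sup>+x'. ennreal (K x x' t) * \<phi> x' \<partial>L \<partial>L) = (\<integral>\<^sup>+x'. (\<integral>\<^sup>+x. ennreal (K x x' t) \<partial>L) * \<phi> x' \<partial>L)"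
proof -
  interpret LL: pair_sigma_finite L L ..
  have "(\<integral>\<^sup>+x. \<integral>\<^sup>+x'. ennreal (K x x' t) * \<phi> x' \<partial>L \<partial>L) = (\<integral>\<^sup>+x'. \<integral>\<^sup>+x. ennreal (K x x' t) * \<phi> x' \<partial>L \<partial>L)"
    by (rule LL.Fubini'[symmetric]) measurable
  also have "\<dots> = (\<integral>\<^sup>+x'. (\<integral>\<^sup>+x. ennreal (K x x' t) \<partial>L) * \<phi> x' \<partial>L)"
    by (intro nn_integral_cong nn_integral_multc) measurable
  finally show ?thesis .
qed

lemma nn_integral_fibre_le:
  assumes t: "t \<in> space T" and \<phi> [measurable]: "\<phi> \<in> borel_measurable L"
  shows "(\<integral>\<^sup>+x. \<integral>\<^sup>+x'. ennreal (K x x' t) * \<phi> x' \<partial>L \<partial>L) \<le> ennreal G * (\<integral>\<^sup>+x'. \<phi> x' \<partial>L)"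
proof -
  have "(\<integral>\<^sup>+x'. (\<integral>\<^sup>+x. ennreal (K x x' t) \<partial>L) * \<phi> x' \<partial>L) \<le> (\<integral>\<^sup>+x'. ennreal G * \<phi> x' \<partial>L)"
    using t by (intro nn_integral_mono mult_right_mono K_le) auto
  then show ?thesis
    by (simp add: nn_integral_fibre[OF t \<phi>] nn_integral_cmult)
qed

text \<open>After Tonelli, \<phi> is weighted by the mass of the kernel started at x'. That mass is
  nonzero, since K > 0 on a space of nonzero measure, so \<phi> itself must vanish almost
  everywhere. Positivity of all evidences comes from here.\<close>

lemma nn_integral_fibre_eq_0:
  assumes t [measurable]: "t \<in> space T" and \<phi> [measurable]: "\<phi> \<in> borel_measurable L"
    and zero: "(\<integral>\<^sup>+x. \<integral>\<^sup>+x'. ennreal (K x x' t) * \<phi> x' \<partial>L \<partial>L) = 0"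
  shows "(\<integral>\<^sup>+x'. \<phi> x' \<partial>L) = 0"
proof -
  have "AE x' in L. (\<integral>\<^sup>+x. ennreal (K x x' t) \<partial>L) * \<phi> x' = 0"
    using zero unfolding nn_integral_fibre[OF t \<phi>] by (subst (asm) nn_integral_0_iff_AE) auto
  then have "AE x' in L. \<phi> x' = 0"
  proof (rule AE_mp, intro AE_I2 impI)
    fix x' assume x' [measurable]: "x' \<in> space L" and eq: "(\<integral>\<^sup>+x. ennreal (K x x' t) \<partial>L) * \<phi> x' = 0"
    have "(\<integral>\<^sup>+x. ennreal (K x x' t) \<partial>L) \<noteq> 0"
    proof
      assume "(\<integral>\<^sup>+x. ennreal (K x x' t) \<partial>L) = 0"
      then have "AE x in L. ennreal (K x x' t) = 0"
        by (subst (asm) nn_integral_0_iff_AE) auto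
      then have "AE x in L. False"
        by (rule AE_mp) (use K_pos[OF _ x' t] in \<open>force intro!: AE_I2 simp: ennreal_eq_0_iff\<close>)
      then show False
        using L_nonzero AE_iff_measurable[of "space L" L "\<lambda>_. False"] by simp
    qed
    then show "\<phi> x' = 0" using eq by simp
  qed
  then show ?thesis by (subst nn_integral_0_iff_AE) auto
qed

text \<open>At a fixed parameter the double integral is the predictive likelihood of a state
  density. Its bounds, positive and at most G, are what makes it an admissible weight for the
  parameter density in \<open>prob_density_reweight\<close>.\<close>

lemma fibre_integral:
  assumes t [measurable]: "t \<in> space T" and f: "prob_density L f"
  shows "(\<lambda>x. LINT x'|L. K x x' t * f x') \<in> borel_measurable L"
    and "x \<in> space L \<Longrightarrow> 0 \<le> (LINT x'|L. K x x' t * f x')"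
    and "integrable L (\<lambda>x. LINT x'|L. K x x' t * f x')"
    and "0 < (LINT x|L. LINT x'|L. K x x' t * f x')"
    and "(LINT x|L. LINT x'|L. K x x' t * f x') \<le> G"
proof -
  note [measurable] = prob_density_measurable[OF f]
  note nn = prob_density_nonneg[OF f] less_imp_le[OF K_pos[OF _ _ t]]
  let ?F = "\<lambda>x. LINT x'|L. K x x' t * f x'"
  let ?I = "\<lambda>x. \<integral>\<^sup>+x'. ennreal (K x x' t) * ennreal (f x') \<partial>L"
  show m [measurable]: "?F \<in> borel_measurable L" by measurable
  show nonneg: "0 \<le> ?F x" if "x \<in> space L" for x
    using nn that by (intro Bochner_Integration.integral_nonneg) auto
  have le: "(\<integral>\<^sup>+x. ?I x \<partial>L) \<le> ennreal G"
    using nn_integral_fibre_le[OF t, of "\<lambda>x. ennreal (f x)"] prob_density_nn_integral[OF f] by simp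
  have ne: "(\<integral>\<^sup>+x. ?I x \<partial>L) \<noteq> 0"
    using nn_integral_fibre_eq_0[OF t, of "\<lambda>x. ennreal (f x)"] prob_density_nn_integral[OF f] by auto
  have "AE x in L. ?I x \<noteq> \<infinity>"
    using le by (intro nn_integral_PInf_AE) (auto simp: top_unique)
  then have "AE x in L. ennreal (?F x) = ?I x"
  proof (rule AE_mp, intro AE_I2 impI)
    fix x assume x [measurable]: "x \<in> space L" and fin: "?I x \<noteq> \<infinity>"
    have eq: "(\<integral>\<^sup>+x'. ennreal (K x x' t * f x') \<partial>L) = ?I x"
      using nn x by (intro nn_integral_cong ennreal_mult) auto
    show "ennreal (?F x) = ?I x"
      unfolding eq[symmetric] using nn x fin by (intro ennreal_integral_of_finite) (auto simp: eq)
  qed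
  then have eq: "(\<integral>\<^sup>+x. ennreal (?F x) \<partial>L) = (\<integral>\<^sup>+x. ?I x \<partial>L)"
    by (rule nn_integral_cong_AE)
  have fin: "(\<integral>\<^sup>+x. ennreal (?F x) \<partial>L) \<noteq> \<infinity>"
    using le by (auto simp: eq top_unique)
  show "integrable L ?F"
    by (rule ennreal_integral_of_finite(1)[OF m nonneg fin])
  show "0 < integral\<^sup>L L ?F"
  proof (rule ccontr)
    assume "\<not> 0 < integral\<^sup>L L ?F"
    then have "ennreal (integral\<^sup>L L ?F) = 0" by (simp add: ennreal_eq_0_iff)
    then show False using ennreal_integral_of_finite(2)[OF m nonneg fin] ne eq by simp
  qed
  have "ennreal (integral\<^sup>L L ?F) \<le> ennreal G"
    using ennreal_integral_of_finite(2)[OF m nonneg fin] le by (simp only: eq)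
  then show "integral\<^sup>L L ?F \<le> G"
    using G_pos by simp
qed

lemma nn_integral_push_le:
  assumes [measurable]: "\<phi> \<in> borel_measurable N"
  shows "(\<integral>\<^sup>+z. \<integral>\<^sup>+x'. ennreal (K (fst z) x' (snd z)) * \<phi> (x', snd z) \<partial>L \<partial>N) \<le> ennreal G * (\<integral>\<^sup>+z. \<phi> z \<partial>N)"
proof -
  have m: "(\<lambda>z. \<integral>\<^sup>+x'. ennreal (K (fst z) x' (snd z)) * \<phi> (x', snd z) \<partial>L) \<in> borel_measurable N"
    by measurable
  have "(\<integral>\<^sup>+z. \<integral>\<^sup>+x'. ennreal (K (fst z) x' (snd z)) * \<phi> (x', snd z) \<partial>L \<partial>N)
      = (\<integral>\<^sup>+t. \<integral>\<^sup>+x. \<integral>\<^sup>+x'. ennreal (K x x' t) * \<phi> (x', t) \<partial>L \<partial>L \<partial>T)"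
    using nn_integral_snd[OF m] by simp
  also have "\<dots> \<le> (\<integral>\<^sup>+t. ennreal G * (\<integral>\<^sup>+x'. \<phi> (x', t) \<partial>L) \<partial>T)"
    by (intro nn_integral_mono nn_integral_fibre_le) auto
  also have "\<dots> = ennreal G * (\<integral>\<^sup>+z. \<phi> z \<partial>N)"
    using nn_integral_snd[OF assms] by (simp add: nn_integral_cmult)
  finally show ?thesis .
qed

lemma nn_integral_push_eq_0:
  assumes [measurable]: "\<phi> \<in> borel_measurable N"
    and zero: "(\<integral>\<^sup>+z. \<integral>\<^sup>+x'. ennreal (K (fst z) x' (snd z)) * \<phi> (x', snd z) \<partial>L \<partial>N) = 0"
  shows "(\<integral>\<^sup>+z. \<phi> z \<partial>N) = 0"
proof -
  have m: "(\<lambda>z. \<integral>\<^sup>+x'. ennreal (K (fst z) x' (snd z)) * \<phi> (x', snd z) \<partial>L) \<in> borel_measurable N"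
    by measurable
  have "(\<integral>\<^sup>+z. \<integral>\<^sup>+x'. ennreal (K (fst z) x' (snd z)) * \<phi> (x', snd z) \<partial>L \<partial>N)
      = (\<integral>\<^sup>+t. \<integral>\<^sup>+x. \<integral>\<^sup>+x'. ennreal (K x x' t) * \<phi> (x', t) \<partial>L \<partial>L \<partial>T)"
    using nn_integral_snd[OF m] by simp
  with zero have zero': "(\<integral>\<^sup>+t. \<integral>\<^sup>+x. \<integral>\<^sup>+x'. ennreal (K x x' t) * \<phi> (x', t) \<partial>L \<partial>L \<partial>T) = 0" by simp
  have m': "(\<lambda>t. \<integral>\<^sup>+x. \<integral>\<^sup>+x'. ennreal (K x x' t) * \<phi> (x', t) \<partial>L \<partial>L) \<in> borel_measurable T"
    using L.borel_measurable_nn_integral_fst[OF measurable_pair_swap[OF m]] by simp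
  have "AE t in T. (\<integral>\<^sup>+x. \<integral>\<^sup>+x'. ennreal (K x x' t) * \<phi> (x', t) \<partial>L \<partial>L) = 0"
    by (rule nn_integral_0_iff_AE[THEN iffD1, OF m' zero'])
  then have "AE t in T. (\<integral>\<^sup>+x'. \<phi> (x', t) \<partial>L) = 0"
    using AE_space[of T]
  proof eventually_elim
    case (elim t)
    note [measurable] = elim(2)
    show ?case
      by (rule nn_integral_fibre_eq_0[OF elim(2) _ elim(1)]) measurable
  qed
  then have "(\<integral>\<^sup>+t. \<integral>\<^sup>+x'. \<phi> (x', t) \<partial>L \<partial>T) = 0"
    by (subst nn_integral_0_iff_AE) auto
  then show ?thesis
    by (simp only: nn_integral_snd[OF assms(1)])
qed

lemma push_measurable [measurable]:
  assumes [measurable]: "f \<in> borel_measurable N"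
  shows "push f \<in> borel_measurable N"
  unfolding push_def split_beta' by measurable

context
  fixes f
  assumes f: "prob_density N f"
begin

lemma push_section:
  assumes "z \<in> space N"
  shows "(\<lambda>x'. K (fst z) x' (snd z) * f (x', snd z)) \<in> borel_measurable L"
    and "x' \<in> space L \<Longrightarrow> 0 \<le> K (fst z) x' (snd z) * f (x', snd z)"
    and "(\<integral>\<^sup>+x'. ennreal (K (fst z) x' (snd z) * f (x', snd z)) \<partial>L)
      = (\<integral>\<^sup>+x'. ennreal (K (fst z) x' (snd z)) * ennreal (f (x', snd z)) \<partial>L)"
proof -
  note [measurable] = prob_density_measurable[OF f]
  have z [measurable]: "fst z \<in> space L" "snd z \<in> space T"
    using assms by (auto simp: space_pair_measure)
  have nn: "0 \<le> K (fst z) x' (snd z)" "0 \<le> f (x', snd z)" if "x' \<in> space L" for x'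
    using z that K_pos[OF z(1) that z(2)] prob_density_nonneg[OF f, of "(x', snd z)"]
    by (auto simp: space_pair_measure)
  show "(\<lambda>x'. K (fst z) x' (snd z) * f (x', snd z)) \<in> borel_measurable L" by measurable
  show "0 \<le> K (fst z) x' (snd z) * f (x', snd z)" if "x' \<in> space L" for x'
    using nn[OF that] by simp
  show "(\<integral>\<^sup>+x'. ennreal (K (fst z) x' (snd z) * f (x', snd z)) \<partial>L)
      = (\<integral>\<^sup>+x'. ennreal (K (fst z) x' (snd z)) * ennreal (f (x', snd z)) \<partial>L)"
    using nn by (intro nn_integral_cong ennreal_mult) auto
qed

lemma push_nonneg: "z \<in> space N \<Longrightarrow> 0 \<le> push f z"
  unfolding push_def split_beta' by (intro Bochner_Integration.integral_nonneg push_section)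

text \<open>The integral of this function over \<open>N\<close> is at most G, so it is finite
  outside a null set. There the Bochner integral and the extended integral of the section
  agree.\<close>

lemma AE_push_section_finite:
  "AE z in N. (\<integral>\<^sup>+x'. ennreal (K (fst z) x' (snd z)) * ennreal (f (x', snd z)) \<partial>L) \<noteq> \<infinity>"
proof -
  note [measurable] = prob_density_measurable[OF f]
  have "(\<integral>\<^sup>+z. \<integral>\<^sup>+x'. ennreal (K (fst z) x' (snd z)) * ennreal (f (x', snd z)) \<partial>L \<partial>N) \<le> ennreal G"
    using nn_integral_push_le[of "\<lambda>z. ennreal (f z)"] prob_density_nn_integral[OF f] by simp
  then show ?thesis
    by (intro nn_integral_PInf_AE) (auto simp: top_unique)
qed

lemma AE_push_section_integrable:
  "AE z in N. integrable L (\<lambda>x'. K (fst z) x' (snd z) * f (x', snd z))"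
  using AE_push_section_finite
proof (rule AE_mp, intro AE_I2 impI)
  fix z assume z: "z \<in> space N"
    and fin: "(\<integral>\<^sup>+x'. ennreal (K (fst z) x' (snd z)) * ennreal (f (x', snd z)) \<partial>L) \<noteq> \<infinity>"
  show "integrable L (\<lambda>x'. K (fst z) x' (snd z) * f (x', snd z))"
    by (rule ennreal_integral_of_finite(1)) (use push_section[OF z] fin in simp_all)
qed

lemma AE_ennreal_push:
  "AE z in N. ennreal (push f z) = (\<integral>\<^sup>+x'. ennreal (K (fst z) x' (snd z)) * ennreal (f (x', snd z)) \<partial>L)"
  using AE_push_section_finite
proof (rule AE_mp, intro AE_I2 impI)
  fix z assume z: "z \<in> space N"
    and fin: "(\<integral>\<^sup>+x'. ennreal (K (fst z) x' (snd z)) * ennreal (f (x', snd z)) \<partial>L) \<noteq> \<infinity>"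
  show "ennreal (push f z) = (\<integral>\<^sup>+x'. ennreal (K (fst z) x' (snd z)) * ennreal (f (x', snd z)) \<partial>L)"
    unfolding push_def split_beta' push_section(3)[OF z, symmetric]
    by (rule ennreal_integral_of_finite(2)) (use push_section[OF z] fin in simp_all)
qed

lemma push_integrable: "integrable N (push f)"
  and push_integral_pos: "0 < integral\<^sup>L N (push f)"
proof -
  note [measurable] = prob_density_measurable[OF f]
  let ?I = "\<integral>\<^sup>+z. \<integral>\<^sup>+x'. ennreal (K (fst z) x' (snd z)) * ennreal (f (x', snd z)) \<partial>L \<partial>N"
  have eq: "(\<integral>\<^sup>+z. ennreal (push f z) \<partial>N) = ?I"
    by (rule nn_integral_cong_AE[OF AE_ennreal_push])
  have "?I \<le> ennreal G"
    using nn_integral_push_le[of "\<lambda>z. ennreal (f z)"] prob_density_nn_integral[OF f] by simp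
  then have fin: "(\<integral>\<^sup>+z. ennreal (push f z) \<partial>N) \<noteq> \<infinity>"
    by (auto simp: eq top_unique)
  have ne: "?I \<noteq> 0"
    using nn_integral_push_eq_0[of "\<lambda>z. ennreal (f z)"] prob_density_nn_integral[OF f] by auto
  show "integrable N (push f)"
    by (rule ennreal_integral_of_finite(1)[OF _ push_nonneg fin]) measurable
  have "ennreal (integral\<^sup>L N (push f)) = ?I"
    unfolding eq[symmetric] by (rule ennreal_integral_of_finite(2)[OF _ push_nonneg fin]) measurable
  then show "0 < integral\<^sup>L N (push f)"
    using ne by (metis ennreal_eq_0_iff not_le)
qed

end

section \<open>Contraction estimates for the unnormalised step\<close>

text \<open>Common core of the two distance estimates. Both distance integrands can be moved under
  the kernel pointwise, which is the hypothesis \<open>le\<close>; the mass bound for the kernel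
  then gives the factor G.\<close>

lemma integral_le_of_section_bound:
  fixes F \<phi> :: "'x \<times> 't \<Rightarrow> real"
  assumes [measurable]: "F \<in> borel_measurable N" "\<phi> \<in> borel_measurable N"
    and F: "\<And>z. 0 \<le> F z" and \<phi>: "\<And>z. 0 \<le> \<phi> z" and i: "integrable N \<phi>"
    and le: "AE z in N. integrable L (\<lambda>x'. K (fst z) x' (snd z) * \<phi> (x', snd z))
        \<and> F z \<le> (LINT x'|L. K (fst z) x' (snd z) * \<phi> (x', snd z))"
  shows "integral\<^sup>L N F \<le> G * integral\<^sup>L N \<phi>"
proof -
  have "(\<integral>\<^sup>+z. ennreal (F z) \<partial>N) \<le> (\<integral>\<^sup>+z. \<integral>\<^sup>+x'. ennreal (K (fst z) x' (snd z)) * ennreal (\<phi> (x', snd z)) \<partial>L \<partial>N)"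
  proof (rule nn_integral_mono_AE)
    show "AE z in N. ennreal (F z) \<le> (\<integral>\<^sup>+x'. ennreal (K (fst z) x' (snd z)) * ennreal (\<phi> (x', snd z)) \<partial>L)"
      using le
    proof (rule AE_mp, intro AE_I2 impI)
      fix z assume z: "z \<in> space N"
        and A: "integrable L (\<lambda>x'. K (fst z) x' (snd z) * \<phi> (x', snd z))
        \<and> F z \<le> (LINT x'|L. K (fst z) x' (snd z) * \<phi> (x', snd z))"
      have K: "0 \<le> K (fst z) x' (snd z)" if "x' \<in> space L" for x'
        using K_pos[of "fst z" x' "snd z"] z that by (auto simp: space_pair_measure)
      have "ennreal (F z) \<le> ennreal (LINT x'|L. K (fst z) x' (snd z) * \<phi> (x', snd z))"
        using A by (intro ennreal_leI) simp
      also have "\<dots> = (\<integral>\<^sup>+x'. ennreal (K (fst z) x' (snd z) * \<phi> (x', snd z)) \<partial>L)"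
        using A K \<phi> by (intro nn_integral_eq_integral[symmetric]) auto
      also have "\<dots> = (\<integral>\<^sup>+x'. ennreal (K (fst z) x' (snd z)) * ennreal (\<phi> (x', snd z)) \<partial>L)"
        using K \<phi> by (intro nn_integral_cong ennreal_mult) auto
      finally show "ennreal (F z) \<le> \<dots>" .
    qed
  qed
  also have "\<dots> \<le> ennreal G * (\<integral>\<^sup>+z. ennreal (\<phi> z) \<partial>N)"
    by (rule nn_integral_push_le) measurable
  also have "\<dots> = ennreal (G * integral\<^sup>L N \<phi>)"
    using G_pos \<phi> i by (simp add: nn_integral_eq_integral ennreal_mult)
  finally have le: "(\<integral>\<^sup>+z. ennreal (F z) \<partial>N) \<le> ennreal (G * integral\<^sup>L N \<phi>)" .
  have "integral\<^sup>L N F = enn2real (\<integral>\<^sup>+z. ennreal (F z) \<partial>N)"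
    using F by (intro integral_eq_nn_integral) auto
  also have "\<dots> \<le> enn2real (ennreal (G * integral\<^sup>L N \<phi>))"
    using le by (intro enn2real_mono) auto
  also have "\<dots> = G * integral\<^sup>L N \<phi>"
    using G_pos \<phi> by (intro enn2real_ennreal mult_nonneg_nonneg) auto
  finally show ?thesis .
qed

text \<open>The positive part of an integral is at most the integral of the positive part, and the
  nonnegative factor K moves through the maximum.\<close>

lemma push_pos_part_le:
  assumes f: "prob_density N f" and g: "prob_density N g"
  shows "(LINT z|N. max 0 (push f z - push g z)) \<le> G * (LINT z|N. max 0 (f z - g z))"
proof (rule integral_le_of_section_bound)
  note [measurable] = prob_density_measurable[OF f] prob_density_measurable[OF g]
  show "(\<lambda>z. max 0 (push f z - push g z)) \<in> borel_measurable N" "(\<lambda>z. max 0 (f z - g z)) \<in> borel_measurable N"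
    by measurable
  show "integrable N (\<lambda>z. max 0 (f z - g z))"
    using prob_density_integrable[OF f] prob_density_integrable[OF g] by simp
  show "AE z in N. integrable L (\<lambda>x'. K (fst z) x' (snd z) * max 0 (f (x', snd z) - g (x', snd z)))
      \<and> max 0 (push f z - push g z) \<le> (LINT x'|L. K (fst z) x' (snd z) * max 0 (f (x', snd z) - g (x', snd z)))"
    using AE_push_section_integrable[OF f] AE_push_section_integrable[OF g]
  proof (rule AE_mp[OF _ AE_mp], intro AE_I2 impI)
    fix z assume z: "z \<in> space N"
      and i: "integrable L (\<lambda>x'. K (fst z) x' (snd z) * f (x', snd z))"
        "integrable L (\<lambda>x'. K (fst z) x' (snd z) * g (x', snd z))"
    have K: "0 \<le> K (fst z) x' (snd z)" if "x' \<in> space L" for x'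
      using K_pos[of "fst z" x' "snd z"] z that by (auto simp: space_pair_measure)
    have eq: "K (fst z) x' (snd z) * max 0 (f (x', snd z) - g (x', snd z))
        = max 0 (K (fst z) x' (snd z) * f (x', snd z) - K (fst z) x' (snd z) * g (x', snd z))"
      if "x' \<in> space L" for x'
      using K[OF that] by (simp add: max_mult_distrib_left right_diff_distrib)
    have I: "integrable L (\<lambda>x'. K (fst z) x' (snd z) * max 0 (f (x', snd z) - g (x', snd z)))"
      using i by (simp add: eq cong: Bochner_Integration.integrable_cong)
    have "push f z - push g z
        = (LINT x'|L. K (fst z) x' (snd z) * f (x', snd z) - K (fst z) x' (snd z) * g (x', snd z))"
      using i by (simp add: push_def split_beta')
    also have "\<dots> \<le> (LINT x'|L. K (fst z) x' (snd z) * max 0 (f (x', snd z) - g (x', snd z)))"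
      using i I by (intro integral_mono) (auto simp: eq)
    finally have "push f z - push g z \<le> \<dots>" .
    moreover have "0 \<le> (LINT x'|L. K (fst z) x' (snd z) * max 0 (f (x', snd z) - g (x', snd z)))"
      using K by (intro Bochner_Integration.integral_nonneg) auto
    ultimately show "integrable L (\<lambda>x'. K (fst z) x' (snd z) * max 0 (f (x', snd z) - g (x', snd z)))
      \<and> max 0 (push f z - push g z) \<le> (LINT x'|L. K (fst z) x' (snd z) * max 0 (f (x', snd z) - g (x', snd z)))"
      using I by simp
  qed
qed simp_all

text \<open>At a fixed point z, the functions u = sqrt (K f) and v = sqrt (K g) of the old state
  have squared L2 norms \<open>push f z\<close> and \<open>push g z\<close>. The reverse triangle
  inequality bounds the squared difference of the norms by the integral of (u - v)^2 = K (sqrt f -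
  sqrt g)^2.\<close>

lemma push_sqrt_diff_le:
  assumes f: "prob_density N f" and g: "prob_density N g"
  shows "(LINT z|N. (sqrt (push f z) - sqrt (push g z))\<^sup>2) \<le> G * (LINT z|N. (sqrt (f z) - sqrt (g z))\<^sup>2)"
proof (rule integral_le_of_section_bound)
  note [measurable] = prob_density_measurable[OF f] prob_density_measurable[OF g]
  show "(\<lambda>z. (sqrt (push f z) - sqrt (push g z))\<^sup>2) \<in> borel_measurable N"
    "(\<lambda>z. (sqrt (f z) - sqrt (g z))\<^sup>2) \<in> borel_measurable N"
    by measurable
  show "integrable N (\<lambda>z. (sqrt (f z) - sqrt (g z))\<^sup>2)"
    by (intro L2_diff(1) prob_density_sqrt_L2 f g)
  show "AE z in N. integrable L (\<lambda>x'. K (fst z) x' (snd z) * (sqrt (f (x', snd z)) - sqrt (g (x', snd z)))\<^sup>2)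
      \<and> (sqrt (push f z) - sqrt (push g z))\<^sup>2
        \<le> (LINT x'|L. K (fst z) x' (snd z) * (sqrt (f (x', snd z)) - sqrt (g (x', snd z)))\<^sup>2)"
    using AE_push_section_integrable[OF f] AE_push_section_integrable[OF g]
  proof (rule AE_mp[OF _ AE_mp], intro AE_I2 impI)
    fix z assume z: "z \<in> space N"
      and i: "integrable L (\<lambda>x'. K (fst z) x' (snd z) * f (x', snd z))"
        "integrable L (\<lambda>x'. K (fst z) x' (snd z) * g (x', snd z))"
    have [measurable]: "fst z \<in> space L" "snd z \<in> space T"
      using z by (auto simp: space_pair_measure)
    have K: "0 \<le> K (fst z) x' (snd z)" if "x' \<in> space L" for x'
      using K_pos[of "fst z" x' "snd z"] z that by (auto simp: space_pair_measure)
    define u where "u x' = sqrt (K (fst z) x' (snd z) * f (x', snd z))" for x'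
    define v where "v x' = sqrt (K (fst z) x' (snd z) * g (x', snd z))" for x'
    have m [measurable]: "u \<in> borel_measurable L" "v \<in> borel_measurable L"
      unfolding u_def v_def by measurable
    have u2: "(u x')\<^sup>2 = K (fst z) x' (snd z) * f (x', snd z)" if "x' \<in> space L" for x'
      using push_section(2)[OF f z that] by (simp add: u_def)
    have v2: "(v x')\<^sup>2 = K (fst z) x' (snd z) * g (x', snd z)" if "x' \<in> space L" for x'
      using push_section(2)[OF g z that] by (simp add: v_def)
    have uv: "(u x' - v x')\<^sup>2 = K (fst z) x' (snd z) * (sqrt (f (x', snd z)) - sqrt (g (x', snd z)))\<^sup>2"
      if "x' \<in> space L" for x'
    proof -
      have "u x' - v x' = sqrt (K (fst z) x' (snd z)) * (sqrt (f (x', snd z)) - sqrt (g (x', snd z)))"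
        by (simp add: u_def v_def real_sqrt_mult right_diff_distrib)
      then show ?thesis using K[OF that] by (simp add: power_mult_distrib)
    qed
    have sq: "integrable L (\<lambda>x'. (u x')\<^sup>2)" "integrable L (\<lambda>x'. (v x')\<^sup>2)"
      "(LINT x'|L. (u x')\<^sup>2) = push f z" "(LINT x'|L. (v x')\<^sup>2) = push g z"
      using i by (simp_all add: u2 v2 push_def split_beta'
        cong: Bochner_Integration.integrable_cong Bochner_Integration.integral_cong)
    show "integrable L (\<lambda>x'. K (fst z) x' (snd z) * (sqrt (f (x', snd z)) - sqrt (g (x', snd z)))\<^sup>2)
      \<and> (sqrt (push f z) - sqrt (push g z))\<^sup>2
        \<le> (LINT x'|L. K (fst z) x' (snd z) * (sqrt (f (x', snd z)) - sqrt (g (x', snd z)))\<^sup>2)"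
      using L2_diff[OF m sq(1,2)] sq(3,4)
      by (simp add: uv cong: Bochner_Integration.integrable_cong Bochner_Integration.integral_cong)
  qed
qed simp_all

section \<open>Error growth in one normalised step\<close>

text \<open>Since p has mass 1, a constant Z with p = push f / Z almost everywhere must be the
  integral of \<open>push f\<close>. In this way the ratio of successive evidences is recognised as
  the normalising constant of the posterior step.\<close>

lemma normalizer_eq:
  assumes f: "prob_density N f" and p: "prob_density N p" and pf: "AE z in N. p z = push f z / Z"
  shows "integral\<^sup>L N (push f) = Z" "0 < Z"
proof -
  note [measurable] = prob_density_measurable[OF f] prob_density_measurable[OF p]
  have "integral\<^sup>L N p = (LINT z|N. push f z / Z)"
    by (rule integral_cong_AE) (use pf in measurable)
  then have one: "integral\<^sup>L N (push f) / Z = 1"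
    using prob_density_integral[OF p] by simp
  then have "Z \<noteq> 0" by auto
  with one show "integral\<^sup>L N (push f) = Z" by simp
  with push_integral_pos[OF f] show "0 < Z" by simp
qed

context
  fixes f g p q Z Z'
  assumes f: "prob_density N f" and g: "prob_density N g"
    and p: "prob_density N p" and q: "prob_density N q"
    and pf: "AE z in N. p z = push f z / Z" and qg: "AE z in N. q z = push g z / Z'"
begin

text \<open>The hypotheses are symmetric in the two densities, so Z' could stand in place of Z. With
  f the posterior, the choice of Z makes the factor depend on the model and the data, and not on the
  approximation.\<close>

lemma tv_dist_step: "tv_dist N p q \<le> G / Z * tv_dist N f g"
proof -
  note [measurable] = prob_density_measurable[OF f] prob_density_measurable[OF p]
    prob_density_measurable[OF g] prob_density_measurable[OF q]
  note Z = normalizer_eq[OF f p pf] normalizer_eq[OF g q qg]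
  have "tv_dist N p q = tv_dist N (\<lambda>z. push f z / Z) (\<lambda>z. push g z / Z')"
    by (rule tv_dist_cong_AE[OF pf qg]) measurable
  also have "\<dots> \<le> (G * tv_dist N f g) / Z"
  proof (rule tv_dist_normalized_le[OF push_integrable[OF f] push_integrable[OF g] _ Z(1,3,2,4)])
    show "AE z in N. 0 \<le> push g z"
      using push_nonneg[OF g] by auto
    show "(LINT z|N. max 0 (push f z - push g z)) \<le> G * tv_dist N f g"
      using push_pos_part_le[OF f g] tv_dist_eq_pos_part(1)[OF f g] by simp
    show "(LINT z|N. max 0 (push g z - push f z)) \<le> G * tv_dist N f g"
      using push_pos_part_le[OF g f] tv_dist_eq_pos_part(2)[OF f g] by simp
  qed
  finally show ?thesis by simp
qed

lemma hellinger_dist_step: "hellinger_dist N p q \<le> 2 * sqrt (G / Z) * hellinger_dist N f g"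
proof -
  note [measurable] = prob_density_measurable[OF f] prob_density_measurable[OF p]
    prob_density_measurable[OF g] prob_density_measurable[OF q]
  note Z = normalizer_eq[OF f p pf] normalizer_eq[OF g q qg]
  have "hellinger_dist N p q = hellinger_dist N (\<lambda>z. push f z / Z) (\<lambda>z. push g z / Z')"
    by (rule hellinger_dist_cong_AE[OF pf qg]) measurable
  also have "\<dots> \<le> 2 / sqrt Z * hellinger_dist N (push f) (push g)"
    using push_nonneg[OF f] push_nonneg[OF g] Z
    by (intro hellinger_dist_normalized_le push_integrable f g) auto
  also have "\<dots> \<le> 2 / sqrt Z * (sqrt G * hellinger_dist N f g)"
  proof (rule mult_left_mono)
    show "hellinger_dist N (push f) (push g) \<le> sqrt G * hellinger_dist N f g"
    proof -
      have "sqrt (LINT z|N. (sqrt (push f z) - sqrt (push g z))\<^sup>2)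
          \<le> sqrt G * sqrt (LINT z|N. (sqrt (f z) - sqrt (g z))\<^sup>2)"
        using real_sqrt_le_mono[OF push_sqrt_diff_le[OF f g]] by (simp only: real_sqrt_mult)
      then have "sqrt (1 / 2) * sqrt (LINT z|N. (sqrt (push f z) - sqrt (push g z))\<^sup>2)
          \<le> sqrt (1 / 2) * (sqrt G * sqrt (LINT z|N. (sqrt (f z) - sqrt (g z))\<^sup>2))"
        by (rule mult_left_mono) simp
      then show ?thesis by (simp only: hellinger_dist_alt mult.left_commute)
    qed
    show "0 \<le> 2 / sqrt Z" using Z by simp
  qed
  also have "\<dots> = 2 * sqrt (G / Z) * hellinger_dist N f g"
    by (simp add: real_sqrt_divide)
  finally show ?thesis .
qed

end

end

section \<open>The Gaussian integral\<close>

lemma prod_Basis_vec: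
  fixes l u :: "real^'n"
  shows "(\<Prod>b\<in>Basis. (u - l) \<bullet> b) = (\<Prod>i\<in>UNIV. u $ i - l $ i)"
proof -
  have "(Basis :: (real^'n) set) = range (\<lambda>i. axis i 1)"
    by (auto simp: Basis_vec_def)
  moreover have "inj (\<lambda>i::'n. axis i (1::real))"
    by (auto simp: inj_def axis_eq_axis)
  ultimately have "(\<Prod>b\<in>Basis. (u - l) \<bullet> b) = (\<Prod>i\<in>UNIV. (u - l) \<bullet> axis i 1)"
    by (metis (no_types, lifting) prod.reindex_cong)
  then show ?thesis
    by (simp add: inner_axis)
qed

lemma measurable_vec_lambda [measurable]:
  "(\<lambda>v. \<chi> i. v i) \<in> (\<Pi>\<^sub>M i\<in>UNIV. lborel) \<rightarrow>\<^sub>M (borel :: (real^'n) measure)"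
  by (simp add: borel_measurable_vec_iff)

text \<open>Agreement on boxes determines Lebesgue measure. The product form allows one coordinate
  to be integrated while the others are held fixed, as \<open>nn_integral_lborel_shear\<close>
  does.\<close>

lemma lborel_vec_eq_PiM:
  "(lborel :: (real^'n) measure) = distr (\<Pi>\<^sub>M i\<in>UNIV. lborel) borel (\<lambda>v. \<chi> i. v i)"
proof (rule lborel_eqI)
  interpret product_sigma_finite "\<lambda>_::'n. lborel :: real measure" ..
  fix l u :: "real^'n"
  assume "\<And>b. b \<in> Basis \<Longrightarrow> l \<bullet> b \<le> u \<bullet> b"
  then have lu: "l $ i \<le> u $ i" for i
    using inner_axis[of l i 1] inner_axis[of u i 1] by (metis axis_in_Basis_iff inner_real_def mult.right_neutral Basis_real_def insertI1)
  have "(\<lambda>v. \<chi> i. v i) -` box l u \<inter> space (\<Pi>\<^sub>M i\<in>UNIV. lborel) = (\<Pi>\<^sub>E i\<in>UNIV. {l $ i <..< u $ i})"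
    by (auto simp: space_PiM mem_box_cart PiE_iff)
  then have "emeasure (distr (\<Pi>\<^sub>M i\<in>UNIV. lborel) borel (\<lambda>v. \<chi> i. v i)) (box l u)
      = emeasure (\<Pi>\<^sub>M i\<in>UNIV. lborel) (\<Pi>\<^sub>E i\<in>UNIV. {l $ i <..< u $ i})"
    by (simp add: emeasure_distr)
  also have "\<dots> = (\<Prod>i\<in>UNIV. emeasure lborel {l $ i <..< u $ i})"
    by (rule emeasure_PiM) auto
  also have "\<dots> = ennreal (\<Prod>i\<in>UNIV. u $ i - l $ i)"
    using lu by (simp add: prod_ennreal)
  finally show "emeasure (distr (\<Pi>\<^sub>M i\<in>UNIV. lborel) borel (\<lambda>v. \<chi> i. v i)) (box l u)
      = ennreal (\<Prod>b\<in>Basis. (u - l) \<bullet> b)"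
    by (simp only: prod_Basis_vec)
qed simp

section \<open>Change of variables under invertible linear maps\<close>

text \<open>As m \<noteq> n, the inner integral over coordinate m sees a translation by the constant
  v n, under which Lebesgue measure on the line is invariant.\<close>

lemma nn_integral_lborel_shear:
  fixes F :: "real^'n \<Rightarrow> ennreal"
  assumes mn: "m \<noteq> n" and F [measurable]: "F \<in> borel_measurable borel"
  shows "(\<integral>\<^sup>+x. F (\<chi> i. if i = m then x $ m + x $ n else x $ i) \<partial>lborel) = (\<integral>\<^sup>+x. F x \<partial>lborel)"
proof -
  interpret product_sigma_finite "\<lambda>_::'n. lborel :: real measure" ..
  let ?P = "\<lambda>I. \<Pi>\<^sub>M i\<in>I. lborel :: real measure"
  have U: "UNIV = insert m (UNIV - {m})" by auto
  have split: "(\<integral>\<^sup>+x. H x \<partial>lborel) = (\<integral>\<^sup>+v. \<integral>\<^sup>+a. H (\<chi> i. (v(m := a)) i) \<partial>lborel \<partial>?P (UNIV - {m}))"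
    if [measurable]: "H \<in> borel_measurable borel" for H :: "real^'n \<Rightarrow> ennreal"
  proof -
    have "(\<integral>\<^sup>+x. H x \<partial>lborel) = (\<integral>\<^sup>+v. H (\<chi> i. v i) \<partial>?P UNIV)"
      by (subst lborel_vec_eq_PiM) (simp add: nn_integral_distr)
    also have "\<dots> = (\<integral>\<^sup>+v. \<integral>\<^sup>+a. H (\<chi> i. (v(m := a)) i) \<partial>lborel \<partial>?P (UNIV - {m}))"
      by (rule product_nn_integral_insert[of "UNIV - {m}" m, folded U]) auto
    finally show ?thesis .
  qed
  have [measurable]: "(\<lambda>x. \<chi> i. if i = m then x $ m + x $ n else x $ i) \<in> borel_measurable (borel :: (real^'n) measure)"
    by (auto simp: borel_measurable_vec_iff intro!: borel_measurable_continuous_onI continuous_intros)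
  have inner: "(\<integral>\<^sup>+a. F (\<chi> i. if i = m then a + v n else (v(m := a)) i) \<partial>lborel)
      = (\<integral>\<^sup>+a. F (\<chi> i. (v(m := a)) i) \<partial>lborel)" for v
  proof -
    have [measurable]: "(\<lambda>a. \<chi> i. (v(m := a)) i) \<in> borel_measurable (borel :: real measure)"
      by (auto simp: borel_measurable_vec_iff)
    have eq: "(\<chi> i. if i = m then a + v n else (v(m := a)) i) = (\<chi> i. (v(m := v n + a)) i)" for a
      by (simp add: vec_eq_iff)
    show ?thesis
      unfolding eq by (rule nn_integral_lborel_translate) measurable
  qed
  have "(\<integral>\<^sup>+x. F (\<chi> i. if i = m then x $ m + x $ n else x $ i) \<partial>lborel)
      = (\<integral>\<^sup>+v. \<integral>\<^sup>+a. F (\<chi> i. if i = m then a + v n else (v(m := a)) i) \<partial>lborel \<partial>?P (UNIV - {m}))"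
    using mn by (subst split) (simp_all cong: if_cong)
  also have "\<dots> = (\<integral>\<^sup>+x. F x \<partial>lborel)"
    by (simp only: inner split[OF F])
  finally show ?thesis .
qed

text \<open>The preimage of a box is the box with its sides permuted by \<open>inv p\<close>, of the
  same volume.\<close>

lemma nn_integral_lborel_permute:
  fixes F :: "real^'n \<Rightarrow> ennreal"
  assumes p: "p permutes UNIV" and F [measurable]: "F \<in> borel_measurable borel"
  shows "(\<integral>\<^sup>+x. F (\<chi> i. x $ p i) \<partial>lborel) = (\<integral>\<^sup>+x. F x \<partial>lborel)"
proof -
  have [measurable]: "(\<lambda>x. \<chi> i. x $ p i) \<in> borel_measurable (borel :: (real^'n) measure)"
    by (auto simp: borel_measurable_vec_iff intro!: borel_measurable_continuous_onI continuous_intros)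
  have "lborel = distr lborel borel (\<lambda>x::real^'n. \<chi> i. x $ p i)"
  proof (rule lborel_eqI)
    fix l u :: "real^'n"
    assume "\<And>b. b \<in> Basis \<Longrightarrow> l \<bullet> b \<le> u \<bullet> b"
    then have lu: "l $ i \<le> u $ i" for i
      using inner_axis[of l i 1] inner_axis[of u i 1] by (metis axis_in_Basis_iff inner_real_def mult.right_neutral Basis_real_def insertI1)
    let ?q = "inv p"
    let ?l = "(\<chi> i. l $ ?q i) :: real^'n" and ?u = "(\<chi> i. u $ ?q i) :: real^'n"
    have q: "p (?q i) = i" "?q (p i) = i" for i
      using permutes_inverses[OF p] by auto
    have "x \<in> box ?l ?u \<longleftrightarrow> (\<chi> i. x $ p i) \<in> box l u" for x :: "real^'n"
      unfolding mem_box_cart by (simp, metis q)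
    then have "(\<lambda>x::real^'n. \<chi> i. x $ p i) -` box l u = box ?l ?u"
      by auto
    then have "emeasure (distr lborel borel (\<lambda>x::real^'n. \<chi> i. x $ p i)) (box l u) = emeasure lborel (box ?l ?u)"
      by (simp add: emeasure_distr)
    also have "\<dots> = ennreal (\<Prod>b\<in>Basis. (?u - ?l) \<bullet> b)"
      using lu by (intro emeasure_lborel_box) (auto simp: Basis_vec_def inner_axis)
    also have "(\<Prod>b\<in>Basis. (?u - ?l) \<bullet> b) = (\<Prod>b\<in>Basis. (u - l) \<bullet> b)"
      unfolding prod_Basis_vec using prod.permute[OF permutes_inv[OF p], of "\<lambda>i. u $ i - l $ i"]
      by (simp add: comp_def)
    finally show "emeasure (distr lborel borel (\<lambda>x::real^'n. \<chi> i. x $ p i)) (box l u)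
        = ennreal (\<Prod>b\<in>Basis. (u - l) \<bullet> b)" .
  qed simp
  then have "(\<integral>\<^sup>+x. F x \<partial>lborel) = (\<integral>\<^sup>+x. F x \<partial>distr lborel borel (\<lambda>x::real^'n. \<chi> i. x $ p i))" by simp
  also have "\<dots> = (\<integral>\<^sup>+x. F (\<chi> i. x $ p i) \<partial>lborel)"
    by (simp add: nn_integral_distr)
  finally show ?thesis ..
qed

lemma nn_integral_lborel_diagonal:
  fixes A :: "real^'n^'n"
  assumes A: "\<And>i j. i \<noteq> j \<Longrightarrow> A $ i $ j = 0" and nz: "det A \<noteq> 0"
    and F [measurable]: "F \<in> borel_measurable borel"
  shows "ennreal \<bar>det A\<bar> * (\<integral>\<^sup>+x. F (A *v x) \<partial>lborel) = (\<integral>\<^sup>+x. F x \<partial>lborel)"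
proof -
  have det: "det A = (\<Prod>i\<in>UNIV. A $ i $ i)"
    by (rule det_diagonal) (rule A)
  \<comment> \<open>The affine change of variables scales along \<open>Basis\<close> vectors rather
    than along indices; on \<open>axis i 1\<close> this expression is the diagonal entry at
    i.\<close>
  define c where "c b = b \<bullet> (A *v b)" for b
  have c: "c (axis i 1) = A $ i $ i" for i
    by (simp add: c_def inner_axis' matrix_vector_mult_basis column_def)
  have basis: "(Basis :: (real^'n) set) = range (\<lambda>i. axis i 1)"
    by (auto simp: Basis_vec_def)
  have inj: "inj (\<lambda>i::'n. axis i (1::real))"
    by (auto simp: inj_def axis_eq_axis)
  have c0: "c b \<noteq> 0" if "b \<in> Basis" for b
    using that nz by (auto simp: basis c det)
  have prod: "(\<Prod>b\<in>Basis. \<bar>c b\<bar>) = \<bar>det A\<bar>"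
    by (simp add: basis prod.reindex[OF inj] c det abs_prod)
  have Ax: "(\<Sum>b\<in>Basis. (c b * (x \<bullet> b)) *\<^sub>R b) = A *v x" for x
  proof -
    have "(\<Sum>b\<in>Basis. (c b * (x \<bullet> b)) *\<^sub>R b) $ i = (A *v x) $ i" for i
    proof -
      have "(\<Sum>b\<in>Basis. (c b * (x \<bullet> b)) *\<^sub>R b) $ i = (\<Sum>j\<in>UNIV. if j = i then A $ i $ i * x $ i else 0)"
        unfolding basis sum.reindex[OF inj] comp_def c
        by (simp only: inner_axis vector_scaleR_component) (simp add: axis_def if_distrib[of "\<lambda>c. _ * c"] cong: if_cong)
      also have "\<dots> = (\<Sum>j\<in>UNIV. A $ i $ j * x $ j)"
      proof (rule sum.cong)
        show "(if j = i then A $ i $ i * x $ i else 0) = A $ i $ j * x $ j" for j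
          using A[of i j] by auto
      qed simp
      finally show ?thesis by (simp add: matrix_vector_mult_def)
    qed
    then show ?thesis by (simp add: vec_eq_iff)
  qed
  have [measurable]: "(\<lambda>x. A *v x) \<in> borel_measurable borel"
    by (intro borel_measurable_continuous_onI linear_continuous_on_compose[OF continuous_on_id]) simp
  have "lborel = density (distr lborel borel (\<lambda>x. A *v x)) (\<lambda>_. ennreal \<bar>det A\<bar>)"
    using lborel_affine_euclidean[of c 0] c0 by (simp add: Ax prod)
  then have "(\<integral>\<^sup>+x. F x \<partial>lborel)
      = (\<integral>\<^sup>+x. F x \<partial>density (distr lborel borel (\<lambda>x. A *v x)) (\<lambda>_. ennreal \<bar>det A\<bar>))" by simp
  also have "\<dots> = ennreal \<bar>det A\<bar> * (\<integral>\<^sup>+x. F (A *v x) \<partial>lborel)"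
    by (simp add: nn_integral_density nn_integral_distr nn_integral_cmult)
  finally show ?thesis ..
qed

text \<open>
  The library's \<open>measure_linear_image\<close> needs a well-ordered index type; reduction to
  elementary matrices does not.
\<close>

lemma nn_integral_lborel_linear:
  fixes A :: "real^'n^'n" and F :: "real^'n \<Rightarrow> ennreal"
  assumes "det A \<noteq> 0" and "F \<in> borel_measurable borel"
  shows "ennreal \<bar>det A\<bar> * (\<integral>\<^sup>+x. F (A *v x) \<partial>lborel) = (\<integral>\<^sup>+x. F x \<partial>lborel)"
proof -
  \<comment> \<open>The condition on the determinant is part of \<open>P\<close>, so that matrices
    with a zero row satisfy it vacuously and a product passes it on to both factors.
    \<open>P\<close> quantifies over F because in a product \<open>P B\<close> is applied to F
    composed with A.\<close>
  define P where "P A \<longleftrightarrow> (det A \<noteq> 0 \<longrightarrow> (\<forall>F\<in>borel_measurable borel.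
      ennreal \<bar>det A\<bar> * (\<integral>\<^sup>+x. F (A *v x) \<partial>lborel) = (\<integral>\<^sup>+x. F x \<partial>lborel)))" for A :: "real^'n^'n"
  have "P A"
  proof (rule induct_matrix_elementary_alt)
    fix A B assume PA: "P A" and PB: "P B"
    show "P (A ** B)"
      unfolding P_def
    proof (intro impI ballI)
      fix F :: "real^'n \<Rightarrow> ennreal" assume F [measurable]: "F \<in> borel_measurable borel"
      assume "det (A ** B) \<noteq> 0"
      then have nz: "det A \<noteq> 0" "det B \<noteq> 0" by (simp_all add: det_mul)
      have [measurable]: "(\<lambda>x. A *v x) \<in> borel_measurable borel"
        by (intro borel_measurable_continuous_onI linear_continuous_on_compose[OF continuous_on_id]) simp
      have FA: "(\<lambda>x. F (A *v x)) \<in> borel_measurable borel" by measurable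
      have "ennreal \<bar>det (A ** B)\<bar> * (\<integral>\<^sup>+x. F ((A ** B) *v x) \<partial>lborel)
          = ennreal \<bar>det A\<bar> * (ennreal \<bar>det B\<bar> * (\<integral>\<^sup>+x. F (A *v (B *v x)) \<partial>lborel))"
        by (simp add: det_mul abs_mult ennreal_mult matrix_vector_mul_assoc mult.assoc)
      also have "\<dots> = (\<integral>\<^sup>+x. F x \<partial>lborel)"
      proof -
        have "ennreal \<bar>det B\<bar> * (\<integral>\<^sup>+x. F (A *v (B *v x)) \<partial>lborel) = (\<integral>\<^sup>+x. F (A *v x) \<partial>lborel)"
          using PB[unfolded P_def, THEN mp, OF nz(2), THEN bspec, OF FA] .
        then show ?thesis
          using PA[unfolded P_def, THEN mp, OF nz(1), THEN bspec, OF F] by (simp only:)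
      qed
      finally show "ennreal \<bar>det (A ** B)\<bar> * (\<integral>\<^sup>+x. F ((A ** B) *v x) \<partial>lborel) = (\<integral>\<^sup>+x. F x \<partial>lborel)" .
    qed
  next
    fix A :: "real^'n^'n" and i assume "row i A = 0"
    then show "P A" by (simp add: P_def det_zero_row(1))
  next
    fix A :: "real^'n^'n" assume "\<And>i j. i \<noteq> j \<Longrightarrow> A $ i $ j = 0"
    then show "P A" by (auto simp: P_def intro!: nn_integral_lborel_diagonal)
  next
    fix m n :: 'n assume "m \<noteq> n"
    let ?p = "Transposition.transpose m n"
    let ?A = "(\<chi> i j. mat 1 $ i $ ?p j) :: real^'n^'n"
    have p: "?p permutes UNIV" by (simp add: permutes_swap_id)
    have det: "\<bar>det ?A\<bar> = 1"
      using det_permute_columns[OF p, of "mat 1 :: real^'n^'n"] by (simp add: abs_mult sign_def)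
    have Ax: "?A *v x = (\<chi> i. x $ ?p i)" for x
    proof -
      have "(\<Sum>j\<in>UNIV. (mat 1 :: real^'n^'n) $ i $ ?p j * x $ j) = (\<Sum>j\<in>UNIV. if j = ?p i then x $ ?p i else 0)" for i
        by (intro sum.cong) (auto simp: mat_def transpose_eq_iff)
      then show ?thesis by (simp add: vec_eq_iff matrix_vector_mult_def)
    qed
    show "P ?A"
      unfolding P_def Ax using nn_integral_lborel_permute[OF p] by (simp add: det)
  next
    fix m n :: 'n assume mn: "m \<noteq> n"
    let ?A = "(\<chi> i j. of_bool (i = m \<and> j = n \<or> i = j)) :: real^'n^'n"
    have eq: "?A = (\<chi> k. if k = m then row m (mat 1) + 1 *s row n (mat 1) else row k (mat 1))"
      using mn by (auto simp: vec_eq_iff row_def mat_def)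
    have det: "det ?A = 1"
      unfolding eq det_row_operation[OF mn] by simp
    have Ax: "?A *v x = (\<chi> i. if i = m then x $ m + x $ n else x $ i)" for x
    proof -
      have "(\<Sum>j\<in>UNIV. of_bool (i = m \<and> j = n \<or> i = j) * x $ j)
          = (\<Sum>j\<in>UNIV. (if j = i then x $ i else 0) + (if j = n then (if i = m then x $ n else 0) else 0))" for i
        using mn by (intro sum.cong) auto
      then show ?thesis by (simp add: vec_eq_iff matrix_vector_mult_def sum.distrib)
    qed
    show "P ?A"
      unfolding P_def Ax det using nn_integral_lborel_shear[OF mn] by simp
  qed
  then show ?thesis using assms by (simp add: P_def)
qed

lemma nn_integral_exp_half_sq:
  "(\<integral>\<^sup>+x. ennreal (exp (- x\<^sup>2 / 2)) \<partial>(lborel :: real measure)) = ennreal (sqrt (2 * pi))"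
proof -
  have "(\<integral>\<^sup>+x. ennreal (exp (- x\<^sup>2 / 2)) \<partial>(lborel :: real measure))
      = (\<integral>\<^sup>+x. ennreal (sqrt (2 * pi)) * ennreal (std_normal_density x) \<partial>lborel)"
    by (intro nn_integral_cong) (simp add: std_normal_density_def flip: ennreal_mult)
  also have "\<dots> = ennreal (sqrt (2 * pi)) * (\<integral>\<^sup>+x. ennreal (std_normal_density x) \<partial>lborel)"
    by (rule nn_integral_cmult) measurable
  also have "(\<integral>\<^sup>+x. ennreal (std_normal_density x) \<partial>lborel) = 1"
    using prob_space.emeasure_space_1[OF prob_space_normal_density[of 1 0]]
    by (simp add: emeasure_density)
  finally show ?thesis by simp
qed

lemma nn_integral_exp_half_norm_sq:
  "(\<integral>\<^sup>+x. ennreal (exp (- (norm x)\<^sup>2 / 2)) \<partial>(lborel :: (real^'n) measure)) = ennreal (sqrt ((2 * pi) ^ CARD('n)))"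
proof -
  have "exp (- (norm x)\<^sup>2 / 2) = (\<Prod>b\<in>Basis. exp (- (x \<bullet> b)\<^sup>2 / 2))" for x :: "real^'n"
  proof -
    have "(norm x)\<^sup>2 = (\<Sum>b\<in>Basis. (x \<bullet> b)\<^sup>2)"
      unfolding power2_norm_eq_inner euclidean_inner[of x x] by (simp add: power2_eq_square)
    then show ?thesis
      by (simp add: exp_sum[symmetric] sum_negf sum_divide_distrib[symmetric])
  qed
  then have "(\<integral>\<^sup>+x. ennreal (exp (- (norm x)\<^sup>2 / 2)) \<partial>(lborel :: (real^'n) measure))
      = (\<integral>\<^sup>+x. (\<Prod>b\<in>Basis. ennreal (exp (- (x \<bullet> b)\<^sup>2 / 2))) \<partial>(lborel :: (real^'n) measure))"
    by (simp add: prod_ennreal)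
  also have "\<dots> = (\<Prod>b\<in>(Basis :: (real^'n) set). \<integral>\<^sup>+x. ennreal (exp (- x\<^sup>2 / 2)) \<partial>lborel)"
    by (rule nn_integral_lborel_prod) auto
  also have "\<dots> = ennreal (sqrt ((2 * pi) ^ CARD('n)))"
    unfolding nn_integral_exp_half_sq by (simp add: ennreal_power real_sqrt_power real_sqrt_mult power_mult_distrib)
  finally show ?thesis .
qed

text \<open>Gram-Schmidt for the inner product \<open>(x, y) \<mapsto> x \<bullet> R y\<close>.\<close>

lemma pos_def_orthonormal_family:
  fixes R :: "real^'n^'n"
  assumes R: "pos_def_matrix R" and "m \<le> CARD('n)"
  shows "\<exists>v :: nat \<Rightarrow> real^'n. \<forall>i<m. \<forall>j<m. v i \<bullet> (R *v v j) = (if i = j then 1 else 0)"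
  using assms(2)
proof (induction m)
  case (Suc m)
  then obtain v :: "nat \<Rightarrow> real^'n" where v: "\<And>i j. i < m \<Longrightarrow> j < m \<Longrightarrow> v i \<bullet> (R *v v j) = (if i = j then 1 else 0)"
    by auto
  \<comment> \<open>At most m < n vectors span a proper subspace, so a nonzero x is orthogonal to
    all \<open>R *v v i\<close>. Symmetry of R gives the same relation with x and \<open>v i\<close>
    exchanged.\<close>
  let ?S = "(\<lambda>i. R *v v i) ` {..<m}"
  have "dim ?S \<le> card ?S" by (rule dim_le_card') simp
  also have "\<dots> \<le> m" using card_image_le[of "{..<m}"] by simp
  also have "m < DIM(real^'n)" using Suc.prems by simp
  finally obtain x where x: "x \<noteq> 0" "\<And>y. y \<in> span ?S \<Longrightarrow> orthogonal x y"
    using orthogonal_to_subspace_exists by blast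
  have sym: "a \<bullet> (R *v b) = b \<bullet> (R *v a)" for a b
    using R by (metis dot_lmul_matrix inner_commute pos_def_matrix_def transpose_matrix_vector)
  have pos: "0 < x \<bullet> (R *v x)" using R x by (simp add: pos_def_matrix_def)
  have orth: "x \<bullet> (R *v v i) = 0" if "i < m" for i
    using x(2)[of "R *v v i"] that by (auto simp: orthogonal_def span_base)
  define w where "w = v(m := (1 / sqrt (x \<bullet> (R *v x))) *\<^sub>R x)"
  have "w i \<bullet> (R *v w j) = (if i = j then 1 else 0)" if "i < Suc m" "j < Suc m" for i j
    using that pos v orth sym[of "v i" x]
    by (auto simp: w_def less_Suc_eq matrix_vector_mult_scaleR field_simps)
  then show ?case by blast
qed simp

section \<open>Whitening of a covariance matrix, mass and maximum of the Gaussian density\<close>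

text \<open>The columns of B are the R-orthonormal family, and the entries of the product are the
  R-inner products of these columns. The bijection e transfers the numbering of the family to the
  index type.\<close>

lemma pos_def_congruent_identity:
  fixes R :: "real^'n^'n"
  assumes R: "pos_def_matrix R"
  obtains B :: "real^'n^'n" where "transpose B ** R ** B = mat 1"
proof -
  obtain v :: "nat \<Rightarrow> real^'n" where v: "\<And>i j. i < CARD('n) \<Longrightarrow> j < CARD('n) \<Longrightarrow>
      v i \<bullet> (R *v v j) = (if i = j then 1 else 0)"
    using pos_def_orthonormal_family[OF R order_refl] by blast
  obtain e :: "'n \<Rightarrow> nat" where e: "bij_betw e UNIV {0..<CARD('n)}"
    using ex_bij_betw_finite_nat[of "UNIV :: 'n set"] by auto
  have e': "e i < CARD('n)" "e i = e j \<longleftrightarrow> i = j" for i j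
    using e by (auto simp: bij_betw_def inj_eq)
  define B :: "real^'n^'n" where "B = (\<chi> i j. v (e j) $ i)"
  have B: "B *v axis j 1 = v (e j)" for j
    by (simp add: matrix_vector_mult_basis column_def B_def vec_eq_iff)
  have "(transpose B ** R ** B) $ i $ j = (mat 1 :: real^'n^'n) $ i $ j" for i j
  proof -
    have "(transpose B ** R ** B) $ i $ j = ((transpose B ** R ** B) *v axis j 1) $ i"
      by (simp add: matrix_vector_mult_basis column_def)
    also have "\<dots> = axis i 1 \<bullet> ((transpose B ** R ** B) *v axis j 1)"
      by (simp add: inner_axis')
    also have "\<dots> = (B *v axis i 1) \<bullet> (R *v (B *v axis j 1))"
      by (metis dot_lmul_matrix matrix_vector_mul_assoc vector_transpose_matrix transpose_matrix_vector)
    also have "\<dots> = (mat 1 :: real^'n^'n) $ i $ j"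
      using v[of "e i" "e j"] e' by (simp add: B mat_def)
    finally show ?thesis .
  qed
  then have "transpose B ** R ** B = mat 1"
    by (simp add: vec_eq_iff)
  then show thesis by (rule that)
qed

text \<open>\<open>matrix_inv\<close> is a choice among two-sided inverses. For square matrices a
  right inverse is also a left inverse, and this determines it.\<close>

lemma matrix_inv_eqI:
  fixes A B :: "real^'n^'n"
  assumes "A ** B = mat 1"
  shows "matrix_inv A = B"
proof -
  have BA: "B ** A = mat 1"
    using assms matrix_left_right_inverse by blast
  then have "invertible A" using assms by (auto simp: invertible_def)
  then have "A ** matrix_inv A = mat 1"
    unfolding invertible_def matrix_inv_def by (rule someI2_ex) simp
  then have "B ** (A ** matrix_inv A) = B" by simp
  then show ?thesis by (simp add: matrix_mul_assoc BA)
qed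

text \<open>From \<open>transpose C ** R ** C = mat 1\<close> the inverse of R is
  \<open>C ** transpose C\<close>, so its quadratic form at x is the squared norm of
  \<open>transpose C *v x\<close>. Taking determinants of the same equation relates det C to det
  R.\<close>

lemma mvn_density_whitened:
  fixes R :: "real^'n^'n"
  assumes R: "pos_def_matrix R"
  obtains B :: "real^'n^'n" where "det B \<noteq> 0" "\<bar>det B\<bar> * sqrt (det R) = 1"
    "\<And>x \<mu>. mvn_density x \<mu> R = exp (- (norm (B *v (x - \<mu>)))\<^sup>2 / 2) / sqrt ((2 * pi) ^ CARD('n) * det R)"
proof -
  obtain C :: "real^'n^'n" where C: "transpose C ** R ** C = mat 1"
    using pos_def_congruent_identity[OF R] by blast
  let ?B = "transpose C"
  have det: "det C * det R * det C = 1"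
    using arg_cong[OF C, of det] by (simp add: det_mul det_transpose)
  have "C ** (?B ** R) = mat 1"
    using C by (metis matrix_left_right_inverse matrix_mul_assoc)
  then have "R ** (C ** ?B) = mat 1"
    by (metis matrix_left_right_inverse matrix_mul_assoc)
  then have inv: "matrix_inv R = C ** ?B" by (rule matrix_inv_eqI)
  have "x \<bullet> (matrix_inv R *v x) = (norm (?B *v x))\<^sup>2" for x
  proof -
    have "x \<bullet> (matrix_inv R *v x) = x \<bullet> (C *v (?B *v x))"
      by (simp only: inv matrix_vector_mul_assoc)
    also have "\<dots> = (?B *v x) \<bullet> (?B *v x)"
      by (metis dot_lmul_matrix transpose_matrix_vector)
    finally show ?thesis by (simp add: power2_norm_eq_inner)
  qed
  then have "mvn_density x \<mu> R = exp (- (norm (?B *v (x - \<mu>)))\<^sup>2 / 2) / sqrt ((2 * pi) ^ CARD('n) * det R)" for x \<mu>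
    by (simp add: mvn_density_def)
  moreover have "det ?B \<noteq> 0"
    using det by (auto simp: det_transpose)
  moreover have "\<bar>det ?B\<bar> * sqrt (det R) = 1"
  proof -
    have "det C * det R * det C = (det C)\<^sup>2 * det R"
      by (simp add: power2_eq_square)
    then have "sqrt (det C * det R * det C) = \<bar>det C\<bar> * sqrt (det R)"
      by (simp only: real_sqrt_mult real_sqrt_abs)
    then show ?thesis using det by (simp add: det_transpose)
  qed
  ultimately show thesis using that by blast
qed

text \<open>Substituting z = B (x - \<mu>) gives the standard Gaussian integral, and the factor
  \<bar>det B\<bar> is exactly 1 / sqrt (det R). Since transitions have mass 1, the kernel mass is
  bounded by the observation density alone.\<close>

lemma nn_integral_mvn_density:
  fixes R :: "real^'n^'n"
  assumes R: "pos_def_matrix R"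
  shows "(\<integral>\<^sup>+x. ennreal (mvn_density x \<mu> R) \<partial>lborel) = 1"
proof -
  obtain B where B: "det B \<noteq> 0" "\<bar>det B\<bar> * sqrt (det R) = 1"
    and mvn: "\<And>x \<mu>. mvn_density x \<mu> R = exp (- (norm (B *v (x - \<mu>)))\<^sup>2 / 2) / sqrt ((2 * pi) ^ CARD('n) * det R)"
    using mvn_density_whitened[OF R] by blast
  have pos: "0 < det R" by (rule pos_def_det_pos[OF R])
  let ?F = "\<lambda>x::real^'n. ennreal (exp (- (norm x)\<^sup>2 / 2))"
  let ?c = "sqrt ((2 * pi) ^ CARD('n) * det R)"
  have [measurable]: "(\<lambda>x. B *v x) \<in> borel_measurable borel"
    by (intro borel_measurable_continuous_onI linear_continuous_on_compose[OF continuous_on_id]) simp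
  have "(\<integral>\<^sup>+x. ?F (B *v (x - \<mu>)) \<partial>lborel) = (\<integral>\<^sup>+x. ?F (B *v x) \<partial>lborel)"
    using nn_integral_lborel_translate[of "\<lambda>x. ?F (B *v x)" "- \<mu>"] by simp
  then have int: "ennreal \<bar>det B\<bar> * (\<integral>\<^sup>+x. ?F (B *v (x - \<mu>)) \<partial>lborel) = ennreal (sqrt ((2 * pi) ^ CARD('n)))"
    using nn_integral_lborel_linear[OF B(1), of ?F] nn_integral_exp_half_norm_sq[where 'n='n] by simp
  let ?a = "1 / sqrt ((2 * pi) ^ CARD('n))" and ?I = "\<integral>\<^sup>+x. ?F (B *v (x - \<mu>)) \<partial>lborel"
  have c: "1 / ?c = ?a * \<bar>det B\<bar>"
    using B(2) pos by (simp add: real_sqrt_mult field_simps)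
  have "0 \<le> 1 / ?c" "0 \<le> ?a" using pos by simp_all
  note mult' = this[THEN ennreal_mult']
  have "(\<integral>\<^sup>+x. ennreal (mvn_density x \<mu> R) \<partial>lborel)
      = (\<integral>\<^sup>+x. ennreal (1 / ?c) * ?F (B *v (x - \<mu>)) \<partial>lborel)"
    unfolding mult'(1)[symmetric] mvn by simp
  also have "\<dots> = ennreal (1 / ?c) * ?I"
    by (rule nn_integral_cmult) measurable
  also have "\<dots> = ennreal ?a * (ennreal \<bar>det B\<bar> * ?I)"
    unfolding c mult'(2) mult.assoc ..
  also have "\<dots> = ennreal (1 / sqrt ((2 * pi) ^ CARD('n))) * ennreal (sqrt ((2 * pi) ^ CARD('n)))"
    by (simp only: int)
  also have "\<dots> = ennreal ((1 / sqrt ((2 * pi) ^ CARD('n))) * sqrt ((2 * pi) ^ CARD('n)))"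
    by (rule ennreal_mult'[symmetric]) simp
  also have "\<dots> = 1" by simp
  finally show ?thesis .
qed

text \<open>Whitening shows that the exponent is nonpositive, so the density is at most its value at
  the mean, where the lower bound on the determinant enters.\<close>

lemma mvn_density_le:
  fixes R :: "real^'n^'n"
  assumes R: "pos_def_matrix R" and c: "0 < c" "c \<le> det R"
  shows "mvn_density x \<mu> R \<le> (2 * pi) powr (- (real CARD('n) / 2)) * c powr (- (1 / 2))"
proof -
  obtain B where "det B \<noteq> 0" "\<bar>det B\<bar> * sqrt (det R) = 1"
    and B: "\<And>x \<mu>. mvn_density x \<mu> R
      = exp (- (norm (B *v (x - \<mu>)))\<^sup>2 / 2) / sqrt ((2 * pi) ^ CARD('n) * det R)"
    using mvn_density_whitened[OF R] by blast
  have "mvn_density x \<mu> R \<le> 1 / sqrt ((2 * pi) ^ CARD('n) * c)"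
    unfolding B using c by (intro frac_le) (auto intro!: mult_left_mono)
  moreover have "1 / sqrt ((2 * pi) ^ CARD('n) * c) = 1 / ((2 * pi) powr (real CARD('n) / 2) * c powr (1 / 2))"
  proof -
    have "(2 * pi) powr (real CARD('n) / 2) = ((2 * pi) powr real CARD('n)) powr (1 / 2)"
      unfolding powr_powr by simp
    also have "\<dots> = sqrt ((2 * pi) powr real CARD('n))"
      by (rule powr_half_sqrt) simp
    also have "(2 * pi) powr real CARD('n) = (2 * pi) ^ CARD('n)"
      by (rule powr_realpow) simp
    finally have "(2 * pi) powr (real CARD('n) / 2) = sqrt ((2 * pi) ^ CARD('n))" .
    moreover have "c powr (1 / 2) = sqrt c"
      using c by (intro powr_half_sqrt) simp
    ultimately show ?thesis
      by (simp only: real_sqrt_mult)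
  qed
  moreover have "\<dots> = (2 * pi) powr (- (real CARD('n) / 2)) * c powr (- (1 / 2))"
    by (simp only: powr_minus divide_inverse inverse_mult_distrib mult_1_left)
  ultimately show ?thesis
    by (simp only:)
qed

section \<open>The filtering recursion of the model\<close>

text \<open>Bayes' rule with likelihood l. The upper bound on l makes n l integrable. Positivity of
  l makes the constant nonzero: otherwise n would vanish almost everywhere.\<close>

lemma prob_density_reweight:
  fixes l :: "'a \<Rightarrow> real"
  assumes n: "prob_density N n" and l [measurable]: "l \<in> borel_measurable N"
    and pos: "\<And>x. x \<in> space N \<Longrightarrow> 0 < l x" and le: "\<And>x. x \<in> space N \<Longrightarrow> l x \<le> c"
  shows "0 < (LINT x|N. n x * l x)"
    and "prob_density N (\<lambda>x. n x * l x / (LINT x|N. n x * l x))"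
proof -
  note [measurable] = prob_density_measurable[OF n]
  note nn = prob_density_nonneg[OF n]
  let ?Z = "LINT x|N. n x * l x"
  have i: "integrable N (\<lambda>x. n x * l x)"
  proof (rule Bochner_Integration.integrable_bound)
    show "integrable N (\<lambda>x. c * n x)"
      using prob_density_integrable[OF n] by simp
    show "AE x in N. norm (n x * l x) \<le> norm (c * n x)"
    proof (rule AE_I2)
      fix x assume x: "x \<in> space N"
      have "l x * n x \<le> c * n x"
        using le[OF x] nn[OF x] by (rule mult_right_mono)
      then show "norm (n x * l x) \<le> norm (c * n x)"
        using pos[OF x] le[OF x] nn[OF x] by (simp add: abs_mult mult.commute)
    qed
  qed measurable
  have nonneg: "0 \<le> n x * l x" if "x \<in> space N" for x
    using pos[OF that] nn[OF that] by simp
  have "?Z \<noteq> 0"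
  proof
    assume "?Z = 0"
    then have "AE x in N. n x * l x = 0"
      using i nonneg by (subst (asm) integral_nonneg_eq_0_iff_AE) auto
    then have "AE x in N. n x = 0"
      using AE_space[of N]
    proof eventually_elim
      case (elim x)
      then show ?case using pos[of x] by simp
    qed
    then have "integral\<^sup>L N n = 0"
      by (rule integral_eq_zero_AE)
    then show False using prob_density_integral[OF n] by simp
  qed
  moreover have "0 \<le> ?Z"
    using nonneg by (rule Bochner_Integration.integral_nonneg)
  ultimately show Z: "0 < ?Z" by simp
  have "(\<integral>\<^sup>+x. ennreal (n x * l x / ?Z) \<partial>N) = ennreal (LINT x|N. n x * l x / ?Z)"
    using i nonneg Z by (intro nn_integral_eq_integral) auto
  then show "prob_density N (\<lambda>x. n x * l x / ?Z)"
    using Z nonneg by (simp add: prob_density_def)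
qed

lemma prob_density_normalize:
  assumes i: "integrable N f" and nonneg: "\<And>x. x \<in> space N \<Longrightarrow> 0 \<le> f x" and pos: "0 < integral\<^sup>L N f"
  shows "prob_density N (\<lambda>x. f x / integral\<^sup>L N f)"
proof -
  have "(\<integral>\<^sup>+x. ennreal (f x / integral\<^sup>L N f) \<partial>N) = ennreal (LINT x|N. f x / integral\<^sup>L N f)"
    using i nonneg pos by (intro nn_integral_eq_integral) auto
  then show ?thesis
    using i pos nonneg by (simp add: prob_density_def)
qed

text \<open>The constant \<open>c j k\<close> collects the amplification from time \<open>j\<close> to time \<open>k\<close>.\<close>

lemma error_recursion:
  fixes a b :: "nat \<Rightarrow> real" and c :: "nat \<Rightarrow> nat \<Rightarrow> real" and e :: "nat \<Rightarrow> ennreal"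
  assumes a0: "a 0 = 0" and b: "\<And>k. 0 \<le> b k"
    and loc: "\<And>k. ennreal (l (Suc k)) \<le> ennreal (c (Suc k) (Suc k)) * e (Suc k)"
    and step: "\<And>k. a (Suc k) \<le> b k * a k + l (Suc k)" and l: "\<And>k. 0 \<le> l k" and a: "\<And>k. 0 \<le> a k"
    and c: "\<And>j k. j \<le> k \<Longrightarrow> c j (Suc k) = b k * c j k"
  shows "ennreal (a k) \<le> (\<Sum>j=1..k. ennreal (c j k) * e j)"
proof (induction k)
  case 0
  then show ?case by (simp add: a0)
next
  case (Suc k)
  have "ennreal (a (Suc k)) \<le> ennreal (b k * a k + l (Suc k))"
    by (rule ennreal_leI[OF step])
  also have "\<dots> = ennreal (b k) * ennreal (a k) + ennreal (l (Suc k))"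
    using a b l by (simp add: ennreal_mult)
  also have "\<dots> \<le> ennreal (b k) * (\<Sum>j=1..k. ennreal (c j k) * e j) + ennreal (c (Suc k) (Suc k)) * e (Suc k)"
    by (intro add_mono mult_left_mono Suc.IH loc) simp
  also have "ennreal (b k) * (\<Sum>j=1..k. ennreal (c j k) * e j) = (\<Sum>j=1..k. ennreal (c j (Suc k)) * e j)"
    unfolding sum_distrib_left
    by (rule sum.cong) (simp_all add: c ennreal_mult'[OF b] mult.assoc)
  finally show ?case by simp
qed

context state_space_model
begin

definition step_kernel :: "real^'r \<Rightarrow> real^'n \<Rightarrow> real^'n \<Rightarrow> real^'d \<Rightarrow> real" where
  "step_kernel yk x x' t = mvn_density yk (h x t) (\<Gamma> t) * mvn_density x (\<Phi> x' t) (\<Sigma> t)"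

definition lik_bound :: "real \<Rightarrow> real" where
  "lik_bound Ct = (2 * pi) powr (- (real CARD('r) / 2)) * Ct powr (- (1 / 2))"

lemma step_kernel_comp:
  assumes "a \<in> borel_measurable N" "b \<in> borel_measurable N" "c \<in> N \<rightarrow>\<^sub>M lebesgue_param \<Theta>"
  shows "(\<lambda>z. step_kernel yk (a z) (b z) (c z)) \<in> borel_measurable N"
  unfolding step_kernel_def
  by (intro borel_measurable_times mvn_Gamma_comp mvn_Sigma_comp h_comp Phi_comp assms borel_measurable_const)

lemma step_kernel_pos: "t \<in> \<Theta> \<Longrightarrow> 0 < step_kernel yk x x' t"
  unfolding step_kernel_def by (intro mult_pos_pos mvn_density_pos Sigma_pos_def Gamma_pos_def)

abbreviation state_param where "state_param \<equiv> (lborel :: (real^'n) measure) \<Otimes>\<^sub>M lebesgue_param \<Theta>"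

definition approx ::
  "(nat \<Rightarrow> real^'n \<Rightarrow> real^'d \<Rightarrow> real) \<Rightarrow> (nat \<Rightarrow> real^'d \<Rightarrow> real) \<Rightarrow> nat \<Rightarrow> (real^'n) \<times> (real^'d) \<Rightarrow> real" where
  "approx \<rho> \<nu> k = (\<lambda>(x, t). \<rho> k x t * \<nu> k t)"

text \<open>For k = 0 the truncated \<open>k - 1\<close> is again 0. The result is still a density,
  and the error recursion reads \<open>filtered\<close> at \<open>Suc k\<close> only.\<close>

definition filtered ::
  "(nat \<Rightarrow> real^'r) \<Rightarrow> (nat \<Rightarrow> real^'n \<Rightarrow> real^'d \<Rightarrow> real) \<Rightarrow> (nat \<Rightarrow> real^'d \<Rightarrow> real) \<Rightarrow> nat \<Rightarrow> (real^'n) \<times> (real^'d) \<Rightarrow> real" where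
  "filtered y \<rho> \<nu> k = (\<lambda>(x, t). filter_state \<Phi> h \<Sigma> \<Gamma> (y k) (\<rho> (k - 1)) x t
     * filter_param \<Theta> \<Phi> h \<Sigma> \<Gamma> (y k) (\<rho> (k - 1)) (\<nu> (k - 1)) t)"

definition local_error ::
  "(nat \<Rightarrow> real^'r) \<Rightarrow> (nat \<Rightarrow> real^'n \<Rightarrow> real^'d \<Rightarrow> real) \<Rightarrow> (nat \<Rightarrow> real^'d \<Rightarrow> real) \<Rightarrow> nat \<Rightarrow> ennreal" where
  "local_error y \<rho> \<nu> k = ennsqrt
     ((\<integral>\<^sup>+t. ennreal (\<nu> k t) * KL lborel (\<lambda>x. \<rho> k x t) (\<lambda>x. filter_state \<Phi> h \<Sigma> \<Gamma> (y k) (\<rho> (k - 1)) x t)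
        \<partial>lebesgue_param \<Theta>)
      + KL (lebesgue_param \<Theta>) (\<nu> k) (filter_param \<Theta> \<Phi> h \<Sigma> \<Gamma> (y k) (\<rho> (k - 1)) (\<nu> (k - 1))))"

text \<open>The extended-valued counterpart of \<open>joint_density\<close>. It satisfies the
  filtering recursion at every point, because Tonelli needs no integrability.\<close>

definition path_mass :: "(nat \<Rightarrow> real^'r) \<Rightarrow> nat \<Rightarrow> (real^'n) \<times> (real^'d) \<Rightarrow> ennreal" where
  "path_mass y k z = (\<integral>\<^sup>+x'. ennreal (path_density \<Phi> h \<Sigma> \<Gamma> p0 k (x'(k := fst z)) (snd z) y) \<partial>(\<Pi>\<^sub>M i\<in>{..<k}. lborel))"

lemma lik_bound_pos: "0 < Ct \<Longrightarrow> 0 < lik_bound Ct"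
  by (simp add: lik_bound_def)

lemma lik_bound_power:
  assumes Ct_pos: "0 < Ct"
  shows "lik_bound Ct ^ m = (2 * pi) powr (- (real CARD('r) * real m / 2)) * Ct powr (- (real m / 2))"
  using Ct_pos by (simp only: lik_bound_def power_mult_distrib powr_power powr_gt_zero)
    (simp add: powr_powr powr_realpow[symmetric] mult.commute)

lemma sqrt_lik_bound_power:
  assumes Ct_pos: "0 < Ct"
  shows "sqrt (lik_bound Ct) ^ m = (2 * pi) powr (- (real CARD('r) * real m / 4)) * Ct powr (- (real m / 4))"
proof -
  have sqrt_powr: "sqrt (x powr a) = x powr (a / 2)" for x a :: real
    using powr_half_sqrt[of "x powr a"] by (simp add: powr_powr)
  have "sqrt (lik_bound Ct) ^ m = sqrt (lik_bound Ct ^ m)"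
    by (simp add: real_sqrt_power)
  then show ?thesis
    by (simp add: lik_bound_power[OF Ct_pos] real_sqrt_mult sqrt_powr)
qed

context
  fixes Ct :: real and y :: "nat \<Rightarrow> real^'r"
  assumes Ct_pos: "0 < Ct" and Ct_le: "\<forall>t\<in>\<Theta>. Ct \<le> det (\<Gamma> t)"
begin

text \<open>For a fixed old state, the observation factor is at most \<open>lik_bound Ct\<close> at
  every new state, and the transition factor integrates to 1 over the new state.\<close>

lemma state_kernel_step:
  "state_kernel lborel (lebesgue_param \<Theta>) (step_kernel yk) (lik_bound Ct)"
proof -
  interpret T: sigma_finite_measure "lebesgue_param \<Theta>" by (rule sigma_finite_param)
  show ?thesis
  proof
    have fst': "fst \<in> borel_measurable (lborel \<Otimes>\<^sub>M L)" for L :: "'z measure"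
      using measurable_fst[of lborel L] by simp
    show "(\<lambda>(x, x', t). step_kernel yk x x' t)
        \<in> borel_measurable (lborel \<Otimes>\<^sub>M (lborel \<Otimes>\<^sub>M lebesgue_param \<Theta>))"
      unfolding split_beta'
      by (intro step_kernel_comp fst' measurable_compose[OF measurable_snd fst']
          measurable_compose[OF measurable_snd measurable_snd])
    show "0 < lik_bound Ct"
      using Ct_pos by (simp add: lik_bound_def)
    show "emeasure (lborel :: (real^'n) measure) (space lborel) \<noteq> 0"
      by simp
    fix x x' :: "real^'n" and t assume "t \<in> space (lebesgue_param \<Theta>)"
    then have t: "t \<in> \<Theta>" by simp
    show "0 < step_kernel yk x x' t"
      by (rule step_kernel_pos[OF t])
    have m: "(\<lambda>x. mvn_density x (\<Phi> x' t) (\<Sigma> t)) \<in> borel_measurable lborel"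
      using t by (intro mvn_Sigma_comp) simp_all
    have "(\<integral>\<^sup>+x. ennreal (step_kernel yk x x' t) \<partial>lborel)
        \<le> (\<integral>\<^sup>+x. ennreal (lik_bound Ct) * ennreal (mvn_density x (\<Phi> x' t) (\<Sigma> t)) \<partial>lborel)"
    proof (rule nn_integral_mono)
      fix x
      have "step_kernel yk x x' t \<le> lik_bound Ct * mvn_density x (\<Phi> x' t) (\<Sigma> t)"
        unfolding step_kernel_def lik_bound_def
        using mvn_density_le[OF Gamma_pos_def[OF t] Ct_pos bspec[OF Ct_le t]] mvn_density_pos[OF Sigma_pos_def[OF t]]
        by (intro mult_right_mono) (auto intro: less_imp_le)
      then show "ennreal (step_kernel yk x x' t) \<le> ennreal (lik_bound Ct) * ennreal (mvn_density x (\<Phi> x' t) (\<Sigma> t))"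
        using Ct_pos by (subst ennreal_mult'[symmetric]) (simp_all add: lik_bound_def ennreal_leI)
    qed
    also have "\<dots> = ennreal (lik_bound Ct)"
      using m by (simp add: nn_integral_cmult nn_integral_mvn_density[OF Sigma_pos_def[OF t]])
    finally show "(\<integral>\<^sup>+x. ennreal (step_kernel yk x x' t) \<partial>lborel) \<le> ennreal (lik_bound Ct)" .
  qed
qed

abbreviation filter_push :: "real^'r \<Rightarrow> ((real^'n) \<times> (real^'d) \<Rightarrow> real) \<Rightarrow> (real^'n) \<times> (real^'d) \<Rightarrow> real" where
  "filter_push yk \<equiv> state_kernel.push lborel (step_kernel yk)"

lemma filter_push_def: "filter_push yk f = (\<lambda>(x, t). LINT x'|lborel. step_kernel yk x x' t * f (x', t))"
  by (rule state_kernel.push_def[OF state_kernel_step])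

section \<open>One filtering step of a factorised density\<close>

context
  fixes \<rho> :: "real^'n \<Rightarrow> real^'d \<Rightarrow> real" and \<nu> :: "real^'d \<Rightarrow> real" and yk :: "real^'r"
  assumes rho: "cond_density \<Theta> \<rho>" and nu: "prob_density (lebesgue_param \<Theta>) \<nu>"
begin

interpretation kern: state_kernel lborel "lebesgue_param \<Theta>" "step_kernel yk" "lik_bound Ct"
  by (rule state_kernel_step)

lemma rho_measurable: "(\<lambda>(x, t). \<rho> x t) \<in> borel_measurable state_param"
  and rho_density: "t \<in> \<Theta> \<Longrightarrow> prob_density lborel (\<lambda>x. \<rho> x t)"
  using rho by (auto simp: cond_density_def)

lemma filter_numerator:
  "mvn_density yk (h x t) (\<Gamma> t) * predict \<Phi> \<Sigma> \<rho> x t = (LINT x'|lborel. step_kernel yk x x' t * \<rho> x' t)"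
  by (simp add: predict_def step_kernel_def mult.assoc)

lemma predict_lik_eq:
  "predict_lik \<Phi> h \<Sigma> \<Gamma> yk \<rho> t = (LINT x|lborel. LINT x'|lborel. step_kernel yk x x' t * \<rho> x' t)"
  by (simp add: predict_lik_def filter_numerator)

lemma predict_lik_pos: "t \<in> \<Theta> \<Longrightarrow> 0 < predict_lik \<Phi> h \<Sigma> \<Gamma> yk \<rho> t"
  unfolding predict_lik_eq using kern.fibre_integral(4)[OF _ rho_density] by simp

lemma predict_lik_le: "t \<in> \<Theta> \<Longrightarrow> predict_lik \<Phi> h \<Sigma> \<Gamma> yk \<rho> t \<le> lik_bound Ct"
  unfolding predict_lik_eq using kern.fibre_integral(5)[OF _ rho_density] by simp

lemma filter_numerator_measurable:
  "(\<lambda>z. LINT x'|lborel. step_kernel yk (fst z) x' (snd z) * \<rho> x' (snd z)) \<in> borel_measurable state_param"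
  using kern.push_measurable[OF rho_measurable] by (simp add: filter_push_def split_beta')

lemma predict_lik_measurable:
  "predict_lik \<Phi> h \<Sigma> \<Gamma> yk \<rho> \<in> borel_measurable (lebesgue_param \<Theta>)"
proof -
  have "(\<lambda>(t, x). LINT x'|lborel. step_kernel yk x x' t * \<rho> x' t) \<in> borel_measurable (lebesgue_param \<Theta> \<Otimes>\<^sub>M lborel)"
    using measurable_compose[OF measurable_pair_swap' filter_numerator_measurable] by (simp add: split_beta')
  from lborel.borel_measurable_lebesgue_integral[OF this]
  show ?thesis by (simp add: predict_lik_eq[abs_def])
qed

lemma filter_state_density:
  assumes t: "t \<in> \<Theta>"
  shows "prob_density lborel (\<lambda>x. filter_state \<Phi> h \<Sigma> \<Gamma> yk \<rho> x t)"
proof -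
  have t': "t \<in> space (lebesgue_param \<Theta>)" using t by simp
  show ?thesis
    unfolding filter_state_def filter_numerator predict_lik_eq
    using kern.fibre_integral[OF t' rho_density[OF t]]
    by (intro prob_density_normalize) auto
qed

lemma filter_state_measurable:
  "(\<lambda>(x, t). filter_state \<Phi> h \<Sigma> \<Gamma> yk \<rho> x t) \<in> borel_measurable state_param"
  unfolding filter_state_def filter_numerator split_beta'
  by (intro borel_measurable_divide filter_numerator_measurable
      measurable_compose[OF measurable_snd predict_lik_measurable])

lemma filter_param_density:
  "prob_density (lebesgue_param \<Theta>) (filter_param \<Theta> \<Phi> h \<Sigma> \<Gamma> yk \<rho> \<nu>)"
  unfolding filter_param_def[abs_def]
  using predict_lik_pos predict_lik_le
  by (intro prob_density_reweight(2)[OF nu predict_lik_measurable, of "lik_bound Ct"]) simp_all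

text \<open>The predictive likelihood at the parameter is the denominator of the state update and a
  factor of the parameter update. It is positive and cancels, so filtering the two factors
  separately is one step of the joint kernel applied to their product.\<close>

lemma filter_product_eq_push:
  assumes z: "z \<in> space state_param"
  shows "filter_state \<Phi> h \<Sigma> \<Gamma> yk \<rho> (fst z) (snd z) * filter_param \<Theta> \<Phi> h \<Sigma> \<Gamma> yk \<rho> \<nu> (snd z)
    = filter_push yk (\<lambda>(x, t). \<rho> x t * \<nu> t) z
      / (LINT t|lebesgue_param \<Theta>. \<nu> t * predict_lik \<Phi> h \<Sigma> \<Gamma> yk \<rho> t)"
proof -
  have "snd z \<in> \<Theta>" using z by (auto simp: space_pair_measure)
  then have "predict_lik \<Phi> h \<Sigma> \<Gamma> yk \<rho> (snd z) \<noteq> 0"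
    using predict_lik_pos by (simp add: less_le)
  moreover have "filter_push yk (\<lambda>(x, t). \<rho> x t * \<nu> t) z
      = (LINT x'|lborel. step_kernel yk (fst z) x' (snd z) * \<rho> x' (snd z)) * \<nu> (snd z)"
    by (simp add: filter_push_def split_beta' flip: mult.assoc)
  ultimately show ?thesis
    by (simp add: filter_state_def filter_param_def filter_numerator)
qed

end

section \<open>The unnormalised posterior as an extended-valued path integral\<close>

lemma path_density_upd_measurable:
  "(\<lambda>(z, x'). path_density \<Phi> h \<Sigma> \<Gamma> p0 k (x'(k := fst z)) (snd z) y)
    \<in> borel_measurable (state_param \<Otimes>\<^sub>M (\<Pi>\<^sub>M i\<in>{..<k}. lborel))"
  unfolding split_beta'
proof (rule path_density_comp)
  let ?M = "state_param \<Otimes>\<^sub>M (\<Pi>\<^sub>M i\<in>{..<k}. lborel :: (real^'n) measure)"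
  show "(\<lambda>z. ((snd z)(k := fst (fst z))) i) \<in> borel_measurable ?M" if "i \<le> k" for i
  proof (cases "i = k")
    case True
    have "(\<lambda>z. fst (fst z)) \<in> ?M \<rightarrow>\<^sub>M lborel"
      by (rule measurable_compose[OF measurable_fst measurable_fst])
    then show ?thesis by (simp add: True)
  next
    case False
    then have "(\<lambda>z. snd z i) \<in> ?M \<rightarrow>\<^sub>M lborel"
      using that by (intro measurable_compose[OF measurable_snd measurable_component_singleton]) simp
    then show ?thesis using False by simp
  qed
  show "(\<lambda>z. snd (fst z)) \<in> ?M \<rightarrow>\<^sub>M lebesgue_param \<Theta>"
    by (rule measurable_compose[OF measurable_fst measurable_snd])
qed simp

lemma path_mass_measurable: "path_mass y k \<in> borel_measurable state_param"
proof -
  interpret n: product_sigma_finite "\<lambda>_::nat. lborel :: (real^'n) measure" ..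
  interpret Pn: sigma_finite_measure "\<Pi>\<^sub>M i\<in>{..<k}. lborel :: (real^'n) measure"
    by (rule n.sigma_finite) simp
  have "(\<lambda>(z, x'). ennreal (path_density \<Phi> h \<Sigma> \<Gamma> p0 k (x'(k := fst z)) (snd z) y))
    \<in> borel_measurable (state_param \<Otimes>\<^sub>M (\<Pi>\<^sub>M i\<in>{..<k}. lborel))"
    using measurable_compose[OF path_density_upd_measurable measurable_ennreal] by (simp add: split_beta')
  from Pn.borel_measurable_nn_integral[OF this] show ?thesis
    by (simp add: path_mass_def[abs_def])
qed

text \<open>Valid also where the path mass is infinite: \<open>enn2real\<close> and the Bochner
  integral are both 0 there.\<close>

lemma joint_density_eq_path_mass:
  assumes "z \<in> space state_param"
  shows "joint_density \<Phi> h \<Sigma> \<Gamma> p0 k (fst z) (snd z) y = enn2real (path_mass y k z)"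
  unfolding joint_density_def path_mass_def
proof (rule integral_eq_nn_integral)
  show "(\<lambda>x'. path_density \<Phi> h \<Sigma> \<Gamma> p0 k (x'(k := fst z)) (snd z) y) \<in> borel_measurable (\<Pi>\<^sub>M i\<in>{..<k}. lborel)"
    using measurable_compose[OF measurable_Pair1'[OF assms] path_density_upd_measurable] by simp
  show "AE x' in \<Pi>\<^sub>M i\<in>{..<k}. lborel. 0 \<le> path_density \<Phi> h \<Sigma> \<Gamma> p0 k (x'(k := fst z)) (snd z) y"
    using assms by (intro AE_I2 path_density_nonneg) (auto simp: space_pair_measure)
qed

lemma path_mass_0: "path_mass y 0 z = ennreal (p0 (fst z) (snd z))"
  by (simp add: path_mass_def path_density_def PiM_empty nn_integral_count_space_finite)

text \<open>Prediction and update for the unnormalised density. The path density at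
  \<open>Suc k\<close> is that at k times the last transition and the last observation, which
  involve the states at times k and \<open>Suc k\<close> only.\<close>

lemma path_mass_Suc:
  assumes z: "z \<in> space state_param"
  shows "path_mass y (Suc k) z
    = (\<integral>\<^sup>+x'. ennreal (step_kernel (y (Suc k)) (fst z) x' (snd z)) * path_mass y k (x', snd z) \<partial>lborel)"
proof -
  interpret n: product_sigma_finite "\<lambda>_::nat. lborel :: (real^'n) measure" ..
  have t: "snd z \<in> \<Theta>" using z by (auto simp: space_pair_measure)
  let ?K = "step_kernel (y (Suc k))"
  let ?p = "path_density \<Phi> h \<Sigma> \<Gamma> p0"
  have ins: "{..<Suc k} = insert k {..<k}" by auto
  have upd: "?p (Suc k) ((v(k := x'))(Suc k := fst z)) (snd z) y = ?K (fst z) x' (snd z) * ?p k (v(k := x')) (snd z) y"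
    for v x'
  proof -
    have "(\<Prod>i<k. mvn_density (((v(k := x'))(Suc k := fst z)) (Suc i)) (\<Phi> (((v(k := x'))(Suc k := fst z)) i) (snd z)) (\<Sigma> (snd z)))
        = (\<Prod>i<k. mvn_density ((v(k := x')) (Suc i)) (\<Phi> ((v(k := x')) i) (snd z)) (\<Sigma> (snd z)))"
      "(\<Prod>i=1..k. mvn_density (y i) (h (((v(k := x'))(Suc k := fst z)) i) (snd z)) (\<Gamma> (snd z)))
        = (\<Prod>i=1..k. mvn_density (y i) (h ((v(k := x')) i) (snd z)) (\<Gamma> (snd z)))"
      by (auto intro!: prod.cong)
    then show ?thesis
      by (simp add: path_density_def step_kernel_def)
  qed
  have "(\<lambda>v. ennreal (?p (Suc k) (v(Suc k := fst z)) (snd z) y)) \<in> borel_measurable (\<Pi>\<^sub>M i\<in>{..<Suc k}. lborel)"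
    using measurable_compose[OF measurable_Pair1'[OF z] measurable_compose[OF path_density_upd_measurable measurable_ennreal]]
    by simp
  \<comment> \<open>Coordinate k is split off as the outer integral; its value x' is the old state
    in the kernel, while \<open>fst z\<close> is the state at time \<open>Suc k\<close>.\<close>
  then have "path_mass y (Suc k) z
      = (\<integral>\<^sup>+x'. \<integral>\<^sup>+v. ennreal (?p (Suc k) ((v(k := x'))(Suc k := fst z)) (snd z) y) \<partial>(\<Pi>\<^sub>M i\<in>{..<k}. lborel) \<partial>lborel)"
    unfolding path_mass_def by (rule n.product_nn_integral_insert_rev[of "{..<k}" k, folded ins, rotated 2]) simp_all
  also have "\<dots> = (\<integral>\<^sup>+x'. ennreal (?K (fst z) x' (snd z)) * path_mass y k (x', snd z) \<partial>lborel)"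
  proof (rule nn_integral_cong)
    fix x' :: "real^'n"
    have z': "(x', snd z) \<in> space state_param" using t by (simp add: space_pair_measure)
    have m: "(\<lambda>v. ennreal (?p k (v(k := x')) (snd z) y)) \<in> borel_measurable (\<Pi>\<^sub>M i\<in>{..<k}. lborel)"
      using measurable_compose[OF measurable_Pair1'[OF z'] measurable_compose[OF path_density_upd_measurable measurable_ennreal]]
      by simp
    have "(\<integral>\<^sup>+v. ennreal (?p (Suc k) ((v(k := x'))(Suc k := fst z)) (snd z) y) \<partial>(\<Pi>\<^sub>M i\<in>{..<k}. lborel))
       = (\<integral>\<^sup>+v. ennreal (?K (fst z) x' (snd z)) * ennreal (?p k (v(k := x')) (snd z) y) \<partial>(\<Pi>\<^sub>M i\<in>{..<k}. lborel))"
      unfolding upd using step_kernel_pos[OF t] by (intro nn_integral_cong ennreal_mult') (simp add: less_imp_le)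
    also have "\<dots> = ennreal (?K (fst z) x' (snd z)) * path_mass y k (x', snd z)"
      using m by (simp add: nn_integral_cmult path_mass_def)
    finally show "(\<integral>\<^sup>+v. ennreal (?p (Suc k) ((v(k := x'))(Suc k := fst z)) (snd z) y) \<partial>(\<Pi>\<^sub>M i\<in>{..<k}. lborel))
      = ennreal (?K (fst z) x' (snd z)) * path_mass y k (x', snd z)" .
  qed
  finally show ?thesis .
qed

text \<open>Each step multiplies the total mass by at most \<open>lik_bound Ct\<close> and, the
  kernel being positive, cannot turn a nonzero mass into 0. Division by the evidence is thus
  legitimate for every data sequence.\<close>

lemma path_mass_integral:
  "(\<integral>\<^sup>+z. path_mass y k z \<partial>state_param) \<noteq> \<infinity> \<and> (\<integral>\<^sup>+z. path_mass y k z \<partial>state_param) \<noteq> 0"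
proof (induction k)
  case 0
  show ?case
    using prob_density_nn_integral[OF prior_density] by (simp add: path_mass_0 split_beta')
next
  case (Suc k)
  interpret kern: state_kernel lborel "lebesgue_param \<Theta>" "step_kernel (y (Suc k))" "lik_bound Ct"
    by (rule state_kernel_step)
  have eq: "(\<integral>\<^sup>+z. path_mass y (Suc k) z \<partial>state_param)
      = (\<integral>\<^sup>+z. \<integral>\<^sup>+x'. ennreal (step_kernel (y (Suc k)) (fst z) x' (snd z)) * path_mass y k (x', snd z) \<partial>lborel \<partial>state_param)"
    by (rule nn_integral_cong) (rule path_mass_Suc)
  show ?case
    using kern.nn_integral_push_le[OF path_mass_measurable[of k]] kern.nn_integral_push_eq_0[OF path_mass_measurable[of k]] Suc
    by (auto simp: eq top_unique ennreal_mult_eq_top_iff)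
qed

lemma AE_path_mass_finite: "AE z in state_param. path_mass y k z \<noteq> \<infinity>"
  using path_mass_measurable path_mass_integral by (intro nn_integral_PInf_AE) auto

section \<open>The posterior recursion\<close>

abbreviation ev where "ev k \<equiv> evidence \<Theta> \<Phi> h \<Sigma> \<Gamma> p0 k y"
abbreviation joint where "joint k \<equiv> (\<lambda>(x, t). joint_density \<Phi> h \<Sigma> \<Gamma> p0 k x t y)"
abbreviation post where "post k \<equiv> (\<lambda>(x, t). posterior \<Theta> \<Phi> h \<Sigma> \<Gamma> p0 k y x t)"

lemma joint_nonneg: "z \<in> space state_param \<Longrightarrow> 0 \<le> joint k z"
  by (auto simp: space_pair_measure joint_density_nonneg)

lemma joint_measurable: "joint k \<in> borel_measurable state_param"
proof -
  have "joint k \<in> borel_measurable state_param \<longleftrightarrow> (\<lambda>z. enn2real (path_mass y k z)) \<in> borel_measurable state_param"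
    by (rule measurable_cong) (simp add: split_beta' joint_density_eq_path_mass)
  then show ?thesis using path_mass_measurable by simp
qed

lemma joint_nn_integral: "(\<integral>\<^sup>+z. ennreal (joint k z) \<partial>state_param) = (\<integral>\<^sup>+z. path_mass y k z \<partial>state_param)"
proof (rule nn_integral_cong_AE)
  show "AE z in state_param. ennreal (joint k z) = path_mass y k z"
    using AE_path_mass_finite[of k] AE_space[of state_param]
    by eventually_elim (simp add: split_beta' joint_density_eq_path_mass top.not_eq_extremum)
qed

lemma joint_integrable: "integrable state_param (joint k)"
  and evidence_pos: "0 < ev k"
proof -
  have fin: "(\<integral>\<^sup>+z. ennreal (joint k z) \<partial>state_param) \<noteq> \<infinity>"
    and ne: "(\<integral>\<^sup>+z. ennreal (joint k z) \<partial>state_param) \<noteq> 0"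
    using path_mass_integral[of k] unfolding joint_nn_integral by auto
  show "integrable state_param (joint k)"
    by (rule ennreal_integral_of_finite(1)[OF joint_measurable joint_nonneg fin])
  have "ennreal (ev k) = (\<integral>\<^sup>+z. ennreal (joint k z) \<partial>state_param)"
    unfolding evidence_def by (rule ennreal_integral_of_finite(2)[OF joint_measurable joint_nonneg fin])
  then show "0 < ev k"
    using ne by (metis ennreal_eq_0_iff not_le)
qed

lemma posterior_density: "prob_density state_param (post k)"
proof -
  have "prob_density state_param (\<lambda>z. joint k z / integral\<^sup>L state_param (joint k))"
    using evidence_pos[of k] unfolding evidence_def
    by (intro prob_density_normalize joint_integrable joint_nonneg)
  then show ?thesis
    by (simp add: posterior_def evidence_def split_beta')
qed

text \<open>At a point where the path mass at \<open>Suc k\<close> is finite, the path mass at k is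
  finite for almost every old state and agrees there with the joint density. This turns
  \<open>path_mass_Suc\<close> into an identity of Bochner integrals; dividing by the evidences
  leaves the ratio \<open>ev (Suc k) / ev k\<close>.\<close>

lemma AE_posterior_Suc:
  "AE z in state_param. post (Suc k) z = filter_push (y (Suc k)) (post k) z / (ev (Suc k) / ev k)"
  using AE_path_mass_finite[of "Suc k"] AE_space[of state_param]
proof eventually_elim
  case (elim z)
  then have z: "z \<in> space state_param" and t: "snd z \<in> \<Theta>" by (auto simp: space_pair_measure)
  have z': "(x', snd z) \<in> space state_param" for x' :: "real^'n" using t by (simp add: space_pair_measure)
  let ?K = "\<lambda>x'. step_kernel (y (Suc k)) (fst z) x' (snd z)"
  have pm: "(\<lambda>x'. path_mass y k (x', snd z)) \<in> borel_measurable lborel"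
    using t by (intro measurable_compose[OF measurable_Pair2' path_mass_measurable]) simp
  have jm: "(\<lambda>x'. joint k (x', snd z)) \<in> borel_measurable lborel"
    using t by (intro measurable_compose[OF measurable_Pair2' joint_measurable]) simp
  have Km: "?K \<in> borel_measurable lborel"
    using t by (intro step_kernel_comp) simp_all
  have "AE x' in lborel. ennreal (?K x') * path_mass y k (x', snd z) \<noteq> \<infinity>"
    using elim(1) unfolding path_mass_Suc[OF z]
    by (intro nn_integral_PInf_AE borel_measurable_times_ennreal pm measurable_compose[OF Km measurable_ennreal])
  then have "AE x' in lborel. ennreal (?K x') * path_mass y k (x', snd z) = ennreal (?K x' * joint k (x', snd z))"
  proof eventually_elim
    case (elim x')
    \<comment> \<open>A finite product with a nonzero factor has its other factor finite; a factor 0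
      would allow 0 * \<infinity> = 0.\<close>
    have "ennreal (?K x') \<noteq> 0" using step_kernel_pos[OF t] by (simp add: ennreal_eq_0_iff not_le)
    with elim have "path_mass y k (x', snd z) \<noteq> \<infinity>" by (auto simp: ennreal_mult_eq_top_iff)
    then have "path_mass y k (x', snd z) = ennreal (joint k (x', snd z))"
      using joint_density_eq_path_mass[OF z'] by (simp add: top.not_eq_extremum)
    then show ?case
      using step_kernel_pos[OF t] by (simp add: ennreal_mult' less_imp_le)
  qed
  then have "path_mass y (Suc k) z = (\<integral>\<^sup>+x'. ennreal (?K x' * joint k (x', snd z)) \<partial>lborel)"
    unfolding path_mass_Suc[OF z] by (rule nn_integral_cong_AE)
  then have "joint (Suc k) z = enn2real (\<integral>\<^sup>+x'. ennreal (?K x' * joint k (x', snd z)) \<partial>lborel)"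
    using joint_density_eq_path_mass[OF z] by (simp add: split_beta')
  also have "\<dots> = (LINT x'|lborel. ?K x' * joint k (x', snd z))"
    using step_kernel_pos[OF t] joint_nonneg[OF z'] jm Km
    by (intro integral_eq_nn_integral[symmetric] AE_I2 mult_nonneg_nonneg borel_measurable_times) (auto intro: less_imp_le)
  finally have J: "joint (Suc k) z = (LINT x'|lborel. ?K x' * joint k (x', snd z))" .
  have "filter_push (y (Suc k)) (post k) z = joint (Suc k) z / ev k"
    unfolding J by (simp add: filter_push_def split_beta' posterior_def)
  then show ?case
    using evidence_pos[of k] by (simp add: posterior_def split_beta')
qed

lemma AE_posterior_0: "AE z in state_param. post 0 z = p0 (fst z) (snd z)"
proof (rule AE_I2)
  have j: "joint 0 z = p0 (fst z) (snd z)" if "z \<in> space state_param" for z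
    using joint_density_eq_path_mass[OF that, of 0] p0_nonneg[of "snd z"] that
    by (auto simp: path_mass_0 split_beta' space_pair_measure)
  have "ev 0 = (LINT z|state_param. p0 (fst z) (snd z))"
    unfolding evidence_def by (rule Bochner_Integration.integral_cong) (simp_all add: j)
  also have "\<dots> = 1"
    using prob_density_integral[OF prior_density] by (simp add: split_beta')
  finally show "post 0 z = p0 (fst z) (snd z)" if "z \<in> space state_param" for z
    using j[OF that] by (simp add: posterior_def split_beta')
qed

section \<open>Propagation of the approximation error\<close>

context
  fixes \<rho> :: "nat \<Rightarrow> real^'n \<Rightarrow> real^'d \<Rightarrow> real" and \<nu> :: "nat \<Rightarrow> real^'d \<Rightarrow> real"
  assumes rho: "\<And>j. cond_density \<Theta> (\<rho> j)"
    and nu: "\<And>j. prob_density (lebesgue_param \<Theta>) (\<nu> j)"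
    and init: "AE (x, t) in state_param. \<rho> 0 x t * \<nu> 0 t = p0 x t"
begin

interpretation pair_sigma_finite "lborel :: (real^'n) measure" "lebesgue_param \<Theta>"
  by (intro pair_sigma_finite.intro sigma_finite_lborel sigma_finite_param)

lemma approx_density: "prob_density state_param (approx \<rho> \<nu> k)"
  unfolding approx_def using rho_density[OF rho nu]
  by (intro prob_density_mult rho_measurable[OF rho nu] nu) simp

lemma filtered_density: "prob_density state_param (filtered y \<rho> \<nu> k)"
  unfolding filtered_def using filter_state_density[OF rho nu]
  by (intro prob_density_mult filter_state_measurable[OF rho nu] filter_param_density[OF rho nu]) simp

text \<open>Turns the sum of state and parameter divergence into the single integral to which
  \<open>tv_dist_le_kl_integrand\<close> and \<open>hellinger_dist_le_kl_integrand\<close>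
  apply.\<close>

lemma local_error_eq:
  "local_error y \<rho> \<nu> k = ennsqrt (\<integral>\<^sup>+z. kl_integrand (approx \<rho> \<nu> k z) (filtered y \<rho> \<nu> k z) \<partial>state_param)"
proof -
  have "KL state_param (approx \<rho> \<nu> k) (filtered y \<rho> \<nu> k)
      = (\<integral>\<^sup>+t. ennreal (\<nu> k t) * KL lborel (\<lambda>x. \<rho> k x t) (\<lambda>x. filter_state \<Phi> h \<Sigma> \<Gamma> (y k) (\<rho> (k - 1)) x t)
          \<partial>lebesgue_param \<Theta>)
        + KL (lebesgue_param \<Theta>) (\<nu> k) (filter_param \<Theta> \<Phi> h \<Sigma> \<Gamma> (y k) (\<rho> (k - 1)) (\<nu> (k - 1)))"
    unfolding approx_def filtered_def
    by (intro KL_chain_rule rho_measurable[OF rho nu] filter_state_measurable[OF rho nu] nu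
        filter_param_density[OF rho nu]) (use rho_density[OF rho nu] filter_state_density[OF rho nu] in simp_all)
  then show ?thesis
    by (simp only: local_error_def KL_eq_nn_integral[OF approx_density filtered_density, symmetric])
qed

lemma AE_filtered_Suc:
  "AE z in state_param. filtered y \<rho> \<nu> (Suc k) z = filter_push (y (Suc k)) (approx \<rho> \<nu> k) z
     / (LINT t|lebesgue_param \<Theta>. \<nu> k t * predict_lik \<Phi> h \<Sigma> \<Gamma> (y (Suc k)) (\<rho> k) t)"
  using filter_product_eq_push[OF rho nu, of _ "y (Suc k)"]
  by (intro AE_I2) (simp add: filtered_def approx_def split_beta')

lemma AE_post_0_eq_approx: "AE z in state_param. post 0 z = approx \<rho> \<nu> 0 z"
  using init AE_posterior_0 by eventually_elim (simp add: approx_def split_beta')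

lemma tv_error_Suc:
  "tv_dist state_param (post (Suc k)) (approx \<rho> \<nu> (Suc k))
    \<le> lik_bound Ct / (ev (Suc k) / ev k) * tv_dist state_param (post k) (approx \<rho> \<nu> k)
      + tv_dist state_param (filtered y \<rho> \<nu> (Suc k)) (approx \<rho> \<nu> (Suc k))"
proof -
  have "tv_dist state_param (post (Suc k)) (filtered y \<rho> \<nu> (Suc k))
      \<le> lik_bound Ct / (ev (Suc k) / ev k) * tv_dist state_param (post k) (approx \<rho> \<nu> k)"
    by (rule state_kernel.tv_dist_step[OF state_kernel_step posterior_density approx_density
          posterior_density filtered_density AE_posterior_Suc AE_filtered_Suc])
  with tv_dist_triangle[OF posterior_density filtered_density approx_density, of "Suc k" "Suc k" "Suc k"]
  show ?thesis by simp
qed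

lemma hellinger_error_Suc:
  "hellinger_dist state_param (post (Suc k)) (approx \<rho> \<nu> (Suc k))
    \<le> 2 * sqrt (lik_bound Ct / (ev (Suc k) / ev k)) * hellinger_dist state_param (post k) (approx \<rho> \<nu> k)
      + hellinger_dist state_param (filtered y \<rho> \<nu> (Suc k)) (approx \<rho> \<nu> (Suc k))"
proof -
  have "hellinger_dist state_param (post (Suc k)) (filtered y \<rho> \<nu> (Suc k))
      \<le> 2 * sqrt (lik_bound Ct / (ev (Suc k) / ev k)) * hellinger_dist state_param (post k) (approx \<rho> \<nu> k)"
    by (rule state_kernel.hellinger_dist_step[OF state_kernel_step posterior_density approx_density
          posterior_density filtered_density AE_posterior_Suc AE_filtered_Suc])
  with hellinger_dist_triangle[OF posterior_density filtered_density approx_density, of "Suc k" "Suc k" "Suc k"]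
  show ?thesis by simp
qed

lemma tv_error_bound:
  "ennreal (tv_dist state_param (post k) (approx \<rho> \<nu> k))
    \<le> (\<Sum>j=1..k. ennreal (lik_bound Ct ^ (k - j) / (sqrt 2 * (ev k / ev j))) * local_error y \<rho> \<nu> j)"
proof (rule error_recursion[where a="\<lambda>k. tv_dist state_param (post k) (approx \<rho> \<nu> k)"
      and b="\<lambda>k. lik_bound Ct / (ev (Suc k) / ev k)" and e="local_error y \<rho> \<nu>"
      and l="\<lambda>k. tv_dist state_param (filtered y \<rho> \<nu> k) (approx \<rho> \<nu> k)"
      and c="\<lambda>j k. lik_bound Ct ^ (k - j) / (sqrt 2 * (ev k / ev j))"])
  note [measurable] = prob_density_measurable[OF posterior_density] prob_density_measurable[OF approx_density]
  \<comment> \<open>The approximation starts from the exact prior, hence the sum begins at j =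
    1.\<close>
  have "tv_dist state_param (post 0) (approx \<rho> \<nu> 0) = tv_dist state_param (approx \<rho> \<nu> 0) (approx \<rho> \<nu> 0)"
    by (rule tv_dist_cong_AE[OF AE_post_0_eq_approx]) simp_all
  then show "tv_dist state_param (post 0) (approx \<rho> \<nu> 0) = 0"
    by (simp add: tv_dist_def)
  show "0 \<le> lik_bound Ct / (ev (Suc k) / ev k)" for k
    using lik_bound_pos[OF Ct_pos] evidence_pos[of k] evidence_pos[of "Suc k"] by simp
  \<comment> \<open>The diagonal coefficient: the exponent is 0 and the evidence ratio is 1, which
    leaves the constant 1 / sqrt 2 of Pinsker's inequality.\<close>
  show "ennreal (tv_dist state_param (filtered y \<rho> \<nu> (Suc k)) (approx \<rho> \<nu> (Suc k)))
      \<le> ennreal (lik_bound Ct ^ (Suc k - Suc k) / (sqrt 2 * (ev (Suc k) / ev (Suc k)))) * local_error y \<rho> \<nu> (Suc k)" for k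
    using tv_dist_le_kl_integrand[OF approx_density filtered_density] evidence_pos[of "Suc k"]
    by (simp add: local_error_eq)
  show "lik_bound Ct ^ (Suc k - j) / (sqrt 2 * (ev (Suc k) / ev j))
      = lik_bound Ct / (ev (Suc k) / ev k) * (lik_bound Ct ^ (k - j) / (sqrt 2 * (ev k / ev j)))"
    if "j \<le> k" for j k
    using that evidence_pos[of k] evidence_pos[of j] evidence_pos[of "Suc k"]
    by (simp add: Suc_diff_le field_simps)
qed (rule tv_error_Suc tv_dist_nonneg)+

lemma hellinger_error_bound:
  "ennreal (hellinger_dist state_param (post k) (approx \<rho> \<nu> k))
    \<le> (\<Sum>j=1..k. ennreal (2 ^ (k - j) * sqrt (lik_bound Ct) ^ (k - j) / sqrt (2 * (ev k / ev j))) * local_error y \<rho> \<nu> j)"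
proof (rule error_recursion[where a="\<lambda>k. hellinger_dist state_param (post k) (approx \<rho> \<nu> k)"
      and b="\<lambda>k. 2 * sqrt (lik_bound Ct / (ev (Suc k) / ev k))" and e="local_error y \<rho> \<nu>"
      and l="\<lambda>k. hellinger_dist state_param (filtered y \<rho> \<nu> k) (approx \<rho> \<nu> k)"
      and c="\<lambda>j k. 2 ^ (k - j) * sqrt (lik_bound Ct) ^ (k - j) / sqrt (2 * (ev k / ev j))"])
  note [measurable] = prob_density_measurable[OF posterior_density] prob_density_measurable[OF approx_density]
  have "hellinger_dist state_param (post 0) (approx \<rho> \<nu> 0) = hellinger_dist state_param (approx \<rho> \<nu> 0) (approx \<rho> \<nu> 0)"
    by (rule hellinger_dist_cong_AE[OF AE_post_0_eq_approx]) simp_all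
  then show "hellinger_dist state_param (post 0) (approx \<rho> \<nu> 0) = 0"
    by (simp add: hellinger_dist_def)
  show "0 \<le> 2 * sqrt (lik_bound Ct / (ev (Suc k) / ev k))" for k
    using lik_bound_pos[OF Ct_pos] evidence_pos[of k] evidence_pos[of "Suc k"] by simp
  show "ennreal (hellinger_dist state_param (filtered y \<rho> \<nu> (Suc k)) (approx \<rho> \<nu> (Suc k)))
      \<le> ennreal (2 ^ (Suc k - Suc k) * sqrt (lik_bound Ct) ^ (Suc k - Suc k) / sqrt (2 * (ev (Suc k) / ev (Suc k))))
        * local_error y \<rho> \<nu> (Suc k)" for k
    using hellinger_dist_le_kl_integrand[OF approx_density filtered_density] evidence_pos[of "Suc k"]
    by (simp add: local_error_eq)
  \<comment> \<open>The evidence \<open>ev k\<close> cancels under the square root, and each step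
    contributes one more factor 2.\<close>
  show "2 ^ (Suc k - j) * sqrt (lik_bound Ct) ^ (Suc k - j) / sqrt (2 * (ev (Suc k) / ev j))
      = 2 * sqrt (lik_bound Ct / (ev (Suc k) / ev k))
        * (2 ^ (k - j) * sqrt (lik_bound Ct) ^ (k - j) / sqrt (2 * (ev k / ev j)))"
    if "j \<le> k" for j k
    using that evidence_pos[of k] evidence_pos[of j] evidence_pos[of "Suc k"]
    by (simp add: Suc_diff_le real_sqrt_mult real_sqrt_divide field_simps)
qed (rule hellinger_error_Suc hellinger_dist_nonneg)+

end

end

end

theorem theorem1:
  fixes M :: "'a measure"
    and \<Theta> :: "(real^'d) set"
    and \<Phi> :: "real^'n \<Rightarrow> real^'d \<Rightarrow> real^'n"
    and h :: "real^'n \<Rightarrow> real^'d \<Rightarrow> real^'r"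
    and \<Sigma> :: "real^'d \<Rightarrow> real^'n^'n"
    and \<Gamma> :: "real^'d \<Rightarrow> real^'r^'r"
    and p0 :: "real^'n \<Rightarrow> real^'d \<Rightarrow> real"
    and X :: "nat \<Rightarrow> 'a \<Rightarrow> real^'n"
    and \<theta> :: "'a \<Rightarrow> real^'d"
    and W :: "nat \<Rightarrow> 'a \<Rightarrow> real^'n"
    and V :: "nat \<Rightarrow> 'a \<Rightarrow> real^'r"
    and Y :: "nat \<Rightarrow> 'a \<Rightarrow> real^'r"
    and y :: "nat \<Rightarrow> real^'r"
    and \<rho> \<rho>s :: "nat \<Rightarrow> real^'n \<Rightarrow> real^'d \<Rightarrow> real"
    and \<nu> \<nu>s :: "nat \<Rightarrow> real^'d \<Rightarrow> real"
    and Ct :: real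
    and err :: "nat \<Rightarrow> ennreal"
    and k :: nat
  assumes model: "state_space_model M \<Theta> \<Phi> h \<Sigma> \<Gamma> p0 X \<theta> W V Y"
    and Ct: "Ct = (INF t\<in>\<Theta>. det (\<Gamma> t))" "0 < Ct"
    and rho: "\<And>j. cond_density \<Theta> (\<rho> j)"
    and nu: "\<And>j. prob_density (lebesgue_param \<Theta>) (\<nu> j)"
    and init: "AE (x, t) in lborel \<Otimes>\<^sub>M lebesgue_param \<Theta>. \<rho> 0 x t * \<nu> 0 t = p0 x t"
    and rho_star: "\<And>j. 1 \<le> j \<Longrightarrow> \<rho>s j = filter_state \<Phi> h \<Sigma> \<Gamma> (y j) (\<rho> (j - 1))"
    and nu_star: "\<And>j. 1 \<le> j \<Longrightarrow> \<nu>s j = filter_param \<Theta> \<Phi> h \<Sigma> \<Gamma> (y j) (\<rho> (j - 1)) (\<nu> (j - 1))"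
    and err: "\<And>j. 1 \<le> j \<Longrightarrow> err j = ennsqrt
        ((\<integral>\<^sup>+t. ennreal (\<nu> j t) * KL lborel (\<lambda>x. \<rho> j x t) (\<lambda>x. \<rho>s j x t) \<partial>lebesgue_param \<Theta>)
         + KL (lebesgue_param \<Theta>) (\<nu> j) (\<nu>s j))"
    and k: "1 \<le> k"
  shows
    "ennreal (tv_dist (lborel \<Otimes>\<^sub>M lebesgue_param \<Theta>)
        (\<lambda>(x, t). posterior \<Theta> \<Phi> h \<Sigma> \<Gamma> p0 k y x t) (\<lambda>(x, t). \<rho> k x t * \<nu> k t))
     \<le> (\<Sum>j=1..k-1.
          ennreal ((2 * pi) powr (- (real CARD('r) * real (k - j) / 2)) * Ct powr (- (real (k - j) / 2))
            / (sqrt 2 * cond_evidence \<Theta> \<Phi> h \<Sigma> \<Gamma> p0 j k y)) * err j)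
       + ennreal (1 / sqrt 2) * err k
     \<and>
     ennreal (hellinger_dist (lborel \<Otimes>\<^sub>M lebesgue_param \<Theta>)
        (\<lambda>(x, t). posterior \<Theta> \<Phi> h \<Sigma> \<Gamma> p0 k y x t) (\<lambda>(x, t). \<rho> k x t * \<nu> k t))
     \<le> (\<Sum>j=1..k-1.
          ennreal (2 ^ (k - j) * (2 * pi) powr (- (real CARD('r) * real (k - j) / 4))
            * Ct powr (- (real (k - j) / 4))
            / sqrt (2 * cond_evidence \<Theta> \<Phi> h \<Sigma> \<Gamma> p0 j k y)) * err j)
       + ennreal (1 / sqrt 2) * err k"
proof -
  interpret state_space_model M \<Theta> \<Phi> h \<Sigma> \<Gamma> p0 X \<theta> W V Y by (rule model)
  \<comment> \<open>The infimum over reals is a lower bound only for a set that is bounded below;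
    the determinants are positive, so 0 is such a bound.\<close>
  have Ct_le: "\<forall>t\<in>\<Theta>. Ct \<le> det (\<Gamma> t)"
    unfolding Ct(1)
  proof (intro ballI cINF_lower)
    show "bdd_below ((\<lambda>t. det (\<Gamma> t)) ` \<Theta>)"
      using pos_def_det_pos[OF Gamma_pos_def] by (intro bdd_belowI2[of _ 0]) (auto intro: less_imp_le)
  qed
  note ctx = Ct(2) Ct_le rho nu init
  have err_eq: "local_error y \<rho> \<nu> j = err j" if "1 \<le> j" for j
    unfolding local_error_def err[OF that] rho_star[OF that] nu_star[OF that] ..
  \<comment> \<open>The last term of the sum is the error made at time k itself, which the theorem
    states separately; k \<ge> 1 guarantees that it occurs.\<close>
  have split: "(\<Sum>j=1..k. c j * local_error y \<rho> \<nu> j) = (\<Sum>j=1..k-1. c j * err j) + c k * err k" for c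
    using k by (cases k) (simp_all add: err_eq)
  have pos: "0 < evidence \<Theta> \<Phi> h \<Sigma> \<Gamma> p0 k y"
    by (rule evidence_pos[OF Ct(2) Ct_le])
  note tv = tv_error_bound[where y=y and \<rho>=\<rho> and \<nu>=\<nu> and k=k, OF ctx]
    and hellinger = hellinger_error_bound[where y=y and \<rho>=\<rho> and \<nu>=\<nu> and k=k, OF ctx]
  show ?thesis
    using tv hellinger pos Ct(2)
    unfolding split lik_bound_power[OF Ct(2)] sqrt_lik_bound_power[OF Ct(2)] approx_def cond_evidence_def by (simp add: mult.assoc)
qed

end
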